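(* Let $\tau>0$ and let $\mu_0\in P(\mathbb{T}^d)$ with $S(\mu_0)<\infty$. For each $\varepsilon$ let $\mu_{\varepsilon,\tau}:(0,\infty)\to P(\mathbb{T}^d)$ be the solution of the $\varepsilon$-JKO scheme with initial value $\mu_0$, that is, $\mu_{\varepsilon,\tau}(t)=\mu_\varepsilon^n$ for $(n-1)\tau<t\le n\tau$, where $\mu^0_\varepsilon=\mu_0$ and, for $n\ge1$, $$\mu_\varepsilon^n=\arg\min_{\mu\in P(\mathbb{T}^d)}\ H_\varepsilon(\mu)+\frac1{2\tau}W_\varepsilon(\mu,\mu_\varepsilon^{n-1})^2 .$$ Let $\overline{\mu}_\tau(t)=\overline{\mu}^n$ for $(n-1)\tau<t\le n\tau$, where $\overline{\mu}^0=\mu_0$ and, for $n\ge1$, $$\overline{\mu}^n=\arg\min_{\mu\in P(\mathbb{T}^d)}\ H(\mu)+\frac1{2\tau}W_{\mathrm{GH}}(\mu,\overline{\mu}^{n-1})^2 .$$ Then for all $t\in(0,\infty)$, $\mu_{\varepsilon,\tau}(t)\to\overline{\mu}_\tau(t)$ in the $W_2$ distance as $\varepsilon\to0$.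
   Context: $\mathbb{T}^d=\mathbb{R}^d/\mathbb{Z}^d$ is the flat torus, $\langle\cdot,\cdot\rangle$ the Euclidean inner product, $P(\mathbb{T}^d)$ the set of Borel probability measures on $\mathbb{T}^d$. Standing assumptions on the data: $A:\mathbb{R}^d\to\mathbb{R}^{d\times d}$ is 1-periodic ($A(x+e_j)=A(x)$ for all $x$ and all standard basis vectors $e_j$), of class at least $C^2$, and there are constants $\Lambda_0,\Lambda_1>0$ with $\Lambda_0I\preceq A(x)\preceq\Lambda_1I$ for all $x$ ($\preceq$ is the Loewner order on symmetric matrices, so $A(x)$ is symmetric). The parameter $\varepsilon>0$ ranges over values for which $x\mapsto A(x/\varepsilon)$ is $\mathbb{Z}^d$-periodic, so that it defines a function on $\mathbb{T}^d$ (e.g. $\varepsilon=1/m$, $m\in\mathbb{N}$). The potentials satisfy $V_\varepsilon\in C^1(\mathbb{T}^d)$, $V_\varepsilon\ge0$, and there is $\lambda>0$ with $V_\varepsilon(x)\le\lambda$ and $|\nabla V_\varepsilon(x)|\le\lambda$ for all $x,\varepsilon$; and there is a function $V$ on $\mathbb{T}^d$ with $\sup_x|V_\varepsilon(x)-V(x)|\to0$ as $\varepsilon\to0$. Entropy: $S(\mu)=\int_{\mathbb{T}^d}\varrho\log\varrho\,dx$ if $d\mu=\varrho\,dx$, and $S(\mu)=\infty$ otherwise. $H_\varepsilon(\mu)=S(\mu)+\int V_\varepsilon\,d\mu$ and $H(\mu)=S(\mu)+\int V\,d\mu$. For a cost $c$ and $\mu,\nu\in P(\mathbb{T}^d)$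 put $W_c(\mu,\nu)=\inf\{\int c\,d\omega:\omega\in\Pi(\mu,\nu)\}^{1/2}$, with $\Pi(\mu,\nu)$ the set of couplings of $\mu,\nu$. $W_2$ uses $c=d_{\mathrm{Eu}}^2$, $d_{\mathrm{Eu}}(x,y)=\min_{k\in\mathbb{Z}^d}|x-y+k|$. $W_\varepsilon$ uses $c=c_\varepsilon$, and $W_{\mathrm{GH}}$ uses $c=c_{\mathrm{hom}}$, where, with minima over $z\in H^1([0,1];\mathbb{T}^d)$ with $z(0)=x$, $z(1)=y$, $$c_\varepsilon(x,y)=\min_z\int_0^1\langle A(z/\varepsilon)^{-1}\dot z,\dot z\rangle dt,\qquad c_{\mathrm{hom}}(x,y)=\min_z\int_0^1A_{\mathrm{hom}}(\dot z)\,dt,$$ $$A_{\mathrm{hom}}(\xi)=\liminf_{T\to\infty}\ \inf_{\varphi\in H^1_0([0,T];\mathbb{R}^d)}\frac1T\int_0^T\big\langle A(t\xi+\varphi)^{-1}(\xi+\dot\varphi),\xi+\dot\varphi\big\rangle dt,\quad \xi\in\mathbb{R}^d .$$ *)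

theory Defs
  imports "HOL-Probability.Probability"
begin

definition int_lattice :: "(real ^ 'n::finite) set"
  where "int_lattice = {k. \<forall>i. k $ i \<in> \<int>}"

lemma zero_in_int_lattice: "0 \<in> int_lattice"
  by (simp add: int_lattice_def)

lemma int_lattice_uminus: "k \<in> int_lattice \<Longrightarrow> - k \<in> int_lattice"
  by (simp add: int_lattice_def)

lemma int_lattice_add: "k \<in> int_lattice \<Longrightarrow> l \<in> int_lattice \<Longrightarrow> k + l \<in> int_lattice"
  by (simp add: int_lattice_def)

definition torus_rel :: "real ^ 'n::finite \<Rightarrow> real ^ 'n \<Rightarrow> bool"
  where "torus_rel x y \<longleftrightarrow> x - y \<in> int_lattice"

lemma equivp_torus_rel: "equivp torus_rel"
proof (rule equivpI)
  show "reflp torus_rel"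
    by (auto simp: reflp_def torus_rel_def zero_in_int_lattice)
  show "symp torus_rel"
    unfolding symp_def torus_rel_def by (metis int_lattice_uminus minus_diff_eq)
  show "transp torus_rel"
    unfolding transp_def torus_rel_def by (metis diff_add_cancel add_diff_eq int_lattice_add)
qed

quotient_type (overloaded) 'n torus = "real ^ 'n::finite" / torus_rel
  morphisms rep_torus proj_torus
  by (rule equivp_torus_rel)

instantiation torus :: (finite) topological_space
begin

definition open_torus :: "'a torus set \<Rightarrow> bool"
  where "open_torus U \<longleftrightarrow> open (proj_torus -` U)"

instance
  by standard (auto simp: open_torus_def vimage_Union)

end

lemma norm_lattice_translates:
  assumes "torus_rel x x'" "torus_rel y y'"
  shows "(\<lambda>k. norm (x - y + k)) ` int_lattice \<subseteq> (\<lambda>k. norm (x' - y' + k)) ` int_lattice"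
proof
  fix r assume "r \<in> (\<lambda>k. norm (x - y + k)) ` int_lattice"
  then obtain k where k: "k \<in> int_lattice" "r = norm (x - y + k)" by auto
  have "(x - x') + - (y - y') + k \<in> int_lattice"
    using assms k by (intro int_lattice_add int_lattice_uminus) (auto simp: torus_rel_def)
  moreover have "r = norm (x' - y' + ((x - x') + - (y - y') + k))"
    by (simp add: k algebra_simps)
  ultimately show "r \<in> (\<lambda>k. norm (x' - y' + k)) ` int_lattice" by blast
qed

lift_definition d_Eu :: "'n::finite torus \<Rightarrow> 'n torus \<Rightarrow> real"
  is "\<lambda>x y. INF k\<in>int_lattice. norm (x - y + k)"
proof -
  fix x x' y y' :: "real ^ 'n"
  assume *: "torus_rel x x'" "torus_rel y y'"
  then have "torus_rel x' x" "torus_rel y' y"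
    using equivp_symp[OF equivp_torus_rel] by auto
  from norm_lattice_translates[OF *] norm_lattice_translates[OF this]
  have "(\<lambda>k. norm (x - y + k)) ` int_lattice = (\<lambda>k. norm (x' - y' + k)) ` int_lattice"
    by (rule subset_antisym)
  then show "(INF k\<in>int_lattice. norm (x - y + k)) = (INF k\<in>int_lattice. norm (x' - y' + k))"
    by simp
qed

definition torus_lebesgue :: "'n::finite torus measure"
  where "torus_lebesgue =
    distr (restrict_space lborel {x :: real ^ 'n. \<forall>i. 0 \<le> x $ i \<and> x $ i < 1}) borel proj_torus"

definition C1_map :: "('a::real_normed_vector \<Rightarrow> 'b::real_normed_vector) \<Rightarrow> bool"
  where "C1_map f \<longleftrightarrow> (\<exists>f'. (\<forall>x. (f has_derivative blinfun_apply (f' x)) (at x)) \<and>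
    continuous_on UNIV f')"

definition C2_map :: "('a::real_normed_vector \<Rightarrow> 'b::real_normed_vector) \<Rightarrow> bool"
  where "C2_map f \<longleftrightarrow> (\<exists>f'. (\<forall>x. (f has_derivative blinfun_apply (f' x)) (at x)) \<and> C1_map f')"

definition loewner_le :: "real ^ 'n ^ 'n \<Rightarrow> real ^ 'n ^ 'n::finite \<Rightarrow> bool"
  where "loewner_le B C \<longleftrightarrow> transpose B = B \<and> transpose C = C \<and>
    (\<forall>\<xi>. \<xi> \<bullet> (B *v \<xi>) \<le> \<xi> \<bullet> (C *v \<xi>))"

definition lattice_periodic :: "(real ^ 'n::finite \<Rightarrow> 'b) \<Rightarrow> bool"
  where "lattice_periodic f \<longleftrightarrow> (\<forall>x j. f (x + axis j 1) = f x)"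

text \<open>
  \<open>H1_path T z g\<close>: the curve \<open>z\<close> belongs to \<open>H\<^sup>1([0,T]; \<real>\<^sup>n)\<close> and \<open>g\<close> is its weak derivative.
  In one dimension this means that (the continuous representative of) \<open>z\<close> is a primitive of a
  square integrable function; \<open>g\<close> is determined by \<open>z\<close> up to null sets.
\<close>

definition H1_path :: "real \<Rightarrow> (real \<Rightarrow> real ^ 'n::finite) \<Rightarrow> (real \<Rightarrow> real ^ 'n) \<Rightarrow> bool"
  where "H1_path T z g \<longleftrightarrow>
    set_borel_measurable lborel {0..T} g \<and>
    set_integrable lborel {0..T} (\<lambda>t. (norm (g t))\<^sup>2) \<and>
    (\<forall>t\<in>{0..T}. z t = z 0 + (LINT s:{0..t}|lborel. g s))"

text \<open>
  Curves in \<open>H\<^sup>1([0,1]; \<T>)\<close> with \<open>\<T>\<close> the torus are represented by their lifts to \<open>\<real>\<^sup>n\<close>. Since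
  \<open>x \<mapsto> A (x / \<epsilon>)\<close> is lattice periodic for the admissible \<open>\<epsilon>\<close>, the energy does not depend on the lift.
\<close>

definition cost_eps ::
  "(real ^ 'n \<Rightarrow> real ^ 'n ^ 'n) \<Rightarrow> real \<Rightarrow> 'n::finite torus \<Rightarrow> 'n torus \<Rightarrow> real"
  where "cost_eps A \<epsilon> x y =
    Inf {LINT t:{0..1}|lborel. (matrix_inv (A (z t /\<^sub>R \<epsilon>)) *v g t) \<bullet> g t | z g.
      H1_path 1 z g \<and> proj_torus (z 0) = x \<and> proj_torus (z 1) = y}"

text \<open>
  The lower limit is formed in the extended reals. It is finite for uniformly elliptic bounded \<open>A\<close>,
  as the averaged energies then lie between two positive multiples of \<open>(norm \<xi>)\<^sup>2\<close>.
\<close>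

definition A_hom :: "(real ^ 'n \<Rightarrow> real ^ 'n ^ 'n) \<Rightarrow> real ^ 'n::finite \<Rightarrow> real"
  where "A_hom A \<xi> = real_of_ereal (Liminf at_top (\<lambda>T. ereal (
    Inf {1 / T * (LINT t:{0..T}|lborel.
            (matrix_inv (A (t *\<^sub>R \<xi> + \<phi> t)) *v (\<xi> + g t)) \<bullet> (\<xi> + g t)) | \<phi> g.
      H1_path T \<phi> g \<and> \<phi> 0 = 0 \<and> \<phi> T = 0})))"

definition cost_hom ::
  "(real ^ 'n \<Rightarrow> real ^ 'n ^ 'n) \<Rightarrow> 'n::finite torus \<Rightarrow> 'n torus \<Rightarrow> real"
  where "cost_hom A x y =
    Inf {LINT t:{0..1}|lborel. A_hom A (g t) | z g.
      H1_path 1 z g \<and> proj_torus (z 0) = x \<and> proj_torus (z 1) = y}"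

definition prob_measures :: "'a::topological_space measure set"
  where "prob_measures = {\<mu>. prob_space \<mu> \<and> sets \<mu> = sets borel}"

definition couplings ::
  "'a::topological_space measure \<Rightarrow> 'a measure \<Rightarrow> ('a \<times> 'a) measure set"
  where "couplings \<mu> \<nu> = {\<omega>. prob_space \<omega> \<and> sets \<omega> = sets (borel \<Otimes>\<^sub>M borel) \<and>
    distr \<omega> borel fst = \<mu> \<and> distr \<omega> borel snd = \<nu>}"

text \<open>
  Minima and infima of costs are real infima of nonempty sets of nonnegative numbers. The costs used
  here are bounded and continuous on the torus, so the integrals against couplings are genuine.
\<close>

definition transport_W ::
  "('a::topological_space \<Rightarrow> 'a \<Rightarrow> real) \<Rightarrow> 'a measure \<Rightarrow> 'a measure \<Rightarrow> real"
  where "transport_W c \<mu> \<nu> = sqrt (INF \<omega>\<in>couplings \<mu> \<nu>. LINT p|\<omega>. c (fst p) (snd p))"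

definition W2 :: "'n::finite torus measure \<Rightarrow> 'n torus measure \<Rightarrow> real"
  where "W2 = transport_W (\<lambda>x y. (d_Eu x y)\<^sup>2)"

definition W_eps ::
  "(real ^ 'n \<Rightarrow> real ^ 'n ^ 'n) \<Rightarrow> real \<Rightarrow> 'n::finite torus measure \<Rightarrow> 'n torus measure \<Rightarrow> real"
  where "W_eps A \<epsilon> = transport_W (cost_eps A \<epsilon>)"

definition W_GH ::
  "(real ^ 'n \<Rightarrow> real ^ 'n ^ 'n) \<Rightarrow> 'n::finite torus measure \<Rightarrow> 'n torus measure \<Rightarrow> real"
  where "W_GH A = transport_W (cost_hom A)"

text \<open>
  The integral of \<open>\<rho> ln \<rho>\<close> takes values in \<open>(-\<infinity>, \<infinity>]\<close>: it is the integral of the positive part minus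
  the integral of the negative part, and the latter is finite because \<open>r ln r \<ge> -1/e\<close> and the torus
  has finite volume.
\<close>

definition torus_entropy :: "'n::finite torus measure \<Rightarrow> ereal"
  where "torus_entropy \<mu> =
    (if absolutely_continuous torus_lebesgue \<mu>
     then let \<rho> = (\<lambda>x. enn2real (RN_deriv torus_lebesgue \<mu> x)) in
       enn2ereal (\<integral>\<^sup>+ x. ennreal (\<rho> x * ln (\<rho> x)) \<partial>torus_lebesgue) -
       enn2ereal (\<integral>\<^sup>+ x. ennreal (- (\<rho> x * ln (\<rho> x))) \<partial>torus_lebesgue)
     else \<infinity>)"

definition free_energy :: "('n::finite torus \<Rightarrow> real) \<Rightarrow> 'n torus measure \<Rightarrow> ereal"
  where "free_energy V \<mu> = torus_entropy \<mu> + ereal (LINT x|\<mu>. V x)"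

definition JKO_solution ::
  "real \<Rightarrow> ('a::topological_space measure \<Rightarrow> ereal) \<Rightarrow> ('a measure \<Rightarrow> 'a measure \<Rightarrow> real) \<Rightarrow>
    'a measure \<Rightarrow> (real \<Rightarrow> 'a measure) \<Rightarrow> bool"
  where "JKO_solution \<tau> H W \<mu>\<^sub>0 \<mu> \<longleftrightarrow>
    (\<exists>m :: nat \<Rightarrow> 'a measure. m 0 = \<mu>\<^sub>0 \<and>
      (\<forall>n\<ge>1. is_arg_min (\<lambda>\<nu>. H \<nu> + ereal (1 / (2 * \<tau>) * (W \<nu> (m (n - 1)))\<^sup>2))
        (\<lambda>\<nu>. \<nu> \<in> prob_measures) (m n)) \<and>
      (\<forall>n\<ge>1. \<forall>t. (real n - 1) * \<tau> < t \<and> t \<le> real n * \<tau> \<longrightarrow> \<mu> t = m n))"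

end

theory Submission
  imports Defs
begin

text \<open>
  The minimal energy between two points is the square of a periodic distance \<open>d\<close> comparable to the
  Euclidean one, and \<open>c\<^sub>\<epsilon>\<close> is the square of \<open>\<epsilon> d(x / \<epsilon>, y / \<epsilon>)\<close> minimized over the lifts of the end
  points. Periodicity makes \<open>d(0, t \<xi>)\<close> subadditive in \<open>t\<close> up to a constant, so \<open>d(0, t \<xi>) / t\<close> has
  a limit \<open>N(\<xi>)\<close>, locally uniformly since \<open>d\<close> is Lipschitz. \<open>N\<close> is sublinear, \<open>A\<^sub>h\<^sub>o\<^sub>m = N\<^sup>2\<close>, and
  Jensen's inequality identifies \<open>c\<^sub>h\<^sub>o\<^sub>m\<close>; hence \<open>c\<^sub>\<epsilon> \<rightarrow> c\<^sub>h\<^sub>o\<^sub>m\<close> uniformly.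

  No compactness of measures is needed. Squared transport costs vary by at most \<open>sup \<bar>c - c'\<bar>\<close> under a
  change of the cost and by a multiple of the \<open>L\<^sup>1\<close> distance of the densities under a change of one
  marginal, so the functionals of one step are uniformly close if the previous iterates are \<open>L\<^sup>1\<close> close.
  The entropy is uniformly convex in \<open>L\<^sup>1\<close> and the squared transport cost is convex, so minimizers of
  close functionals are \<open>L\<^sup>1\<close> close. Induction on the number of steps gives \<open>L\<^sup>1\<close> convergence of the
  densities, which dominates \<open>W\<^sub>2\<close> convergence.
\<close>

section \<open>Curves of class H1\<close>

text \<open>The obstacle is that cost, potential and previous iterate all change with \<epsilon>, so
  convergence has to be passed through a minimization at every step. A quantitative estimate
  survives this: if the functional changes by \<eta>, the minimizer moves in L1 by at most 4 s +
  \<eta> / s for every s > 0, and s is fixed before \<epsilon>. Densities are available because the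
  initial measure is a competitor of finite value, so every iterate has finite entropy. On the side
  of the costs no minimizing curve is chosen; curves whose energy lies strictly below a number above
  the infimum take its place. Square roots enter because the action grows quadratically with length
  and only its root obeys the triangle inequality. The constant in the subadditivity is the price of
  moving a point to a nearby lattice point. Convergence for bounded displacements is enough,
  although lifts are unbounded, because comparison with the Euclidean norm confines nearly optimal
  lifts to a fixed ball.\<close>

lemma set_integral_scale:
  fixes f :: "real \<Rightarrow> 'b::{banach, second_countable_topology}"
  assumes "r > 0"
  shows "(LINT t:{0..S / r}|lborel. f (r * t)) = (1 / r) *\<^sub>R (LINT t:{0..S}|lborel. f t)"
    and "set_integrable lborel {0..S} f \<Longrightarrow> set_integrable lborel {0..S / r} (\<lambda>t. f (r * t))"
proof -
  have ind: "indicator {0..S / r} t = (indicator {0..S} (0 + r * t) :: real)" for t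
    using assms by (auto simp: indicator_def field_simps zero_le_mult_iff)
  show "(LINT t:{0..S / r}|lborel. f (r * t)) = (1 / r) *\<^sub>R (LINT t:{0..S}|lborel. f t)"
    using lborel_integral_real_affine[of r "\<lambda>t. indicator {0..S} t *\<^sub>R f t" 0] assms
    unfolding set_lebesgue_integral_def by (simp add: ind)
  show "set_integrable lborel {0..S} f \<Longrightarrow> set_integrable lborel {0..S / r} (\<lambda>t. f (r * t))"
    using lborel_integrable_real_affine[of "\<lambda>t. indicator {0..S} t *\<^sub>R f t" r 0] assms
    unfolding set_integrable_def by (simp add: ind)
qed

lemma set_integral_shift:
  fixes f :: "real \<Rightarrow> 'b::{banach, second_countable_topology}"
  shows "(LINT t:{S..S + T}|lborel. f (t - S)) = (LINT t:{0..T}|lborel. f t)"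
    and "set_integrable lborel {0..T} f \<Longrightarrow> set_integrable lborel {S..S + T} (\<lambda>t. f (t - S))"
proof -
  have ind: "indicator {S..S + T} t = (indicator {0..T} (- S + 1 * t) :: real)" for t
    by (auto simp: indicator_def)
  show "(LINT t:{S..S + T}|lborel. f (t - S)) = (LINT t:{0..T}|lborel. f t)"
    using lborel_integral_real_affine[of 1 "\<lambda>t. indicator {0..T} t *\<^sub>R f t" "- S"]
    unfolding set_lebesgue_integral_def by (simp add: ind)
  show "set_integrable lborel {0..T} f \<Longrightarrow> set_integrable lborel {S..S + T} (\<lambda>t. f (t - S))"
    using lborel_integrable_real_affine[of "\<lambda>t. indicator {0..T} t *\<^sub>R f t" 1 "- S"]
    unfolding set_integrable_def by (simp add: ind)
qed

text \<open>The second function restarts its own clock at time S, so each piece keeps the domain on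
  which \<open>H1_path\<close> describes it. At t = S the first branch decides.\<close>

definition path_join :: "real \<Rightarrow> (real \<Rightarrow> 'a) \<Rightarrow> (real \<Rightarrow> 'a) \<Rightarrow> real \<Rightarrow> 'a"
  where "path_join S f1 f2 t = (if t \<le> S then f1 t else f2 (t - S))"

lemma set_integral_path_join:
  fixes f1 :: "real \<Rightarrow> 'b::{banach, second_countable_topology}"
  assumes f1: "set_integrable lborel {0..S} f1" and f2: "set_integrable lborel {0..T} f2"
    and "0 \<le> S" "0 \<le> T"
  shows "set_integrable lborel {0..S + T} (path_join S f1 f2)" (is ?int)
    and "(LINT t:{0..S + T}|lborel. path_join S f1 f2 t) =
      (LINT t:{0..S}|lborel. f1 t) + (LINT t:{0..T}|lborel. f2 t)" (is ?eq)
proof -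
  have s: "{0..S + T} = {0..S} \<union> {S<..S + T}" using assms by auto
  have i1: "set_integrable lborel {0..S} (path_join S f1 f2)"
    using f1 by (subst set_integrable_cong[where f' = f1]) (auto simp: path_join_def)
  \<comment> \<open>The piece after S is taken half open to make the union disjoint; the point S is
    put back at the end as a null set.\<close>
  have "set_integrable lborel {S<..S + T} (\<lambda>t. f2 (t - S))"
    by (rule set_integrable_subset[OF set_integral_shift(2)[OF f2, of S]]) auto
  then have i2: "set_integrable lborel {S<..S + T} (path_join S f1 f2)"
    by (subst set_integrable_cong[where f' = "\<lambda>t. f2 (t - S)"]) (auto simp: path_join_def)
  show ?int unfolding s by (intro set_integrable_Un i1 i2) auto
  have "(LINT t:{0..S + T}|lborel. path_join S f1 f2 t) =
     (LINT t:{0..S}|lborel. path_join S f1 f2 t) + (LINT t:{S<..S + T}|lborel. path_join S f1 f2 t)"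
    unfolding s by (intro set_integral_Un i1 i2) auto
  also have "(LINT t:{0..S}|lborel. path_join S f1 f2 t) = (LINT t:{0..S}|lborel. f1 t)"
    by (rule set_lebesgue_integral_cong) (auto simp: path_join_def)
  also have "(LINT t:{S<..S + T}|lborel. path_join S f1 f2 t) = (LINT t:{S<..S + T}|lborel. f2 (t - S))"
    by (rule set_lebesgue_integral_cong) (auto simp: path_join_def)
  also have "\<dots> = (LINT t:{S..S + T}|lborel. f2 (t - S))"
    by (rule set_integral_discrete_difference[where X = "{S}"]) auto
  finally show ?eq by (simp add: set_integral_shift(1))
qed

lemma H1_path_measurable:
  "H1_path T z g \<Longrightarrow> set_borel_measurable lborel {0..T} g"
  unfolding H1_path_def by blast

lemma H1_path_square_integrable:
  "H1_path T z g \<Longrightarrow> set_integrable lborel {0..T} (\<lambda>t. (norm (g t))\<^sup>2)"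
  unfolding H1_path_def by blast

lemma H1_path_eq:
  "H1_path T z g \<Longrightarrow> t \<in> {0..T} \<Longrightarrow> z t = z 0 + (LINT s:{0..t}|lborel. g s)"
  unfolding H1_path_def by blast

lemma set_integrable_const_Icc: "set_integrable lborel {a..b::real} (\<lambda>_. c :: 'b::{banach, second_countable_topology})"
  unfolding set_integrable_def by (rule borel_integrable_compact) auto

lemma set_integral_const_Icc:
  fixes c :: "'b::euclidean_space"
  assumes "0 \<le> t"
  shows "(LINT s:{0..t}|lborel. c) = t *\<^sub>R c"
  using assms set_borel_integral_eq_integral(2)[OF set_integrable_const_Icc[of 0 t c]] by simp

text \<open>Constants are integrable on a bounded interval, and
  \<open>r \<le> 1 + r\<^sup>2\<close>.\<close>

lemma H1_path_integrable:
  assumes "H1_path T z g"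
  shows "set_integrable lborel {0..T} g"
  unfolding set_integrable_def
proof (rule Bochner_Integration.integrable_bound)
  show "integrable lborel (\<lambda>t. indicator {0..T} t *\<^sub>R (1 + (norm (g t))\<^sup>2))"
    using set_integral_add(1)[OF set_integrable_const_Icc[of 0 T "1::real"] H1_path_square_integrable[OF assms]]
    unfolding set_integrable_def .
  show "(\<lambda>t. indicator {0..T} t *\<^sub>R g t) \<in> borel_measurable lborel"
    using H1_path_measurable[OF assms] by (simp add: set_borel_measurable_def)
  have "r \<le> 1 + r\<^sup>2" for r :: real using zero_le_power2[of "r - 1/2"] by (simp add: power2_eq_square algebra_simps)
  then show "AE t in lborel. norm (indicator {0..T} t *\<^sub>R g t) \<le> norm (indicator {0..T} t *\<^sub>R (1 + (norm (g t))\<^sup>2))"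
    by (auto simp: indicator_def)
qed

lemma set_integrable_mono_Icc:
  fixes f :: "real \<Rightarrow> 'b::{banach, second_countable_topology}"
  shows "set_integrable lborel {0..T} f \<Longrightarrow> t \<le> T \<Longrightarrow> set_integrable lborel {0..t} f"
  by (rule set_integrable_subset) auto

text \<open>A primitive is continuous. This is what later makes the integrand of the energy
  measurable along the curve.\<close>

lemma H1_path_continuous:
  assumes "H1_path T z g"
  shows "continuous_on {0..T} z"
proof -
  have "continuous_on {0..T} (\<lambda>t. z 0 + integral {0..t} g)"
    by (intro continuous_intros indefinite_integral_continuous_1
        set_borel_integral_eq_integral(1) H1_path_integrable[OF assms])
  moreover have "z t = z 0 + integral {0..t} g" if "t \<in> {0..T}" for t
    using H1_path_eq[OF assms that] set_borel_integral_eq_integral(2)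
      [OF set_integrable_mono_Icc[OF H1_path_integrable[OF assms], of t]] that by simp
  ultimately show ?thesis by (metis (no_types, lifting) continuous_on_eq)
qed

lemma H1_pathI:
  assumes "set_integrable lborel {0..T} g" "set_integrable lborel {0..T} (\<lambda>t. (norm (g t))\<^sup>2)"
    "\<And>t. t \<in> {0..T} \<Longrightarrow> z t = z 0 + (LINT s:{0..t}|lborel. g s)"
  shows "H1_path T z g"
  using assms borel_measurable_integrable[OF assms(1)[unfolded set_integrable_def]]
  unfolding H1_path_def set_borel_measurable_def by blast

lemma H1_path_join:
  assumes p1: "H1_path S z1 g1" and p2: "H1_path T z2 g2" and "z1 S = z2 0" "0 \<le> S" "0 \<le> T"
  shows "H1_path (S + T) (path_join S z1 z2) (path_join S g1 g2)"
proof (rule H1_pathI)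
  show "set_integrable lborel {0..S + T} (path_join S g1 g2)"
    by (intro set_integral_path_join H1_path_integrable[OF p1] H1_path_integrable[OF p2] assms)
  have "(\<lambda>t. (norm (path_join S g1 g2 t))\<^sup>2) = path_join S (\<lambda>t. (norm (g1 t))\<^sup>2) (\<lambda>t. (norm (g2 t))\<^sup>2)"
    by (auto simp: path_join_def)
  then show "set_integrable lborel {0..S + T} (\<lambda>t. (norm (path_join S g1 g2 t))\<^sup>2)"
    using set_integral_path_join(1)[OF H1_path_square_integrable[OF p1] H1_path_square_integrable[OF p2]] assms by simp
  fix t assume t: "t \<in> {0..S + T}"
  show "path_join S z1 z2 t = path_join S z1 z2 0 + (LINT s:{0..t}|lborel. path_join S g1 g2 s)"
  proof (cases "t \<le> S")
    case True
    have "(LINT s:{0..t}|lborel. path_join S g1 g2 s) = (LINT s:{0..t}|lborel. g1 s)"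
      using True by (intro set_lebesgue_integral_cong) (auto simp: path_join_def)
    moreover have "z1 t = z1 0 + (LINT s:{0..t}|lborel. g1 s)"
      using True t by (intro H1_path_eq[OF p1]) auto
    ultimately show ?thesis using True \<open>0 \<le> S\<close> by (simp add: path_join_def[of S z1])
  next
    case False
    have "(LINT s:{0..S + (t - S)}|lborel. path_join S g1 g2 s) =
       (LINT t:{0..S}|lborel. g1 t) + (LINT t:{0..t - S}|lborel. g2 t)"
      using False assms t
      by (intro set_integral_path_join(2) H1_path_integrable[OF p1] set_integrable_mono_Icc[OF H1_path_integrable[OF p2]]) auto
    moreover have "z1 S = z1 0 + (LINT s:{0..S}|lborel. g1 s)"
      using \<open>0 \<le> S\<close> by (intro H1_path_eq[OF p1]) auto
    moreover have "z2 (t - S) = z2 0 + (LINT s:{0..t - S}|lborel. g2 s)"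
      using False t by (intro H1_path_eq[OF p2]) auto
    ultimately show ?thesis
      using False \<open>z1 S = z2 0\<close> \<open>0 \<le> S\<close> by (simp add: path_join_def[of S z1] add.assoc)
  qed
qed

text \<open>The curve is traversed r times as fast; this is how curves of different durations are
  compared.\<close>

lemma H1_path_scale:
  assumes p: "H1_path S z g" and "r > 0"
  shows "H1_path (S / r) (\<lambda>t. z (r * t)) (\<lambda>t. r *\<^sub>R g (r * t))"
proof (rule H1_pathI)
  show "set_integrable lborel {0..S / r} (\<lambda>t. r *\<^sub>R g (r * t))"
    by (intro set_integrable_scaleR_right set_integral_scale(2) H1_path_integrable[OF p] assms)
  have "set_integrable lborel {0..S / r} (\<lambda>t. r\<^sup>2 * (norm (g (r * t)))\<^sup>2)"
    by (intro set_integrable_mult_right set_integral_scale(2)[where f = "\<lambda>t. (norm (g t))\<^sup>2"] H1_path_square_integrable[OF p] assms)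
  then show "set_integrable lborel {0..S / r} (\<lambda>t. (norm (r *\<^sub>R g (r * t)))\<^sup>2)"
    by (simp add: power_mult_distrib)
  fix t assume t: "t \<in> {0..S / r}"
  have "(LINT s:{0..(r * t) / r}|lborel. g (r * s)) = (1 / r) *\<^sub>R (LINT s:{0..r * t}|lborel. g s)"
    by (rule set_integral_scale(1)[OF assms(2)])
  then have "(LINT s:{0..t}|lborel. r *\<^sub>R g (r * s)) = (LINT s:{0..r * t}|lborel. g s)"
    using assms by simp
  moreover have "z (r * t) = z 0 + (LINT s:{0..r * t}|lborel. g s)"
    using t assms by (intro H1_path_eq[OF p]) (auto simp: field_simps)
  ultimately show "z (r * t) = z (r * 0) + (LINT s:{0..t}|lborel. r *\<^sub>R g (r * s))"
    by simp
qed

lemma H1_path_scaleR: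
  assumes p: "H1_path S z g"
  shows "H1_path S (\<lambda>t. c *\<^sub>R z t) (\<lambda>t. c *\<^sub>R g t)"
proof (rule H1_pathI)
  show "set_integrable lborel {0..S} (\<lambda>t. c *\<^sub>R g t)"
    by (intro set_integrable_scaleR_right H1_path_integrable[OF p])
  show "set_integrable lborel {0..S} (\<lambda>t. (norm (c *\<^sub>R g t))\<^sup>2)"
    using set_integrable_mult_right[OF H1_path_square_integrable[OF p], of "c\<^sup>2"]
    by (simp add: power_mult_distrib)
  fix t assume "t \<in> {0..S}"
  from H1_path_eq[OF p this] show "c *\<^sub>R z t = c *\<^sub>R z 0 + (LINT s:{0..t}|lborel. c *\<^sub>R g s)"
    by (metis scaleR_add_right set_integral_scaleR_right)
qed

lemma H1_path_line: "H1_path T (\<lambda>t. x + t *\<^sub>R \<xi>) (\<lambda>_. \<xi>)"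
proof (rule H1_pathI)
  fix t assume t: "t \<in> {0..T}"
  have "(LINT s:{0..t}|lborel. \<xi>) = t *\<^sub>R \<xi>"
    using t by (intro set_integral_const_Icc) simp
  then show "x + t *\<^sub>R \<xi> = x + 0 *\<^sub>R \<xi> + (LINT s:{0..t}|lborel. \<xi>)"
    by simp
qed (rule set_integrable_const_Icc)+

text \<open>Serves two purposes: translating a curve by a constant, which is a line of zero
  velocity, and passing between a curve and its deviation from uniform motion.\<close>

lemma H1_path_add:
  assumes p1: "H1_path S z1 g1" and p2: "H1_path S z2 g2"
  shows "H1_path S (\<lambda>t. z1 t + z2 t) (\<lambda>t. g1 t + g2 t)"
proof (rule H1_pathI)
  show i: "set_integrable lborel {0..S} (\<lambda>t. g1 t + g2 t)"
    by (intro set_integral_add H1_path_integrable[OF p1] H1_path_integrable[OF p2])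
  have b: "set_integrable lborel {0..S} (\<lambda>t. 2 * (norm (g1 t))\<^sup>2 + 2 * (norm (g2 t))\<^sup>2)"
    by (intro set_integral_add set_integrable_mult_right H1_path_square_integrable[OF p1] H1_path_square_integrable[OF p2])
  have *: "(norm (x + y))\<^sup>2 \<le> 2 * (norm x)\<^sup>2 + 2 * (norm y)\<^sup>2" for x y :: "real ^ 'n"
    using zero_le_power2[of "norm (x - y)"] by (simp add: power2_norm_eq_inner algebra_simps inner_commute)
  show "set_integrable lborel {0..S} (\<lambda>t. (norm (g1 t + g2 t))\<^sup>2)"
  proof (rule set_integrable_bound[OF b])
    have "(\<lambda>t. (norm (indicator {0..S} t *\<^sub>R (g1 t + g2 t)))\<^sup>2) \<in> borel_measurable lborel"
      using i unfolding set_integrable_def by measurable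
    moreover have "(\<lambda>t. (norm (indicator {0..S} t *\<^sub>R (g1 t + g2 t)))\<^sup>2)
        = (\<lambda>t. indicator {0..S} t *\<^sub>R (norm (g1 t + g2 t))\<^sup>2)"
      by (auto simp: indicator_def)
    ultimately show "set_borel_measurable lborel {0..S} (\<lambda>t. (norm (g1 t + g2 t))\<^sup>2)"
      by (simp add: set_borel_measurable_def)
    show "AE t in lborel. t \<in> {0..S} \<longrightarrow> norm ((norm (g1 t + g2 t))\<^sup>2)
        \<le> norm (2 * (norm (g1 t))\<^sup>2 + 2 * (norm (g2 t))\<^sup>2)"
      by (intro AE_I2) (simp add: *)
  qed
  fix t assume t: "t \<in> {0..S}"
  have "(LINT s:{0..t}|lborel. g1 s + g2 s) = (LINT s:{0..t}|lborel. g1 s) + (LINT s:{0..t}|lborel. g2 s)"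
    using t by (intro set_integral_add set_integrable_mono_Icc[OF H1_path_integrable[OF p1]]
        set_integrable_mono_Icc[OF H1_path_integrable[OF p2]]) auto
  then show "z1 t + z2 t = z1 0 + z2 0 + (LINT s:{0..t}|lborel. g1 s + g2 s)"
    using H1_path_eq[OF p1 t] H1_path_eq[OF p2 t] by simp
qed

section \<open>Minimal action and geodesic distance\<close>

text \<open>\<open>L\<close> stands for the quadratic form of the inverse coefficient matrix. What
  shapes the action is its homogeneity of degree two in v, its two-sided bounds and its periodicity
  in x.\<close>

locale periodic_lagrangian =
  fixes L :: "real ^ 'n::finite \<Rightarrow> real ^ 'n \<Rightarrow> real" and a b :: real
  assumes a_pos: "0 < a"
    and L_measurable: "(\<lambda>p. L (fst p) (snd p)) \<in> borel_measurable borel"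
    and L_homogeneous: "L x (c *\<^sub>R v) = c\<^sup>2 * L x v"
    and L_lower: "a * (norm v)\<^sup>2 \<le> L x v"
    and L_upper: "L x v \<le> b * (norm v)\<^sup>2"
    and L_periodic: "k \<in> int_lattice \<Longrightarrow> L (x + k) v = L x v"
begin

definition energy :: "real \<Rightarrow> (real \<Rightarrow> real ^ 'n) \<Rightarrow> (real \<Rightarrow> real ^ 'n) \<Rightarrow> real"
  where "energy T z g = (LINT t:{0..T}|lborel. L (z t) (g t))"

definition action :: "real ^ 'n \<Rightarrow> real ^ 'n \<Rightarrow> real"
  where "action x y = Inf {energy 1 z g | z g. H1_path 1 z g \<and> z 0 = x \<and> z 1 = y}"

lemma L_nonneg: "0 \<le> L x v"
  using L_lower[of v x] a_pos by (smt (verit) mult_nonneg_nonneg zero_le_power2)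

lemma energy_integrable:
  assumes p: "H1_path T z g"
  shows "set_integrable lborel {0..T} (\<lambda>t. L (z t) (g t))"
proof (rule set_integrable_bound)
  show "set_integrable lborel {0..T} (\<lambda>t. b * (norm (g t))\<^sup>2)"
    by (intro set_integrable_mult_right H1_path_square_integrable[OF p])
  \<comment> \<open>Nothing is known about z and g outside {0..T}, so both are cut off there before
    being inserted into L; the outer indicator removes what the cut-off changed.\<close>
  have z: "(\<lambda>t. indicator {0..T} t *\<^sub>R z t) \<in> borel_measurable lborel"
    using borel_measurable_continuous_on_indicator[OF _ H1_path_continuous[OF p]] by simp
  have g: "(\<lambda>t. indicator {0..T} t *\<^sub>R g t) \<in> borel_measurable lborel"
    using H1_path_measurable[OF p] by (simp add: set_borel_measurable_def)
  have "(\<lambda>t. (indicator {0..T} t *\<^sub>R z t, indicator {0..T} t *\<^sub>R g t)) \<in> borel_measurable lborel"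
    using measurable_Pair[OF z g] by (simp add: borel_prod)
  from measurable_compose[OF this L_measurable]
  have "(\<lambda>t. L (indicator {0..T} t *\<^sub>R z t) (indicator {0..T} t *\<^sub>R g t)) \<in> borel_measurable lborel"
    by simp
  then have "(\<lambda>t. indicator {0..T} t * L (indicator {0..T} t *\<^sub>R z t) (indicator {0..T} t *\<^sub>R g t))
      \<in> borel_measurable lborel"
    by measurable
  moreover have "(\<lambda>t. indicator {0..T} t * L (indicator {0..T} t *\<^sub>R z t) (indicator {0..T} t *\<^sub>R g t))
      = (\<lambda>t. indicator {0..T} t *\<^sub>R L (z t) (g t))"
    by (auto simp: indicator_def)
  ultimately show "set_borel_measurable lborel {0..T} (\<lambda>t. L (z t) (g t))"
    by (simp add: set_borel_measurable_def)
  show "AE t in lborel. t \<in> {0..T} \<longrightarrow> norm (L (z t) (g t)) \<le> norm (b * (norm (g t))\<^sup>2)"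
    by (intro AE_I2) (use L_nonneg L_upper order_trans[OF L_nonneg L_upper] in simp)
qed

lemma energy_nonneg: "0 \<le> energy T z g"
  unfolding energy_def set_lebesgue_integral_def
  by (intro Bochner_Integration.integral_nonneg) (simp add: L_nonneg)

text \<open>Homogeneity contributes \<open>r\<^sup>2\<close> and the change of variables 1 /
  r.\<close>

lemma energy_scale:
  assumes "r > 0"
  shows "energy (S / r) (\<lambda>t. z (r * t)) (\<lambda>t. r *\<^sub>R g (r * t)) = r * energy S z g"
proof -
  have "energy (S / r) (\<lambda>t. z (r * t)) (\<lambda>t. r *\<^sub>R g (r * t)) =
      r\<^sup>2 * (LINT t:{0..S / r}|lborel. L (z (r * t)) (g (r * t)))"
    by (simp add: energy_def L_homogeneous)
  also have "(LINT t:{0..S / r}|lborel. L (z (r * t)) (g (r * t))) = (1 / r) * energy S z g"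
    using set_integral_scale(1)[OF assms, of S "\<lambda>t. L (z t) (g t)"] by (simp add: energy_def)
  finally show ?thesis using assms by (simp add: power2_eq_square)
qed

lemma energy_join:
  assumes p1: "H1_path S z1 g1" and p2: "H1_path T z2 g2" and "0 \<le> S" "0 \<le> T"
  shows "energy (S + T) (path_join S z1 z2) (path_join S g1 g2) = energy S z1 g1 + energy T z2 g2"
proof -
  have "(\<lambda>t. L (path_join S z1 z2 t) (path_join S g1 g2 t)) =
      path_join S (\<lambda>t. L (z1 t) (g1 t)) (\<lambda>t. L (z2 t) (g2 t))"
    by (auto simp: path_join_def)
  then show ?thesis
    using set_integral_path_join(2)[OF energy_integrable[OF p1] energy_integrable[OF p2]] assms
    by (simp add: energy_def)
qed

text \<open>Cauchy-Schwarz in time, obtained by integrating a pointwise completed square.\<close>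

lemma energy_lower:
  assumes p: "H1_path T z g" and "0 < T"
  shows "a * (norm (z T - z 0))\<^sup>2 \<le> T * energy T z g"
proof -
  define m where "m = norm (z T - z 0)"
  have T: "z T - z 0 = (LINT t:{0..T}|lborel. g t)"
    using H1_path_eq[OF p, of T] assms by simp
  have n: "set_integrable lborel {0..T} (\<lambda>t. norm (g t))"
    using H1_path_integrable[OF p] by (rule set_integrable_norm)
  have "m \<le> (LINT t:{0..T}|lborel. norm (g t))"
    unfolding m_def T by (rule set_integral_norm_bound[OF H1_path_integrable[OF p]])
  then have "2 * a * m / T * m \<le> 2 * a * m / T * (LINT t:{0..T}|lborel. norm (g t))"
    using a_pos assms by (intro mult_left_mono) (auto simp: m_def)
  also have "\<dots> = (LINT t:{0..T}|lborel. 2 * a * m / T * norm (g t))"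
    by simp
  also have "\<dots> \<le> (LINT t:{0..T}|lborel. L (z t) (g t) + a * (m / T)\<^sup>2)"
  proof (rule set_integral_mono)
    show "set_integrable lborel {0..T} (\<lambda>t. 2 * a * m / T * norm (g t))"
      using n by (rule set_integrable_mult_right)
    show "set_integrable lborel {0..T} (\<lambda>t. L (z t) (g t) + a * (m / T)\<^sup>2)"
      by (intro set_integral_add energy_integrable[OF p] set_integrable_const_Icc)
    fix t
    \<comment> \<open>The square is completed at m / T, the speed of uniform motion between the end
      points; this makes the integrated inequality sharp.\<close>
    have "0 \<le> a * (norm (g t) - m / T)\<^sup>2" using a_pos by simp
    also have "\<dots> = a * (norm (g t))\<^sup>2 - 2 * a * m / T * norm (g t) + a * (m / T)\<^sup>2"
      by (simp add: power2_diff algebra_simps)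
    finally show "2 * a * m / T * norm (g t) \<le> L (z t) (g t) + a * (m / T)\<^sup>2"
      using L_lower[of "g t" "z t"] by simp
  qed
  also have "\<dots> = energy T z g + (LINT t:{0..T}|lborel. a * (m / T)\<^sup>2)"
    unfolding energy_def by (intro set_integral_add energy_integrable[OF p] set_integrable_const_Icc)
  also have "(LINT t:{0..T}|lborel. a * (m / T)\<^sup>2) = T * (a * (m / T)\<^sup>2)"
    using assms by (simp add: set_lebesgue_integral_def)
  finally have "T * (2 * a * m / T * m) \<le> T * (energy T z g + T * (a * (m / T)\<^sup>2))"
    using assms by (intro mult_left_mono) auto
  then show ?thesis using assms by (simp add: m_def[symmetric] power2_eq_square field_simps)
qed

lemma energy_line_le:
  assumes "0 \<le> T"
  shows "energy T (\<lambda>t. x + t *\<^sub>R \<xi>) (\<lambda>_. \<xi>) \<le> T * (b * (norm \<xi>)\<^sup>2)"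
proof -
  have "energy T (\<lambda>t. x + t *\<^sub>R \<xi>) (\<lambda>_. \<xi>) \<le> (LINT t:{0..T}|lborel. b * (norm \<xi>)\<^sup>2)"
    unfolding energy_def
    by (intro set_integral_mono energy_integrable[OF H1_path_line] set_integrable_const_Icc L_upper)
  also have "\<dots> = T * (b * (norm \<xi>)\<^sup>2)"
    using assms by (simp add: set_lebesgue_integral_def)
  finally show ?thesis .
qed

lemma action_bdd_below: "bdd_below {energy 1 z g | z g. H1_path 1 z g \<and> z 0 = x \<and> z 1 = y}"
  using energy_nonneg by (intro bdd_belowI[of _ 0]) auto

lemma action_nonempty: "{energy 1 z g | z g. H1_path 1 z g \<and> z 0 = x \<and> z 1 = y} \<noteq> {}"
proof -
  have "H1_path 1 (\<lambda>t. x + t *\<^sub>R (y - x)) (\<lambda>_. y - x)" by (rule H1_path_line)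
  moreover have "x + 0 *\<^sub>R (y - x) = x" "x + 1 *\<^sub>R (y - x) = y" by auto
  ultimately show ?thesis by blast
qed

lemma action_le_energy:
  assumes p: "H1_path T z g" and "0 < T"
  shows "action (z 0) (z T) \<le> T * energy T z g"
proof -
  have "H1_path (T / T) (\<lambda>t. z (T * t)) (\<lambda>t. T *\<^sub>R g (T * t))"
    by (rule H1_path_scale[OF assms])
  then have "action (z (T * 0)) (z (T * 1)) \<le> energy (T / T) (\<lambda>t. z (T * t)) (\<lambda>t. T *\<^sub>R g (T * t))"
    unfolding action_def using assms
    by (intro cInf_lower action_bdd_below CollectI exI[of _ "\<lambda>t. z (T * t)"]
        exI[of _ "\<lambda>t. T *\<^sub>R g (T * t)"]) auto
  then show ?thesis using energy_scale[OF \<open>0 < T\<close>, of T z g] by simp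
qed

text \<open>Substitute for minimizing curves. The product of duration and energy is invariant under
  linear changes of time, so a nearly optimal curve of unit duration can be run in any time
  T.\<close>

lemma action_less_obtain:
  assumes "action x y < e" "0 < T"
  obtains z g where "H1_path T z g" "z 0 = x" "z T = y" "T * energy T z g < e"
proof -
  obtain z g where p: "H1_path 1 z g" "z 0 = x" "z 1 = y" "energy 1 z g < e"
    using assms(1) unfolding action_def
    by (auto simp: cInf_less_iff[OF action_nonempty action_bdd_below])
  have "H1_path (1 / (1 / T)) (\<lambda>t. z (1 / T * t)) (\<lambda>t. (1 / T) *\<^sub>R g (1 / T * t))"
    using assms by (intro H1_path_scale p) auto
  moreover have "energy (1 / (1 / T)) (\<lambda>t. z (1 / T * t)) (\<lambda>t. (1 / T) *\<^sub>R g (1 / T * t)) = 1 / T * energy 1 z g"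
    using assms by (intro energy_scale) auto
  ultimately show ?thesis
    using p assms by (intro that[of "\<lambda>t. z (1 / T * t)" "\<lambda>t. (1 / T) *\<^sub>R g (1 / T * t)"]) auto
qed

lemma action_nonneg: "0 \<le> action x y"
  unfolding action_def using action_nonempty energy_nonneg by (intro cInf_greatest) auto

lemma action_upper: "action x y \<le> b * (norm (y - x))\<^sup>2"
  using action_le_energy[OF H1_path_line[of 1 x "y - x"]] energy_line_le[of 1 x "y - x"] by simp

lemma action_lower: "a * (norm (y - x))\<^sup>2 \<le> action x y"
proof (rule dense_ge)
  fix s assume "action x y < s"
  then obtain z g where "H1_path 1 z g" "z 0 = x" "z 1 = y" "1 * energy 1 z g < s"
    using action_less_obtain[of x y s 1] by auto
  with energy_lower[of 1 z g] show "a * (norm (y - x))\<^sup>2 \<le> s" by simp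
qed

text \<open>Nearly optimal curves of durations S and T are run one after the other. Energies add,
  and the first leg has energy close to \<open>action x y / S\<close>, the second close to
  \<open>action y w / T\<close>.\<close>

lemma action_concat:
  assumes "0 < S" "0 < T"
  shows "action x w \<le> (S + T) * (action x y / S + action y w / T)"
proof -
  have "action x w \<le> (S + T) * (r / S + s / T)" if r: "action x y < r" and s: "action y w < s" for r s
  proof -
    obtain z1 g1 where 1: "H1_path S z1 g1" "z1 0 = x" "z1 S = y" "S * energy S z1 g1 < r"
      using action_less_obtain[OF r assms(1)] by auto
    obtain z2 g2 where 2: "H1_path T z2 g2" "z2 0 = y" "z2 T = w" "T * energy T z2 g2 < s"
      using action_less_obtain[OF s assms(2)] by auto
    let ?z = "path_join S z1 z2" and ?g = "path_join S g1 g2"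
    have "H1_path (S + T) ?z ?g" using 1 2 assms by (intro H1_path_join) auto
    from action_le_energy[OF this] have "action (?z 0) (?z (S + T)) \<le> (S + T) * energy (S + T) ?z ?g"
      using assms by simp
    moreover have "?z 0 = x" "?z (S + T) = w" using 1 2 assms by (auto simp: path_join_def)
    moreover have "energy (S + T) ?z ?g = energy S z1 g1 + energy T z2 g2"
      using 1 2 assms by (intro energy_join) auto
    moreover have "energy S z1 g1 \<le> r / S" "energy T z2 g2 \<le> s / T"
      using 1 2 assms by (auto simp: field_simps)
    ultimately show ?thesis
      using assms by (smt (verit) mult_left_mono)
  qed
  \<comment> \<open>Each leg exceeds its infimum by at most e, and the excess vanishes as e tends to
    0.\<close>
  then have "action x w \<le> (S + T) * ((action x y + e) / S + (action y w + e) / T)" if "e > 0" for e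
    using that by simp
  then have *: "\<forall>\<^sub>F e in at_right 0. action x w \<le> (S + T) * ((action x y + e) / S + (action y w + e) / T)"
    by (auto simp: eventually_at_right_field intro: exI[of _ 1])
  have "((\<lambda>e. (S + T) * ((action x y + e) / S + (action y w + e) / T)) \<longlongrightarrow>
      (S + T) * ((action x y + 0) / S + (action y w + 0) / T)) (at_right 0)"
    using assms by (intro tendsto_intros) auto
  from tendsto_lowerbound[OF this *] show ?thesis by simp
qed

lemma action_shift_le:
  assumes k: "k \<in> int_lattice"
  shows "action (x + k) (y + k) \<le> action x y"
proof (rule dense_ge)
  fix s assume "action x y < s"
  then obtain z g where p: "H1_path 1 z g" "z 0 = x" "z 1 = y" "1 * energy 1 z g < s"
    using action_less_obtain[of x y s 1] by auto
  have "H1_path 1 (\<lambda>t. z t + (k + t *\<^sub>R 0)) (\<lambda>t. g t + 0)"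
    by (rule H1_path_add[OF p(1) H1_path_line])
  then have "H1_path 1 (\<lambda>t. z t + k) g" by simp
  moreover have "energy 1 (\<lambda>t. z t + k) g = energy 1 z g"
    by (simp add: energy_def L_periodic[OF k])
  ultimately show "action (x + k) (y + k) \<le> s"
    using action_le_energy[of 1 "\<lambda>t. z t + k" g] p by simp
qed

lemma action_shift:
  assumes k: "k \<in> int_lattice"
  shows "action (x + k) (y + k) = action x y"
  using action_shift_le[OF k, of x y] action_shift_le[OF int_lattice_uminus[OF k], of "x + k" "y + k"]
  by simp

definition geodesic_dist :: "real ^ 'n \<Rightarrow> real ^ 'n \<Rightarrow> real"
  where "geodesic_dist x y = sqrt (action x y)"

lemma geodesic_dist_square: "(geodesic_dist x y)\<^sup>2 = action x y"
  by (simp add: geodesic_dist_def action_nonneg)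

lemma geodesic_dist_upper: "geodesic_dist x y \<le> sqrt b * norm (y - x)"
proof -
  have "sqrt (action x y) \<le> sqrt (b * (norm (y - x))\<^sup>2)" using action_upper by (rule real_sqrt_le_mono)
  then show ?thesis by (simp add: geodesic_dist_def real_sqrt_mult)
qed

lemma geodesic_dist_lower: "sqrt a * norm (y - x) \<le> geodesic_dist x y"
proof -
  have "sqrt (a * (norm (y - x))\<^sup>2) \<le> sqrt (action x y)" using action_lower by (rule real_sqrt_le_mono)
  then show ?thesis by (simp add: geodesic_dist_def real_sqrt_mult)
qed

text \<open>In \<open>action_concat\<close> the optimal durations are proportional to the distances travelled.\<close>

lemma geodesic_dist_triangle: "geodesic_dist x w \<le> geodesic_dist x y + geodesic_dist y w"
proof -
  let ?S = "geodesic_dist x y" and ?T = "geodesic_dist y w"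
  have nn: "0 \<le> ?S" "0 \<le> ?T" by (auto simp: geodesic_dist_def action_nonneg)
  have z: "geodesic_dist u v = 0 \<Longrightarrow> u = v" for u v
    using geodesic_dist_lower[of v u] a_pos by (simp add: mult_le_0_iff)
  show ?thesis
  proof (cases "?S = 0 \<or> ?T = 0")
    case True
    then show ?thesis using z[of x y] z[of y w] nn by auto
  next
    case False
    with nn have pos: "0 < ?S" "0 < ?T" by auto
    have "action x w \<le> (?S + ?T) * (action x y / ?S + action y w / ?T)"
      using pos by (rule action_concat)
    also have "\<dots> = (?S + ?T)\<^sup>2"
      unfolding geodesic_dist_square[symmetric] using pos by (simp add: power2_eq_square)
    finally show ?thesis unfolding geodesic_dist_def[of x w] using nn by (intro real_le_lsqrt) auto
  qed
qed

end

section \<open>The stable norm of a periodic distance\<close>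

text \<open>Rounding down leaves an error below 1 in each coordinate, and the sum norm turns this
  into the dimension. Any bound depending only on the dimension would do.\<close>

lemma int_lattice_near:
  obtains k :: "real ^ 'n::finite" where "k \<in> int_lattice" "norm (x - k) \<le> real CARD('n)"
proof
  let ?k = "(\<chi> i. of_int \<lfloor>x $ i\<rfloor>) :: real ^ 'n"
  show "?k \<in> int_lattice" by (simp add: int_lattice_def)
  have "norm (x - ?k) \<le> (\<Sum>i\<in>UNIV. \<bar>(x - ?k) $ i\<bar>)" by (rule norm_le_l1_cart)
  also have "\<dots> \<le> (\<Sum>i\<in>(UNIV :: 'n set). 1)" by (intro sum_mono) (simp; linarith)
  finally show "norm (x - ?k) \<le> real CARD('n)" by simp
qed

text \<open>Without symmetry among the axioms \<open>stable_norm\<close> is a sublinear functional: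
  homogeneity is stated for nonnegative factors, and the two orders of the arguments are estimated
  separately.\<close>

locale periodic_dist =
  fixes d :: "real ^ 'n::finite \<Rightarrow> real ^ 'n \<Rightarrow> real" and \<alpha> \<beta> :: real
  assumes \<alpha>_pos: "0 < \<alpha>"
    and triangle: "d x w \<le> d x y + d y w"
    and shift: "k \<in> int_lattice \<Longrightarrow> d (x + k) (y + k) = d x y"
    and lower: "\<alpha> * norm (y - x) \<le> d x y"
    and upper: "d x y \<le> \<beta> * norm (y - x)"
begin

definition cell_cost :: real where "cell_cost = \<beta> * real CARD('n)"

text \<open>Fekete's construction: \<open>d 0 (t *\<^sub>R \<xi>) + 2 * cell_cost\<close> is
  subadditive in t, so its quotient by t converges to its infimum. The constant disappears in the
  limit, but with it the lower bound holds at every t.\<close>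

definition stable_norm :: "real ^ 'n \<Rightarrow> real"
  where "stable_norm \<xi> = (INF t\<in>{0<..}. (d 0 (t *\<^sub>R \<xi>) + 2 * cell_cost) / t)"

lemma \<beta>_pos: "0 < \<beta>"
  using lower[of "axis undefined 1" 0] upper[of 0 "axis undefined 1"] \<alpha>_pos by simp

lemma cell_cost_nonneg: "0 \<le> cell_cost" using \<beta>_pos by (simp add: cell_cost_def)

lemma d_nonneg: "0 \<le> d x y"
  using lower[of y x] \<alpha>_pos by (smt (verit) mult_nonneg_nonneg norm_ge_zero)

text \<open>Let k be a lattice point near x. Periodicity identifies the distance from k to y - x + k
  with that from 0 to y - x, and the detours x to k and y - x + k to y cost at most
  \<open>cell_cost\<close> each.\<close>

lemma d_diff: "d x y \<le> d 0 (y - x) + 2 * cell_cost" "d 0 (y - x) \<le> d x y + 2 * cell_cost"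
proof -
  obtain k where k: "k \<in> int_lattice" "norm (x - k) \<le> real CARD('n)" by (rule int_lattice_near)
  have cell_cost: "d u w \<le> cell_cost" if "norm (w - u) = norm (x - k)" for u w
    using upper[of u w] mult_left_mono[OF k(2) less_imp_le[OF \<beta>_pos]]
    unfolding cell_cost_def that by linarith
  have 1: "d k (y - x + k) = d 0 (y - x)" using shift[OF k(1), of 0 "y - x"] by simp
  have 2: "d x k \<le> cell_cost" "d k x \<le> cell_cost" by (auto intro!: cell_cost simp: norm_minus_commute)
  have 3: "d (y - x + k) y \<le> cell_cost" "d y (y - x + k) \<le> cell_cost"
    by (auto intro!: cell_cost simp: norm_minus_commute algebra_simps)
  show "d x y \<le> d 0 (y - x) + 2 * cell_cost"
    using triangle[of x y k] triangle[of k y "y - x + k"] 1 2 3 by linarith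
  show "d 0 (y - x) \<le> d x y + 2 * cell_cost"
    using triangle[of k "y - x + k" x] triangle[of x "y - x + k" y] 1 2 3 by linarith
qed

lemma subadditive: "d 0 (\<xi> + \<eta>) \<le> d 0 \<xi> + d 0 \<eta> + 2 * cell_cost"
  using triangle[of 0 "\<xi> + \<eta>" \<xi>] d_diff(1)[of \<xi> "\<xi> + \<eta>"] by simp

lemma d_Lipschitz: "d x y \<le> d x' y' + \<beta> * norm (x - x') + \<beta> * norm (y - y')"
  using triangle[of x y x'] triangle[of x' y y'] upper[of x x'] upper[of y' y]
  by (simp add: norm_minus_commute)

lemma stable_norm_bdd_below: "bdd_below ((\<lambda>t. (d 0 (t *\<^sub>R \<xi>) + 2 * cell_cost) / t) ` {0<..})"
  using d_nonneg cell_cost_nonneg by (intro bdd_belowI[of _ 0]) auto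

lemma stable_norm_le:
  assumes "0 < t"
  shows "t * stable_norm \<xi> \<le> d 0 (t *\<^sub>R \<xi>) + 2 * cell_cost"
proof -
  have "stable_norm \<xi> \<le> (d 0 (t *\<^sub>R \<xi>) + 2 * cell_cost) / t"
    unfolding stable_norm_def using assms by (intro cINF_lower stable_norm_bdd_below) auto
  then show ?thesis using assms by (simp add: pos_le_divide_eq mult.commute)
qed

text \<open>Division with remainder by a nearly optimal s: t splits into q copies of s and a
  remainder of at most s. The copies give the linear term, the remainder the constant M, which is
  independent of t.\<close>

lemma stable_norm_almost:
  assumes "0 < \<delta>"
  obtains M where "\<And>t. 0 < t \<Longrightarrow> d 0 (t *\<^sub>R \<xi>) \<le> t * (stable_norm \<xi> + \<delta>) + M"
proof -
  obtain s where s: "0 < s" "(d 0 (s *\<^sub>R \<xi>) + 2 * cell_cost) / s < stable_norm \<xi> + \<delta>"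
    using assms cINF_less_iff[OF _ stable_norm_bdd_below, of \<xi> "stable_norm \<xi> + \<delta>"]
    unfolding stable_norm_def by auto
  define G where "G = (\<lambda>t. d 0 (t *\<^sub>R \<xi>) + 2 * cell_cost)"
  have G_add: "G (t + u) \<le> G t + G u" for t u
    using subadditive[of "t *\<^sub>R \<xi>" "u *\<^sub>R \<xi>"] by (simp add: G_def scaleR_add_left)
  have G_mult: "G (real q * s + r) \<le> real q * G s + G r" for q r
  proof (induction q)
    case (Suc q)
    have "G (real (Suc q) * s + r) = G (s + (real q * s + r))" by (simp add: algebra_simps)
    also have "\<dots> \<le> G s + G (real q * s + r)" by (rule G_add)
    finally show ?case using Suc by (simp add: algebra_simps)
  qed simp
  have "d 0 (t *\<^sub>R \<xi>) \<le> t * (stable_norm \<xi> + \<delta>) + (\<beta> * (s * norm \<xi>) + 2 * cell_cost)" if "0 < t" for t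
  proof -
    define q where "q = nat \<lfloor>t / s\<rfloor>"
    define r where "r = t - real q * s"
    have q: "real q \<le> t / s" "t / s < real q + 1"
      using that s by (auto simp: q_def)
    then have r: "0 \<le> r" "r \<le> s" using s by (auto simp: r_def field_simps)
    have "d 0 (t *\<^sub>R \<xi>) \<le> G t" using cell_cost_nonneg by (simp add: G_def)
    also have "G t \<le> real q * G s + G r" using G_mult[of q r] by (simp add: r_def)
    also have "real q * G s \<le> t / s * G s"
      using q d_nonneg cell_cost_nonneg by (intro mult_right_mono) (auto simp: G_def)
    also have "\<dots> = t * (G s / s)" by simp
    also have "\<dots> \<le> t * (stable_norm \<xi> + \<delta>)"
      using s that by (intro mult_left_mono) (auto simp: G_def)
    also have "G r \<le> \<beta> * (s * norm \<xi>) + 2 * cell_cost"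
      using upper[of 0 "r *\<^sub>R \<xi>"] r \<beta>_pos mult_right_mono[OF r(2), of "norm \<xi>"]
      by (simp add: G_def) (smt (verit) mult_left_mono)
    finally show ?thesis by simp
  qed
  then show ?thesis using that by blast
qed

lemma stable_norm_limit: "((\<lambda>t. d 0 (t *\<^sub>R \<xi>) / t) \<longlongrightarrow> stable_norm \<xi>) at_top"
proof (rule order_tendstoI)
  fix c assume c: "c < stable_norm \<xi>"
  have "((\<lambda>t. stable_norm \<xi> - 2 * cell_cost / t) \<longlongrightarrow> stable_norm \<xi> - 0) at_top"
    by (intro tendsto_intros tendsto_divide_0[OF tendsto_const] filterlim_at_top_imp_at_infinity filterlim_ident)
  then have "\<forall>\<^sub>F t in at_top. c < stable_norm \<xi> - 2 * cell_cost / t"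
    using c by (intro order_tendstoD) auto
  then show "\<forall>\<^sub>F t in at_top. c < d 0 (t *\<^sub>R \<xi>) / t"
    using eventually_gt_at_top[of 0]
  proof eventually_elim
    case (elim t)
    then show ?case using stable_norm_le[of t \<xi>] by (simp add: field_simps)
  qed
next
  fix c assume c: "stable_norm \<xi> < c"
  define \<delta> where "\<delta> = (c - stable_norm \<xi>) / 2"
  have \<delta>: "0 < \<delta>" "stable_norm \<xi> + \<delta> < c" using c by (auto simp: \<delta>_def field_simps)
  obtain M where M: "\<And>t. 0 < t \<Longrightarrow> d 0 (t *\<^sub>R \<xi>) \<le> t * (stable_norm \<xi> + \<delta>) + M"
    using stable_norm_almost[OF \<delta>(1), of \<xi>] by blast
  have "((\<lambda>t. stable_norm \<xi> + \<delta> + M / t) \<longlongrightarrow> stable_norm \<xi> + \<delta> + 0) at_top"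
    by (intro tendsto_intros tendsto_divide_0[OF tendsto_const] filterlim_at_top_imp_at_infinity filterlim_ident)
  then have "\<forall>\<^sub>F t in at_top. stable_norm \<xi> + \<delta> + M / t < c"
    using \<delta> by (intro order_tendstoD) auto
  then show "\<forall>\<^sub>F t in at_top. d 0 (t *\<^sub>R \<xi>) / t < c"
    using eventually_gt_at_top[of 0]
  proof eventually_elim
    case (elim t)
    have "d 0 (t *\<^sub>R \<xi>) / t \<le> stable_norm \<xi> + \<delta> + M / t"
      using M[of t] elim by (simp add: field_simps)
    then show ?case using elim by simp
  qed
qed

lemma stable_norm_upper: "stable_norm \<xi> \<le> \<beta> * norm \<xi>"
proof (rule tendsto_upperbound[OF stable_norm_limit])
  show "\<forall>\<^sub>F t in at_top. d 0 (t *\<^sub>R \<xi>) / t \<le> \<beta> * norm \<xi>"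
    using eventually_gt_at_top[of 0]
  proof eventually_elim
    case (elim t)
    then show ?case using upper[of 0 "t *\<^sub>R \<xi>"] by (simp add: field_simps)
  qed
qed simp

lemma stable_norm_lower: "\<alpha> * norm \<xi> \<le> stable_norm \<xi>"
proof (rule tendsto_lowerbound[OF stable_norm_limit])
  show "\<forall>\<^sub>F t in at_top. \<alpha> * norm \<xi> \<le> d 0 (t *\<^sub>R \<xi>) / t"
    using eventually_gt_at_top[of 0]
  proof eventually_elim
    case (elim t)
    then show ?case using lower[of "t *\<^sub>R \<xi>" 0] by (simp add: field_simps)
  qed
qed simp

lemma stable_norm_nonneg: "0 \<le> stable_norm \<xi>"
  using stable_norm_lower[of \<xi>] \<alpha>_pos by (smt (verit) mult_nonneg_nonneg norm_ge_zero)

lemma stable_norm_zero [simp]: "stable_norm 0 = 0"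
  using stable_norm_upper[of 0] stable_norm_nonneg[of 0] by simp

lemma stable_norm_scaleR:
  assumes "0 \<le> c"
  shows "stable_norm (c *\<^sub>R \<xi>) = c * stable_norm \<xi>"
proof (cases "c = 0")
  case False
  with assms have c: "0 < c" by simp
  have "((\<lambda>t. c * (d 0 ((c * t) *\<^sub>R \<xi>) / (c * t))) \<longlongrightarrow> c * stable_norm \<xi>) at_top"
    using c by (intro tendsto_intros filterlim_compose[OF stable_norm_limit]
        filterlim_tendsto_pos_mult_at_top[OF tendsto_const _ filterlim_ident])
  then have "((\<lambda>t. d 0 (t *\<^sub>R (c *\<^sub>R \<xi>)) / t) \<longlongrightarrow> c * stable_norm \<xi>) at_top"
    using c by (simp add: mult.commute)
  then show ?thesis
    using tendsto_unique[OF _ stable_norm_limit] by (metis trivial_limit_at_top_linorder)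
qed simp

lemma stable_norm_add: "stable_norm (\<xi> + \<eta>) \<le> stable_norm \<xi> + stable_norm \<eta>"
proof (rule tendsto_le[OF _ _ stable_norm_limit])
  have "((\<lambda>t. d 0 (t *\<^sub>R \<xi>) / t + d 0 (t *\<^sub>R \<eta>) / t + 2 * cell_cost / t) \<longlongrightarrow> stable_norm \<xi> + stable_norm \<eta> + 0) at_top"
    by (intro tendsto_intros stable_norm_limit tendsto_divide_0[OF tendsto_const] filterlim_at_top_imp_at_infinity filterlim_ident)
  then show "((\<lambda>t. d 0 (t *\<^sub>R \<xi>) / t + d 0 (t *\<^sub>R \<eta>) / t + 2 * cell_cost / t) \<longlongrightarrow> stable_norm \<xi> + stable_norm \<eta>) at_top"
    by simp
  show "\<forall>\<^sub>F t in at_top. d 0 (t *\<^sub>R (\<xi> + \<eta>)) / t \<le> d 0 (t *\<^sub>R \<xi>) / t + d 0 (t *\<^sub>R \<eta>) / t + 2 * cell_cost / t"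
    using eventually_gt_at_top[of 0]
  proof eventually_elim
    case (elim t)
    then show ?case using subadditive[of "t *\<^sub>R \<xi>" "t *\<^sub>R \<eta>"]
      by (simp add: scaleR_add_right add_divide_distrib[symmetric] divide_right_mono)
  qed
qed simp

lemma stable_norm_Lipschitz: "stable_norm \<xi> \<le> stable_norm \<eta> + \<beta> * norm (\<xi> - \<eta>)"
  using stable_norm_add[of \<eta> "\<xi> - \<eta>"] stable_norm_upper[of "\<xi> - \<eta>"] by simp

lemma stable_norm_continuous: "continuous_on S stable_norm"
proof -
  have "\<beta>-lipschitz_on S stable_norm"
  proof (rule lipschitz_onI)
    show "dist (stable_norm x) (stable_norm y) \<le> \<beta> * dist x y" for x y
      using stable_norm_Lipschitz[of x y] stable_norm_Lipschitz[of y x]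
      by (simp add: dist_real_def dist_norm norm_minus_commute abs_le_iff)
  qed (use \<beta>_pos in simp)
  then show ?thesis by (rule lipschitz_on_continuous_on)
qed

section \<open>The distance at scale \<epsilon> and its uniform convergence\<close>

definition rescaled :: "real \<Rightarrow> real ^ 'n \<Rightarrow> real ^ 'n \<Rightarrow> real"
  where "rescaled \<epsilon> x y = \<epsilon> * d (x /\<^sub>R \<epsilon>) (y /\<^sub>R \<epsilon>)"

lemma rescaled_nonneg: "0 < \<epsilon> \<Longrightarrow> 0 \<le> rescaled \<epsilon> x y"
  by (simp add: rescaled_def d_nonneg)

lemma norm_rescaled_diff: "0 < \<epsilon> \<Longrightarrow> \<epsilon> * (\<beta> * norm (x /\<^sub>R \<epsilon> - y /\<^sub>R \<epsilon>)) = \<beta> * norm (x - y)"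
  for \<epsilon> :: real and x y :: "real ^ 'n"
  unfolding scaleR_diff_right[symmetric] by simp

lemma rescaled_upper:
  assumes "0 < \<epsilon>"
  shows "rescaled \<epsilon> x y \<le> \<beta> * norm (y - x)"
  using mult_left_mono[OF upper less_imp_le[OF assms], of "x /\<^sub>R \<epsilon>" "y /\<^sub>R \<epsilon>"]
  unfolding rescaled_def norm_rescaled_diff[OF assms] .

lemma rescaled_Lipschitz:
  assumes "0 < \<epsilon>"
  shows "rescaled \<epsilon> x y \<le> rescaled \<epsilon> x' y' + \<beta> * norm (x - x') + \<beta> * norm (y - y')"
  using mult_left_mono[OF d_Lipschitz less_imp_le[OF assms], of "x /\<^sub>R \<epsilon>" "y /\<^sub>R \<epsilon>" "x' /\<^sub>R \<epsilon>" "y' /\<^sub>R \<epsilon>"]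
  unfolding rescaled_def distrib_left norm_rescaled_diff[OF assms] .

text \<open>This direction has a rate valid for all points, because the stable norm is an infimum.
  Two units of \<open>cell_cost\<close> come from the definition of that infimum and two from moving
  the base point to 0.\<close>

lemma stable_norm_le_rescaled:
  assumes "0 < \<epsilon>"
  shows "stable_norm (y - x) \<le> rescaled \<epsilon> x y + 4 * cell_cost * \<epsilon>"
proof -
  have "(1 / \<epsilon>) * stable_norm (y - x) \<le> d 0 ((1 / \<epsilon>) *\<^sub>R (y - x)) + 2 * cell_cost"
    using assms by (intro stable_norm_le) auto
  also have "d 0 ((1 / \<epsilon>) *\<^sub>R (y - x)) \<le> d (x /\<^sub>R \<epsilon>) (y /\<^sub>R \<epsilon>) + 2 * cell_cost"
    using d_diff(2)[of "y /\<^sub>R \<epsilon>" "x /\<^sub>R \<epsilon>"] by (simp add: scaleR_diff_right divide_inverse)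
  finally show ?thesis using assms by (simp add: rescaled_def field_simps)
qed

text \<open>Here only a pointwise limit is known. A finite net in the ball of displacements together
  with the Lipschitz constant \<beta>, which does not depend on \<epsilon>, makes it
  uniform.\<close>

lemma rescaled_le_stable_norm:
  assumes "0 < \<delta>"
  shows "\<forall>\<^sub>F \<epsilon> in at_right 0. \<forall>x y. norm (y - x) \<le> R \<longrightarrow> rescaled \<epsilon> x y \<le> stable_norm (y - x) + \<delta>"
proof -
  \<comment> \<open>The two passages between a displacement and its net point cost \<delta> / 4
    each; the limit at the net point and the change of base point take the other two
    quarters.\<close>
  define r where "r = \<delta> / (4 * \<beta>)"
  have r: "0 < r" "\<beta> * r = \<delta> / 4" using assms \<beta>_pos by (auto simp: r_def)
  have "compact (cball (0 :: real ^ 'n) R)" by simp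
  then have "\<exists>C. finite C \<and> cball (0 :: real ^ 'n) R \<subseteq> (\<Union>c\<in>C. ball c r)"
    using r(1) by (simp only: compact_eq_totally_bounded)
  then obtain C where C: "finite C" "cball (0 :: real ^ 'n) R \<subseteq> (\<Union>c\<in>C. ball c r)"
    by (elim exE conjE)
  have lim: "\<forall>\<^sub>F \<epsilon> in at_right 0. \<epsilon> * d 0 (c /\<^sub>R \<epsilon>) < stable_norm c + \<delta> / 4" for c
  proof -
    have "((\<lambda>\<epsilon>. d 0 (inverse \<epsilon> *\<^sub>R c) / inverse \<epsilon>) \<longlongrightarrow> stable_norm c) (at_right 0)"
      by (rule filterlim_compose[OF stable_norm_limit filterlim_inverse_at_top_right])
    then have "\<forall>\<^sub>F \<epsilon> in at_right 0. d 0 (inverse \<epsilon> *\<^sub>R c) / inverse \<epsilon> < stable_norm c + \<delta> / 4"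
      using assms by (intro order_tendstoD(2)) auto
    moreover have "d 0 (inverse \<epsilon> *\<^sub>R c) / inverse \<epsilon> = \<epsilon> * d 0 (c /\<^sub>R \<epsilon>)" for \<epsilon>
      by (simp add: divide_inverse)
    ultimately show ?thesis by (simp only:)
  qed
  have "\<forall>\<^sub>F \<epsilon> in at_right 0. \<forall>c\<in>C. \<epsilon> * d 0 (c /\<^sub>R \<epsilon>) < stable_norm c + \<delta> / 4"
    by (intro eventually_ball_finite C ballI lim)
  moreover have "\<forall>\<^sub>F \<epsilon> in at_right 0. 2 * cell_cost * \<epsilon> < \<delta> / 4"
  proof -
    have "((\<lambda>\<epsilon>. 2 * cell_cost * \<epsilon>) \<longlongrightarrow> 2 * cell_cost * 0) (at_right 0)" by (intro tendsto_intros)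
    then show ?thesis using assms by (intro order_tendstoD(2)) auto
  qed
  moreover have "\<forall>\<^sub>F \<epsilon> in at_right 0. 0 < (\<epsilon> :: real)"
    by (rule eventually_at_right_less)
  ultimately show ?thesis
  proof eventually_elim
    case (elim \<epsilon>)
    show ?case
    proof (intro allI impI)
      fix x y :: "real ^ 'n" assume "norm (y - x) \<le> R"
      then have "y - x \<in> cball 0 R" by simp
      from subsetD[OF C(2) this] obtain c where c: "c \<in> C" "y - x \<in> ball c r"
        by (rule UN_E)
      then have c': "norm ((y - x) - c) < r" by (simp add: dist_norm norm_minus_commute)
      have b: "\<beta> * norm ((y - x) - c) \<le> \<delta> / 4"
        using mult_left_mono[of "norm ((y - x) - c)" r \<beta>] c' r \<beta>_pos by simp
      have "d (x /\<^sub>R \<epsilon>) (y /\<^sub>R \<epsilon>) \<le> d 0 ((y - x) /\<^sub>R \<epsilon>) + 2 * cell_cost"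
        using d_diff(1)[of "x /\<^sub>R \<epsilon>" "y /\<^sub>R \<epsilon>"] by (simp add: scaleR_diff_right)
      then have 1: "rescaled \<epsilon> x y \<le> rescaled \<epsilon> 0 (y - x) + 2 * cell_cost * \<epsilon>"
        using mult_left_mono[OF _ less_imp_le[OF elim(3)], of "d (x /\<^sub>R \<epsilon>) (y /\<^sub>R \<epsilon>)"
            "d 0 ((y - x) /\<^sub>R \<epsilon>) + 2 * cell_cost"]
        by (simp add: rescaled_def distrib_left mult.commute)
      have 2: "rescaled \<epsilon> 0 (y - x) \<le> rescaled \<epsilon> 0 c + \<delta> / 4"
        using rescaled_Lipschitz[OF elim(3), of 0 "y - x" 0 c] b by simp
      have 3: "rescaled \<epsilon> 0 c < stable_norm c + \<delta> / 4"
        using elim(1) c(1) by (simp add: rescaled_def)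
      have 4: "stable_norm c \<le> stable_norm (y - x) + \<delta> / 4"
        using stable_norm_Lipschitz[of c "y - x"] b by (simp add: norm_minus_commute)
      from 1 2 3 4 elim(2) show "rescaled \<epsilon> x y \<le> stable_norm (y - x) + \<delta>" by linarith
    qed
  qed
qed

end

section \<open>Elliptic coefficients\<close>

sublocale periodic_lagrangian \<subseteq> periodic_dist geodesic_dist "sqrt a" "sqrt b"
proof
  show "geodesic_dist (x + k) (y + k) = geodesic_dist x y" if "k \<in> int_lattice" for k x y
    by (simp add: geodesic_dist_def action_shift[OF that])
qed (use a_pos geodesic_dist_triangle geodesic_dist_lower geodesic_dist_upper in auto)

lemma lattice_periodic_axis_scale:
  fixes f :: "real ^ 'n::finite \<Rightarrow> 'b"
  assumes "lattice_periodic f" "r \<in> \<int>"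
  shows "f (x + r *\<^sub>R axis j 1) = f x"
proof -
  have nat: "f (x + real n *\<^sub>R axis j 1) = f x" for n x
  proof (induction n)
    case (Suc n)
    have "x + real (Suc n) *\<^sub>R axis j 1 = (x + real n *\<^sub>R axis j 1) + axis j 1"
      by (simp add: scaleR_add_left)
    then show ?case using assms(1) Suc unfolding lattice_periodic_def by metis
  qed simp
  obtain i where i: "r = of_int i" using assms(2) by (auto elim: Ints_cases)
  show ?thesis
  proof (cases "0 \<le> i")
    case True
    then show ?thesis using nat[of x "nat i"] by (simp add: i)
  next
    case False
    \<comment> \<open>A negative multiple is undone by a positive one applied at the shifted
      point.\<close>
    then show ?thesis using nat[of "x + r *\<^sub>R axis j 1" "nat (- i)"] by (simp add: i)
  qed
qed

lemma lattice_periodic_shift: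
  fixes f :: "real ^ 'n::finite \<Rightarrow> 'b"
  assumes f: "lattice_periodic f" and k: "k \<in> int_lattice"
  shows "f (x + k) = f x"
proof -
  have "f (x + (\<Sum>i\<in>S. (k $ i) *\<^sub>R axis i 1)) = f x" for S
  proof (induction S arbitrary: x rule: infinite_finite_induct)
    case (insert i S)
    have "k $ i \<in> \<int>" using k by (simp add: int_lattice_def)
    then show ?case
      using insert lattice_periodic_axis_scale[OF f, of "k $ i" "x + (\<Sum>i\<in>S. (k $ i) *\<^sub>R axis i 1)" i]
      by (simp add: algebra_simps)
  qed auto
  from this[of UNIV] show ?thesis
    using basis_expansion[of k] by (simp add: scalar_mult_eq_scaleR)
qed

lemma mat_vector_mult: "mat c *v x = c *\<^sub>R (x :: real ^ 'n::finite)"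
  by (simp add: vec_eq_iff mat_def matrix_vector_mult_def if_distrib[of "\<lambda>u. u * _"] cong: if_cong)

locale elliptic_matrix =
  fixes M :: "real ^ 'n::finite ^ 'n" and l u :: real
  assumes l_pos: "0 < l" and u_pos: "0 < u"
    and M_lower: "loewner_le (mat l) M" and M_upper: "loewner_le M (mat u)"
begin

lemma M_symmetric: "x \<bullet> (M *v y) = (M *v x) \<bullet> y"
proof -
  have "transpose M = M" using M_lower by (simp add: loewner_le_def)
  then show ?thesis by (metis dot_lmul_matrix transpose_matrix_vector)
qed

lemma M_form_lower: "l * (norm x)\<^sup>2 \<le> x \<bullet> (M *v x)"
  using M_lower by (simp add: loewner_le_def mat_vector_mult power2_norm_eq_inner)

lemma M_form_upper: "x \<bullet> (M *v x) \<le> u * (norm x)\<^sup>2"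
  using M_upper by (simp add: loewner_le_def mat_vector_mult power2_norm_eq_inner)

text \<open>Coercivity leaves only 0 in the kernel. \<open>matrix_inv\<close> is defined by choice,
  so its two identities are available once invertibility is known.\<close>

lemma M_inv: "M ** matrix_inv M = mat 1" "matrix_inv M ** M = mat 1"
proof -
  have "x = 0" if "M *v x = 0" for x
    using M_form_lower[of x] l_pos that by (simp add: mult_le_0_iff)
  then have "invertible M" by (simp add: invertible_left_inverse matrix_left_invertible_ker)
  then have "M ** matrix_inv M = mat 1 \<and> matrix_inv M ** M = mat 1"
    unfolding invertible_def matrix_inv_def by (rule someI_ex)
  then show "M ** matrix_inv M = mat 1" "matrix_inv M ** M = mat 1" by auto
qed

lemma M_inv_vector: "M *v (matrix_inv M *v v) = v" "matrix_inv M *v (M *v v) = v"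
  by (simp_all add: matrix_vector_mul_assoc M_inv)

text \<open>Test the lower bound of the form of M at w, the preimage of v:
  \<open>l * (norm w)\<^sup>2 \<le> w \<bullet> v\<close>. Then apply Cauchy-Schwarz and divide by
  the norm of w.\<close>

lemma inv_norm_le: "norm (matrix_inv M *v v) \<le> (1 / l) * norm v"
proof -
  let ?w = "matrix_inv M *v v"
  have "l * (norm ?w)\<^sup>2 \<le> ?w \<bullet> v" using M_form_lower[of ?w] by (simp add: M_inv_vector)
  also have "\<dots> \<le> norm ?w * norm v" by (rule norm_cauchy_schwarz)
  finally have "norm ?w * (l * norm ?w) \<le> norm ?w * norm v" by (simp add: power2_eq_square mult_ac)
  then have "?w = 0 \<or> l * norm ?w \<le> norm v"
    by (metis mult_le_cancel_left_pos zero_less_norm_iff)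
  then show ?thesis using l_pos by (auto simp: field_simps)
qed

lemma inv_form_upper: "(matrix_inv M *v v) \<bullet> v \<le> (1 / l) * (norm v)\<^sup>2"
proof -
  have "(matrix_inv M *v v) \<bullet> v \<le> norm (matrix_inv M *v v) * norm v" by (rule norm_cauchy_schwarz)
  also have "\<dots> \<le> (1 / l) * norm v * norm v" by (intro mult_right_mono inv_norm_le) auto
  finally show ?thesis by (simp add: power2_eq_square)
qed

text \<open>Evaluate the nonnegative form of \<open>M\<close> at \<open>M\<inverse> v - u\<inverse> v\<close>.\<close>

lemma inv_form_lower: "(1 / u) * (norm v)\<^sup>2 \<le> (matrix_inv M *v v) \<bullet> v"
proof -
  let ?w = "matrix_inv M *v v" and ?t = "1 / u"
  have "0 \<le> l * (norm (?w - ?t *\<^sub>R v))\<^sup>2" using l_pos by simp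
  also have "\<dots> \<le> (?w - ?t *\<^sub>R v) \<bullet> (M *v (?w - ?t *\<^sub>R v))" by (rule M_form_lower)
  also have "M *v (?w - ?t *\<^sub>R v) = v - ?t *\<^sub>R (M *v v)"
    by (simp add: matrix_vector_mult_diff_distrib matrix_vector_mult_scaleR M_inv_vector)
  also have "(?w - ?t *\<^sub>R v) \<bullet> (v - ?t *\<^sub>R (M *v v)) =
      ?w \<bullet> v - ?t * (?w \<bullet> (M *v v)) - ?t * (v \<bullet> v) + ?t\<^sup>2 * (v \<bullet> (M *v v))"
    by (simp add: inner_diff_left inner_diff_right power2_eq_square algebra_simps)
  also have "?w \<bullet> (M *v v) = v \<bullet> v" by (simp add: M_symmetric M_inv_vector)
  also have "?t\<^sup>2 * (v \<bullet> (M *v v)) \<le> ?t\<^sup>2 * (u * (norm v)\<^sup>2)"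
    by (intro mult_left_mono M_form_upper) auto
  also have "?t\<^sup>2 * (u * (norm v)\<^sup>2) = ?t * (v \<bullet> v)"
    using u_pos by (simp add: power2_eq_square power2_norm_eq_inner flip: power2_norm_eq_inner)
  finally show ?thesis by (simp add: power2_norm_eq_inner)
qed

end

lemma C2_map_imp_continuous_on: "C2_map f \<Longrightarrow> continuous_on S f"
  unfolding C2_map_def by (meson continuous_at_imp_continuous_on has_derivative_continuous)

locale elliptic_field =
  fixes A :: "real ^ 'n::finite \<Rightarrow> real ^ 'n ^ 'n" and l u :: real
  assumes A_periodic: "lattice_periodic A"
    and A_continuous: "continuous_on UNIV A"
    and pos: "0 < l" "0 < u"
    and A_elliptic: "loewner_le (mat l) (A x)" "loewner_le (A x) (mat u)"
begin

lemma elliptic: "elliptic_matrix (A x) l u"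
  using pos A_elliptic by unfold_locales

definition lagrangian :: "real ^ 'n \<Rightarrow> real ^ 'n \<Rightarrow> real"
  where "lagrangian x v = (matrix_inv (A x) *v v) \<bullet> v"

text \<open>The resolvent identity writes the difference as one inverse applied to a vector that
  tends to 0, and all the inverses have norm at most 1 / l. Joint continuity is what yields Borel
  measurability of the Lagrangian.\<close>

lemma inv_vector_continuous:
  "((\<lambda>p. matrix_inv (A (fst p)) *v snd p) \<longlongrightarrow> matrix_inv (A x) *v v) (at (x, v))"
proof -
  let ?B = "\<lambda>x. matrix_inv (A x)"
  let ?h = "\<lambda>p :: (real ^ 'n) \<times> (real ^ 'n). 1 / l * (norm (snd p - v) + norm ((A x - A (fst p)) *v (?B x *v v)))"
  have bound: "norm (?B (fst p) *v snd p - ?B x *v v) \<le> ?h p" for p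
  proof -
    interpret y: elliptic_matrix "A (fst p)" l u by (rule elliptic)
    interpret x: elliptic_matrix "A x" l u by (rule elliptic)
    have "?B (fst p) *v snd p - ?B x *v v =
        ?B (fst p) *v ((snd p - v) + (A x - A (fst p)) *v (?B x *v v))"
      by (simp add: matrix_vector_right_distrib matrix_vector_mult_diff_distrib
          matrix_vector_mult_diff_rdistrib x.M_inv_vector y.M_inv_vector)
    also have "norm \<dots> \<le> 1 / l * norm ((snd p - v) + (A x - A (fst p)) *v (?B x *v v))"
      by (rule y.inv_norm_le)
    also have "\<dots> \<le> ?h p" using pos by (intro mult_left_mono norm_triangle_ineq) auto
    finally show ?thesis .
  qed
  have "isCont A x" using A_continuous by (simp add: continuous_on_eq_continuous_at)
  then have A: "((\<lambda>p. A (fst p)) \<longlongrightarrow> A x) (at (x, v))"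
    by (intro isCont_tendsto_compose[of x A]) (auto intro!: tendsto_eq_intros)
  have "((\<lambda>p. (A x - A (fst p)) *v (?B x *v v)) \<longlongrightarrow> (A x - A x) *v (?B x *v v)) (at (x, v))"
  proof (rule vec_tendstoI)
    fix i
    have "((\<lambda>p. \<Sum>j\<in>UNIV. (A x $ i $ j - A (fst p) $ i $ j) * (?B x *v v) $ j) \<longlongrightarrow>
        (\<Sum>j\<in>UNIV. (A x $ i $ j - A x $ i $ j) * (?B x *v v) $ j)) (at (x, v))"
      by (intro tendsto_intros A)
    then show "((\<lambda>p. ((A x - A (fst p)) *v (?B x *v v)) $ i) \<longlongrightarrow> ((A x - A x) *v (?B x *v v)) $ i) (at (x, v))"
      by (simp add: matrix_vector_mult_def[of "A x - _"])
  qed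
  then have lim: "(?h \<longlongrightarrow> 1 / l * (norm (v - v) + norm ((A x - A x) *v (?B x *v v)))) (at (x, v))"
    by (intro tendsto_intros) (auto intro!: tendsto_eq_intros)
  have "(?h \<longlongrightarrow> 0) (at (x, v))" using lim by simp
  then have "((\<lambda>p. ?B (fst p) *v snd p - ?B x *v v) \<longlongrightarrow> 0) (at (x, v))"
    by (rule Lim_null_comparison[OF always_eventually[OF allI[OF bound]]])
  then show ?thesis by (simp add: LIM_zero_iff)
qed

text \<open>Inversion exchanges the ellipticity constants: the upper bound of A controls the
  Lagrangian from below and the lower bound controls it from above.\<close>

sublocale periodic_lagrangian lagrangian "1 / u" "1 / l"
proof
  show "0 < 1 / u" using pos by simp
  have "continuous_on UNIV (\<lambda>p. matrix_inv (A (fst p)) *v snd p)"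
    using inv_vector_continuous by (simp add: continuous_on_eq_continuous_at isCont_def)
  then have "continuous_on UNIV (\<lambda>p. lagrangian (fst p) (snd p))"
    unfolding lagrangian_def by (intro continuous_intros) auto
  then show "(\<lambda>p. lagrangian (fst p) (snd p)) \<in> borel_measurable borel"
    by (rule borel_measurable_continuous_onI)
  show "lagrangian x (c *\<^sub>R v) = c\<^sup>2 * lagrangian x v" for x c v
    by (simp add: lagrangian_def matrix_vector_mult_scaleR power2_eq_square)
  show "1 / u * (norm v)\<^sup>2 \<le> lagrangian x v" for v x
    unfolding lagrangian_def by (rule elliptic_matrix.inv_form_lower[OF elliptic])
  show "lagrangian x v \<le> 1 / l * (norm v)\<^sup>2" for v x
    unfolding lagrangian_def by (rule elliptic_matrix.inv_form_upper[OF elliptic])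
  show "lagrangian (x + k) v = lagrangian x v" if "k \<in> int_lattice" for k x v
    by (simp add: lagrangian_def lattice_periodic_shift[OF A_periodic that])
qed

text \<open>Adding the uniform motion with velocity \<xi> turns the fluctuations \<phi> into the
  curves from 0 to \<open>T *\<^sub>R \<xi>\<close>. The least energy in time T is the action
  divided by T, and the mean value divides by T once more.\<close>

lemma Inf_mean_energy:
  assumes T: "0 < T"
  shows "Inf {1 / T * (LINT t:{0..T}|lborel.
            (matrix_inv (A (t *\<^sub>R \<xi> + \<phi> t)) *v (\<xi> + g t)) \<bullet> (\<xi> + g t)) | \<phi> g.
      H1_path T \<phi> g \<and> \<phi> 0 = 0 \<and> \<phi> T = 0} = (geodesic_dist 0 (T *\<^sub>R \<xi>) / T)\<^sup>2" (is "Inf ?S = ?r")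
proof -
  have r: "?r = action 0 (T *\<^sub>R \<xi>) / T\<^sup>2"
    by (simp add: power_divide geodesic_dist_square)
  have S: "?S = {1 / T * energy T (\<lambda>t. t *\<^sub>R \<xi> + \<phi> t) (\<lambda>t. \<xi> + g t) | \<phi> g.
      H1_path T \<phi> g \<and> \<phi> 0 = 0 \<and> \<phi> T = 0}"
    by (simp add: energy_def lagrangian_def)
  have approx: "\<exists>e\<in>?S. e < s" if s: "?r < s" for s
  proof -
    have "action 0 (T *\<^sub>R \<xi>) < T\<^sup>2 * s" using s T unfolding r by (simp add: pos_divide_less_eq mult.commute)
    from action_less_obtain[OF this T] obtain z g where
      z: "H1_path T z g" "z 0 = 0" "z T = T *\<^sub>R \<xi>" "T * energy T z g < T\<^sup>2 * s" .
    have "H1_path T (\<lambda>t. z t + (0 + t *\<^sub>R (- \<xi>))) (\<lambda>t. g t + - \<xi>)"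
      by (rule H1_path_add[OF z(1) H1_path_line])
    moreover have "1 / T * energy T z g < s" using z(4) T by (simp add: power2_eq_square field_simps)
    ultimately show ?thesis
      unfolding S using z(2,3)
      by (intro bexI[of _ "1 / T * energy T z g"] CollectI
          exI[of _ "\<lambda>t. z t + (0 + t *\<^sub>R (- \<xi>))"] exI[of _ "\<lambda>t. g t + - \<xi>"]) auto
  qed
  have bound: "?r \<le> e" if e: "e \<in> ?S" for e
  proof -
    from e obtain \<phi> g where \<phi>: "H1_path T \<phi> g" "\<phi> 0 = 0" "\<phi> T = 0"
      and e: "e = 1 / T * energy T (\<lambda>t. t *\<^sub>R \<xi> + \<phi> t) (\<lambda>t. \<xi> + g t)"
      unfolding S by auto
    have "H1_path T (\<lambda>t. (0 + t *\<^sub>R \<xi>) + \<phi> t) (\<lambda>t. \<xi> + g t)"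
      by (rule H1_path_add[OF H1_path_line \<phi>(1)])
    from action_le_energy[OF this T] have "action 0 (T *\<^sub>R \<xi>) \<le> T * (T * e)"
      using \<phi> T by (simp add: e)
    then show ?thesis using T unfolding r by (simp add: power2_eq_square pos_divide_le_eq mult_ac)
  qed
  show ?thesis
  proof (rule cInf_eq_non_empty)
    show "?S \<noteq> {}" using approx[of "?r + 1"] by auto
    show "y \<le> ?r" if "\<And>x. x \<in> ?S \<Longrightarrow> y \<le> x" for y
      by (rule dense_ge) (meson approx that le_less_trans less_imp_le)
  qed (rule bound)
qed

text \<open>The averaged minima converge, so the lower limit is a limit.
  \<open>Inf_mean_energy\<close> requires T > 0 and is therefore used eventually.\<close>

lemma A_hom_eq: "A_hom A \<xi> = (stable_norm \<xi>)\<^sup>2"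
proof -
  have "((\<lambda>T. (geodesic_dist 0 (T *\<^sub>R \<xi>) / T)\<^sup>2) \<longlongrightarrow> (stable_norm \<xi>)\<^sup>2) at_top"
    by (intro tendsto_intros stable_norm_limit)
  then have "((\<lambda>T. ereal ((geodesic_dist 0 (T *\<^sub>R \<xi>) / T)\<^sup>2)) \<longlongrightarrow> ereal ((stable_norm \<xi>)\<^sup>2)) at_top"
    by (rule tendsto_ereal)
  moreover have "\<forall>\<^sub>F T in at_top. ereal ((geodesic_dist 0 (T *\<^sub>R \<xi>) / T)\<^sup>2) = ereal (
    Inf {1 / T * (LINT t:{0..T}|lborel.
            (matrix_inv (A (t *\<^sub>R \<xi> + \<phi> t)) *v (\<xi> + g t)) \<bullet> (\<xi> + g t)) | \<phi> g.
      H1_path T \<phi> g \<and> \<phi> 0 = 0 \<and> \<phi> T = 0})"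
    using eventually_gt_at_top[of 0] by eventually_elim (simp only: Inf_mean_energy)
  ultimately have "((\<lambda>T. ereal (
    Inf {1 / T * (LINT t:{0..T}|lborel.
            (matrix_inv (A (t *\<^sub>R \<xi> + \<phi> t)) *v (\<xi> + g t)) \<bullet> (\<xi> + g t)) | \<phi> g.
      H1_path T \<phi> g \<and> \<phi> 0 = 0 \<and> \<phi> T = 0})) \<longlongrightarrow> ereal ((stable_norm \<xi>)\<^sup>2)) at_top"
    by (rule Lim_transform_eventually)
  from lim_imp_Liminf[OF _ this] show ?thesis by (simp add: A_hom_def)
qed

end

section \<open>Costs on the torus\<close>

lemma proj_torus_eq_iff: "proj_torus x = proj_torus y \<longleftrightarrow> x - y \<in> int_lattice"
  by (simp add: torus.abs_eq_iff torus_rel_def)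

lemma proj_torus_add_lattice: "k \<in> int_lattice \<Longrightarrow> proj_torus (x + k) = proj_torus x"
  by (simp add: proj_torus_eq_iff)

lemma proj_torus_obtain: obtains x where "proj_torus x = X"
  by (rule that[of "rep_torus X"]) (rule Quotient3_abs_rep[OF Quotient3_torus])

text \<open>Both lifts vary, as in the costs, where only the projections of the end points are
  prescribed.\<close>

definition lift_Inf :: "(real ^ 'n \<Rightarrow> real ^ 'n \<Rightarrow> real) \<Rightarrow> 'n::finite torus \<Rightarrow> 'n torus \<Rightarrow> real"
  where "lift_Inf F X Y = Inf {F x y | x y. proj_torus x = X \<and> proj_torus y = Y}"

text \<open>Collects what \<open>rescaled \<epsilon>\<close> and the stable norm share with one and
  the same \<beta>, so that the resulting bounds on the torus are uniform in \<epsilon>.\<close>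

definition lift_bounded :: "real \<Rightarrow> (real ^ 'n \<Rightarrow> real ^ 'n::finite \<Rightarrow> real) \<Rightarrow> bool"
  where "lift_bounded \<beta> F \<longleftrightarrow> (\<forall>x y. 0 \<le> F x y \<and> F x y \<le> \<beta> * norm (y - x)) \<and>
    (\<forall>x y x' y'. F x y \<le> F x' y' + \<beta> * norm (x - x') + \<beta> * norm (y - y'))"

lemma lift_set_nonempty: "{F x y | x y. proj_torus x = X \<and> proj_torus y = Y} \<noteq> {}"
proof -
  obtain x y where "proj_torus x = X" "proj_torus y = Y"
    using proj_torus_obtain[of X] proj_torus_obtain[of Y] by metis
  then show ?thesis by auto
qed

lemma lift_set_bdd_below:
  assumes "lift_bounded \<beta> F"
  shows "bdd_below {F x y | x y. proj_torus x = X \<and> proj_torus y = Y}"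
  using assms by (intro bdd_belowI[of _ 0]) (auto simp: lift_bounded_def)

lemma lift_Inf_lower:
  "lift_bounded \<beta> F \<Longrightarrow> lift_Inf F (proj_torus x) (proj_torus y) \<le> F x y"
  unfolding lift_Inf_def by (rule cInf_lower[OF _ lift_set_bdd_below]) auto

lemma lift_Inf_greatest:
  "(\<And>x y. proj_torus x = X \<Longrightarrow> proj_torus y = Y \<Longrightarrow> c \<le> F x y) \<Longrightarrow> c \<le> lift_Inf F X Y"
  unfolding lift_Inf_def by (rule cInf_greatest[OF lift_set_nonempty]) auto

lemma lift_Inf_less_obtain:
  assumes "lift_bounded \<beta> F" "lift_Inf F X Y < s"
  obtains x y where "proj_torus x = X" "proj_torus y = Y" "F x y < s"
  using assms(2) unfolding lift_Inf_def cInf_less_iff[OF lift_set_nonempty lift_set_bdd_below[OF assms(1)]]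
  by blast

lemma lift_Inf_nonneg: "lift_bounded \<beta> F \<Longrightarrow> 0 \<le> lift_Inf F X Y"
  by (rule lift_Inf_greatest) (auto simp: lift_bounded_def)

text \<open>A bound for the diameter of the torus: the lift x is moved by a lattice vector near y -
  x.\<close>

lemma lift_Inf_upper:
  fixes F :: "real ^ 'n::finite \<Rightarrow> real ^ 'n \<Rightarrow> real"
  assumes F: "lift_bounded \<beta> F" and "0 < \<beta>"
  shows "lift_Inf F X Y \<le> \<beta> * real CARD('n)"
proof -
  obtain x y where xy: "proj_torus x = X" "proj_torus y = Y" using proj_torus_obtain by metis
  obtain k where k: "k \<in> int_lattice" "norm ((y - x) - k) \<le> real CARD('n)" by (rule int_lattice_near)
  have "lift_Inf F (proj_torus (x + k)) (proj_torus y) \<le> F (x + k) y" by (rule lift_Inf_lower[OF F])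
  also have "\<dots> \<le> \<beta> * norm (y - (x + k))" using F unfolding lift_bounded_def by blast
  also have "\<dots> \<le> \<beta> * real CARD('n)" using k assms(2) by (intro mult_left_mono) (auto simp: diff_diff_eq)
  finally show ?thesis using xy by (simp add: proj_torus_add_lattice[OF k(1)])
qed

text \<open>Arbitrary lifts u, w of the second pair of points become lifts of the first pair when
  moved by x - x' and y - y'. The Lipschitz bound of F applies to this move and passes to the
  infimum.\<close>

lemma lift_Inf_Lipschitz:
  assumes F: "lift_bounded \<beta> F"
  shows "lift_Inf F (proj_torus x) (proj_torus y) \<le>
    lift_Inf F (proj_torus x') (proj_torus y') + \<beta> * norm (x - x') + \<beta> * norm (y - y')"
proof -
  have "lift_Inf F (proj_torus x) (proj_torus y) - \<beta> * norm (x - x') - \<beta> * norm (y - y') \<le>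
      lift_Inf F (proj_torus x') (proj_torus y')"
  proof (rule lift_Inf_greatest)
    fix u w assume "proj_torus u = proj_torus x'" "proj_torus w = proj_torus y'"
    then have k: "u - x' \<in> int_lattice" "w - y' \<in> int_lattice" by (simp_all add: proj_torus_eq_iff)
    have "lift_Inf F (proj_torus (x + (u - x'))) (proj_torus (y + (w - y'))) \<le>
        F (x + (u - x')) (y + (w - y'))"
      by (rule lift_Inf_lower[OF F])
    also have "\<dots> \<le> F u w + \<beta> * norm (x + (u - x') - u) + \<beta> * norm (y + (w - y') - w)"
      using F unfolding lift_bounded_def by blast
    also have "x + (u - x') - u = x - x'" by simp
    also have "y + (w - y') - w = y - y'" by simp
    finally show "lift_Inf F (proj_torus x) (proj_torus y) - \<beta> * norm (x - x') - \<beta> * norm (y - y') \<le> F u w"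
      unfolding proj_torus_add_lattice[OF k(1)] proj_torus_add_lattice[OF k(2)] by linarith
  qed
  then show ?thesis by linarith
qed

lemma lift_Inf_continuous:
  fixes F :: "real ^ 'n::finite \<Rightarrow> real ^ 'n \<Rightarrow> real"
  assumes F: "lift_bounded \<beta> F" and "0 < \<beta>"
  shows "continuous_on UNIV (\<lambda>p. lift_Inf F (proj_torus (fst p)) (proj_torus (snd p)))"
proof (rule continuous_at_imp_continuous_on, rule ballI)
  fix p :: "(real ^ 'n) \<times> (real ^ 'n)"
  let ?f = "\<lambda>p. lift_Inf F (proj_torus (fst p)) (proj_torus (snd p))"
  let ?h = "\<lambda>q. \<beta> * norm (fst q - fst p) + \<beta> * norm (snd q - snd p)"
  have bound: "norm (?f q - ?f p) \<le> ?h q" for q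
    using lift_Inf_Lipschitz[OF F, of "fst q" "snd q" "fst p" "snd p"]
      lift_Inf_Lipschitz[OF F, of "fst p" "snd p" "fst q" "snd q"]
    unfolding norm_minus_commute[of "fst p"] norm_minus_commute[of "snd p"] real_norm_def
    by linarith
  have "(?h \<longlongrightarrow> \<beta> * norm (fst p - fst p) + \<beta> * norm (snd p - snd p)) (at p)"
    by (intro tendsto_intros)
  then have "(?h \<longlongrightarrow> 0) (at p)" by simp
  then have "((\<lambda>q. ?f q - ?f p) \<longlongrightarrow> 0) (at p)"
    by (rule Lim_null_comparison[OF always_eventually[OF allI[OF bound]]])
  then show "isCont ?f p" by (simp add: isCont_def LIM_zero_iff)
qed

text \<open>The costs are infima of energies, but nearly optimal curves are found from nearly
  optimal distances; hence the approximation hypothesis speaks of a level s above the distance,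
  squared only afterwards.\<close>

lemma Inf_eq_square:
  fixes S :: "real set"
  assumes "0 \<le> I" "\<And>e. e \<in> S \<Longrightarrow> I\<^sup>2 \<le> e" "\<And>s. I < s \<Longrightarrow> \<exists>e\<in>S. e < s\<^sup>2"
  shows "Inf S = I\<^sup>2"
proof (rule cInf_eq_non_empty)
  show "S \<noteq> {}" using assms(3)[of "I + 1"] by auto
  fix y assume y: "\<And>x. x \<in> S \<Longrightarrow> y \<le> x"
  show "y \<le> I\<^sup>2"
  proof (rule ccontr)
    assume "\<not> y \<le> I\<^sup>2"
    then have "I\<^sup>2 < y" by simp
    then have "I < sqrt y" by (rule real_less_rsqrt)
    then obtain e where "e \<in> S" "e < (sqrt y)\<^sup>2" using assms(3) by blast
    moreover have "0 \<le> y" using \<open>I\<^sup>2 < y\<close> by (smt (verit) zero_le_power2)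
    ultimately show False using y by fastforce
  qed
qed (rule assms(2))

section \<open>Uniform convergence on the torus and Jensen's inequality\<close>

context periodic_dist
begin

lemma lift_bounded_rescaled: "0 < \<epsilon> \<Longrightarrow> lift_bounded \<beta> (rescaled \<epsilon>)"
  unfolding lift_bounded_def using rescaled_nonneg rescaled_upper rescaled_Lipschitz by blast

lemma lift_bounded_stable_norm: "lift_bounded \<beta> (\<lambda>x y. stable_norm (y - x))"
proof -
  have "stable_norm (y - x) \<le> stable_norm (y' - x') + \<beta> * norm (x - x') + \<beta> * norm (y - y')" for x y x' y'
  proof -
    have "norm ((y - x) - (y' - x')) \<le> norm (x - x') + norm (y - y')"
      using norm_triangle_ineq4[of "y - y'" "x - x'"] by (simp add: algebra_simps)
    then have "\<beta> * norm ((y - x) - (y' - x')) \<le> \<beta> * (norm (x - x') + norm (y - y'))"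
      using \<beta>_pos by (intro mult_left_mono) auto
    then show ?thesis
      using stable_norm_Lipschitz[of "y - x" "y' - x'"] unfolding distrib_left by linarith
  qed
  then show ?thesis
    unfolding lift_bounded_def using stable_norm_nonneg stable_norm_upper by blast
qed

text \<open>The lower bound holds for all lifts with a rate. The upper bound is uniform only for
  bounded displacements, which suffices because lifts that nearly minimize the stable norm have
  them.\<close>

lemma lift_Inf_rescaled_close:
  assumes "0 < \<delta>"
  shows "\<forall>\<^sub>F \<epsilon> in at_right 0. \<forall>X Y.
    \<bar>lift_Inf (rescaled \<epsilon>) X Y - lift_Inf (\<lambda>x y. stable_norm (y - x)) X Y\<bar> \<le> \<delta>"
proof -
  let ?J = "lift_Inf (\<lambda>x y. stable_norm (y - x))"
  \<comment> \<open>The minimum is at most \<beta> times the dimension, the chosen lifts exceed it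
    by less than 1, and the lower bound \<alpha> converts this into a bound on the
    displacement.\<close>
  define R where "R = (\<beta> * real CARD('n) + 1) / \<alpha>"
  have "((\<lambda>\<epsilon>. 4 * cell_cost * \<epsilon>) \<longlongrightarrow> 4 * cell_cost * 0) (at_right 0)" by (intro tendsto_intros)
  then have "\<forall>\<^sub>F \<epsilon> in at_right 0. 4 * cell_cost * \<epsilon> < \<delta>" using assms by (intro order_tendstoD(2)) auto
  moreover have "\<forall>\<^sub>F \<epsilon> in at_right 0. \<forall>x y. norm (y - x) \<le> R \<longrightarrow> rescaled \<epsilon> x y \<le> stable_norm (y - x) + \<delta>"
    by (rule rescaled_le_stable_norm[OF assms])
  moreover have "\<forall>\<^sub>F \<epsilon> in at_right 0. 0 < (\<epsilon> :: real)" by (rule eventually_at_right_less)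
  ultimately show ?thesis
  proof eventually_elim
    case (elim \<epsilon>)
    show ?case
    proof (intro allI)
      fix X Y :: "'n torus"
      have "?J X Y - \<delta> \<le> lift_Inf (rescaled \<epsilon>) X Y"
      proof (rule lift_Inf_greatest)
        fix x y assume "proj_torus x = X" "proj_torus y = Y"
        then have "?J X Y \<le> stable_norm (y - x)"
          using lift_Inf_lower[OF lift_bounded_stable_norm, of x y] by simp
        then show "?J X Y - \<delta> \<le> rescaled \<epsilon> x y"
          using stable_norm_le_rescaled[OF elim(3), of y x] elim(1) by linarith
      qed
      moreover have "lift_Inf (rescaled \<epsilon>) X Y - \<delta> \<le> ?J X Y"
      proof (rule dense_ge_bounded)
        show "?J X Y < ?J X Y + 1" by simp
        fix s assume s: "?J X Y < s" "s < ?J X Y + 1"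
        obtain x y where xy: "proj_torus x = X" "proj_torus y = Y" "stable_norm (y - x) < s"
          using lift_Inf_less_obtain[OF lift_bounded_stable_norm s(1)] .
        have "\<alpha> * norm (y - x) \<le> \<beta> * real CARD('n) + 1"
          using stable_norm_lower[of "y - x"] xy(3) s(2) lift_Inf_upper[OF lift_bounded_stable_norm \<beta>_pos, of X Y]
          by linarith
        then have "norm (y - x) \<le> R" using \<alpha>_pos by (simp add: R_def pos_le_divide_eq mult.commute)
        then have "rescaled \<epsilon> x y \<le> stable_norm (y - x) + \<delta>" using elim(2) by blast
        moreover have "lift_Inf (rescaled \<epsilon>) X Y \<le> rescaled \<epsilon> x y"
          using lift_Inf_lower[OF lift_bounded_rescaled[OF elim(3)], of x y] xy by simp
        ultimately show "lift_Inf (rescaled \<epsilon>) X Y - \<delta> \<le> s" using xy(3) by linarith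
      qed
      ultimately show "\<bar>lift_Inf (rescaled \<epsilon>) X Y - ?J X Y\<bar> \<le> \<delta>" by linarith
    qed
  qed
qed

lemma stable_norm_convex_ball: "convex {\<xi>. stable_norm \<xi> \<le> r}"
proof (rule convexI, clarify)
  fix x y :: "real ^ 'n" and p q :: real
  assume "stable_norm x \<le> r" "stable_norm y \<le> r" and pq: "0 \<le> p" "0 \<le> q" "p + q = 1"
  then have "p * stable_norm x + q * stable_norm y \<le> p * r + q * r"
    by (intro add_mono mult_left_mono) auto
  moreover have "p * r + q * r = r" using pq by (simp flip: distrib_right)
  ultimately show "stable_norm (p *\<^sub>R x + q *\<^sub>R y) \<le> r"
    using stable_norm_add[of "p *\<^sub>R x" "q *\<^sub>R y"] pq by (simp add: stable_norm_scaleR)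
qed

lemma stable_norm_integrable:
  assumes p: "H1_path T z g"
  shows "set_integrable lborel {0..T} (\<lambda>t. stable_norm (g t))"
    and "set_integrable lborel {0..T} (\<lambda>t. (stable_norm (g t))\<^sup>2)"
proof -
  have g: "(\<lambda>t. indicator {0..T} t *\<^sub>R g t) \<in> borel_measurable lborel"
    using H1_path_measurable[OF p] by (simp add: set_borel_measurable_def)
  have N: "stable_norm \<in> borel_measurable borel"
    by (rule borel_measurable_continuous_onI[OF stable_norm_continuous])
  have m: "(\<lambda>t. stable_norm (indicator {0..T} t *\<^sub>R g t)) \<in> borel_measurable lborel"
    by (rule measurable_compose[OF g N])
  have e: "stable_norm (indicator {0..T} t *\<^sub>R g t) = indicator {0..T} t *\<^sub>R stable_norm (g t)" for t
    by (simp add: stable_norm_scaleR)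
  show "set_integrable lborel {0..T} (\<lambda>t. stable_norm (g t))"
  proof (rule set_integrable_bound)
    show "set_integrable lborel {0..T} (\<lambda>t. \<beta> * norm (g t))"
      by (intro set_integrable_mult_right set_integrable_norm H1_path_integrable[OF p])
    show "set_borel_measurable lborel {0..T} (\<lambda>t. stable_norm (g t))"
      using m unfolding e set_borel_measurable_def .
    show "AE t in lborel. t \<in> {0..T} \<longrightarrow> norm (stable_norm (g t)) \<le> norm (\<beta> * norm (g t))"
      using stable_norm_nonneg stable_norm_upper \<beta>_pos by (intro AE_I2) auto
  qed
  have m2: "(\<lambda>t. (stable_norm (indicator {0..T} t *\<^sub>R g t))\<^sup>2) \<in> borel_measurable lborel"
    using m by measurable
  have e2: "(stable_norm (indicator {0..T} t *\<^sub>R g t))\<^sup>2 = indicator {0..T} t *\<^sub>R (stable_norm (g t))\<^sup>2" for t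
    by (auto simp: indicator_def)
  show "set_integrable lborel {0..T} (\<lambda>t. (stable_norm (g t))\<^sup>2)"
  proof (rule set_integrable_bound)
    show "set_integrable lborel {0..T} (\<lambda>t. \<beta>\<^sup>2 * (norm (g t))\<^sup>2)"
      by (intro set_integrable_mult_right H1_path_square_integrable[OF p])
    show "set_borel_measurable lborel {0..T} (\<lambda>t. (stable_norm (g t))\<^sup>2)"
      using m2 unfolding e2 set_borel_measurable_def .
    have "(stable_norm v)\<^sup>2 \<le> \<beta>\<^sup>2 * (norm v)\<^sup>2" for v
      using power_mono[OF stable_norm_upper stable_norm_nonneg, of v 2] by (simp add: power_mult_distrib)
    then show "AE t in lborel. t \<in> {0..T} \<longrightarrow> norm ((stable_norm (g t))\<^sup>2) \<le> norm (\<beta>\<^sup>2 * (norm (g t))\<^sup>2)"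
      by (intro AE_I2) simp
  qed
qed

text \<open>Jensen's inequality, by separating the mean from the convex ball \<open>stable_norm \<le> r\<close>.\<close>

lemma stable_norm_Jensen:
  assumes p: "H1_path T z g" and "0 \<le> T"
  shows "stable_norm (z T - z 0) \<le> (LINT t:{0..T}|lborel. stable_norm (g t))"
proof (rule ccontr)
  let ?v = "z T - z 0" and ?I = "LINT t:{0..T}|lborel. stable_norm (g t)"
  assume "\<not> stable_norm ?v \<le> ?I"
  then obtain r where r: "?I < r" "r < stable_norm ?v" using dense by (metis not_le)
  have "0 \<le> ?I"
    unfolding set_lebesgue_integral_def
    by (intro Bochner_Integration.integral_nonneg) (simp add: stable_norm_nonneg)
  with r have r0: "0 < r" by simp
  have "closed {\<xi>. stable_norm \<xi> \<le> r}"
    by (intro closed_Collect_le stable_norm_continuous continuous_intros)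
  from separating_hyperplane_closed_point[OF stable_norm_convex_ball this, of ?v] r
  obtain w c where w: "w \<bullet> ?v < c" "\<And>x. stable_norm x \<le> r \<Longrightarrow> c < w \<bullet> x" by auto
  have c: "c < 0" using w(2)[of 0] r0 by simp
  \<comment> \<open>By homogeneity, separation from one ball becomes a linear majorant of a negative
    multiple of the stable norm. Integrating it gives c ?I / r \<le> w \<bullet> ?v < c, and c < 0
    then forces ?I > r.\<close>
  have bound: "(c / r) * stable_norm x \<le> w \<bullet> x" for x
  proof (cases "stable_norm x = 0")
    case True
    then have "x = 0" using stable_norm_lower[of x] \<alpha>_pos by (simp add: mult_le_0_iff)
    then show ?thesis by simp
  next
    case False
    then have N: "0 < stable_norm x" using stable_norm_nonneg[of x] by simp
    have "stable_norm ((r / stable_norm x) *\<^sub>R x) = r"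
      using N r0 by (subst stable_norm_scaleR) auto
    then have "c < w \<bullet> ((r / stable_norm x) *\<^sub>R x)" by (intro w(2)) simp
    then have "c * stable_norm x \<le> r * (w \<bullet> x)" using N by (simp add: field_simps)
    then show ?thesis using r0 by (simp add: field_simps)
  qed
  have "(c / r) * ?I = (LINT t:{0..T}|lborel. (c / r) * stable_norm (g t))" by simp
  also have "\<dots> \<le> (LINT t:{0..T}|lborel. w \<bullet> g t)"
    using H1_path_integrable[OF p]
    by (intro set_integral_mono set_integrable_mult_right stable_norm_integrable[OF p] bound)
       (auto simp: set_integrable_def simp flip: inner_scaleR_right)
  also have "\<dots> = w \<bullet> (LINT t:{0..T}|lborel. g t)"
    using H1_path_integrable[OF p]
    by (simp add: set_lebesgue_integral_def set_integrable_def flip: inner_scaleR_right)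
  also have "(LINT t:{0..T}|lborel. g t) = ?v"
    using H1_path_eq[OF p, of T] assms(2) by simp
  finally have "(c / r) * ?I < c" using w(1) by simp
  then have "c * ?I < c * r" using r0 by (simp add: field_simps)
  then show False using c r by (simp add: mult_less_cancel_left)
qed

text \<open>The tangent of the square at m, the stable norm of the total displacement, is integrated
  over unit time; this reduces the claim to the inequality without squares.\<close>

lemma stable_norm_square_Jensen:
  assumes p: "H1_path 1 z g"
  shows "(stable_norm (z 1 - z 0))\<^sup>2 \<le> (LINT t:{0..1}|lborel. (stable_norm (g t))\<^sup>2)"
proof -
  define m where "m = stable_norm (z 1 - z 0)"
  have m: "0 \<le> m" by (simp add: m_def stable_norm_nonneg)
  have one: "(LINT t:{0..1::real}|lborel. c) = c" for c :: real
    using set_integral_const_Icc[of 1 c] by simp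
  have "2 * m * m - m\<^sup>2 \<le> 2 * m * (LINT t:{0..1}|lborel. stable_norm (g t)) - m\<^sup>2"
    using stable_norm_Jensen[OF p] m by (intro diff_right_mono mult_left_mono) (auto simp: m_def)
  also have "\<dots> = (LINT t:{0..1}|lborel. 2 * m * stable_norm (g t)) - (LINT t:{0..1::real}|lborel. m\<^sup>2)"
    by (simp add: one)
  also have "\<dots> = (LINT t:{0..1}|lborel. 2 * m * stable_norm (g t) - m\<^sup>2)"
    by (intro set_integral_diff(2)[symmetric] set_integrable_mult_right stable_norm_integrable[OF p] set_integrable_const_Icc)
  also have "\<dots> \<le> (LINT t:{0..1}|lborel. (stable_norm (g t))\<^sup>2)"
  proof (intro set_integral_mono set_integral_diff(1) set_integrable_mult_right stable_norm_integrable[OF p] set_integrable_const_Icc)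
    show "2 * m * stable_norm (g t) - m\<^sup>2 \<le> (stable_norm (g t))\<^sup>2" for t
      using zero_le_power2[of "stable_norm (g t) - m"] by (simp add: power2_diff algebra_simps)
  qed
  finally show ?thesis by (simp add: m_def power2_eq_square)
qed

end

context elliptic_field
begin

text \<open>The homogenized integrand depends on the velocity alone. Jensen's inequality bounds the
  cost of a curve below by that of the straight segment, and segments are admissible.\<close>

lemma cost_hom_eq: "cost_hom A X Y = (lift_Inf (\<lambda>x y. stable_norm (y - x)) X Y)\<^sup>2"
  unfolding cost_hom_def A_hom_eq
proof (rule Inf_eq_square)
  let ?I = "lift_Inf (\<lambda>x y. stable_norm (y - x)) X Y"
  show I: "0 \<le> ?I" by (rule lift_Inf_nonneg[OF lift_bounded_stable_norm])
  fix e assume "e \<in> {LINT t:{0..1}|lborel. (stable_norm (g t))\<^sup>2 | z g.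
      H1_path 1 z g \<and> proj_torus (z 0) = X \<and> proj_torus (z 1) = Y}"
  then obtain z g where e: "e = (LINT t:{0..1}|lborel. (stable_norm (g t))\<^sup>2)"
    and z: "H1_path 1 z g" "proj_torus (z 0) = X" "proj_torus (z 1) = Y" by auto
  have "?I \<le> stable_norm (z 1 - z 0)"
    using lift_Inf_lower[OF lift_bounded_stable_norm, of "z 0" "z 1"] z by simp
  then have "?I\<^sup>2 \<le> (stable_norm (z 1 - z 0))\<^sup>2" using I by (rule power_mono)
  also have "\<dots> \<le> e" unfolding e by (rule stable_norm_square_Jensen[OF z(1)])
  finally show "?I\<^sup>2 \<le> e" .
next
  fix s assume s: "lift_Inf (\<lambda>x y. stable_norm (y - x)) X Y < s"
  obtain x y where xy: "proj_torus x = X" "proj_torus y = Y" "stable_norm (y - x) < s"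
    using lift_Inf_less_obtain[OF lift_bounded_stable_norm s] .
  have "(LINT t:{0..1::real}|lborel. (stable_norm (y - x))\<^sup>2) < s\<^sup>2"
    using xy(3) stable_norm_nonneg[of "y - x"]
    using set_integral_const_Icc[of 1 "(stable_norm (y - x))\<^sup>2"] by (simp add: power_strict_mono)
  then show "\<exists>e\<in>{LINT t:{0..1}|lborel. (stable_norm (g t))\<^sup>2 | z g.
      H1_path 1 z g \<and> proj_torus (z 0) = X \<and> proj_torus (z 1) = Y}. e < s\<^sup>2"
    using xy H1_path_line[of 1 x "y - x"]
    by (intro bexI[of _ "LINT t:{0..1::real}|lborel. (stable_norm (y - x))\<^sup>2"] CollectI
        exI[of _ "\<lambda>t. x + t *\<^sub>R (y - x)"] exI[of _ "\<lambda>_. y - x"]) auto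
qed

text \<open>Dividing a curve by \<epsilon> turns its energy with oscillating coefficients into
  \<open>\<epsilon>\<^sup>2\<close> times an unscaled energy. The end points are projected to the
  torus before the division.\<close>

lemma cost_eps_eq:
  assumes \<epsilon>: "0 < \<epsilon>"
  shows "cost_eps A \<epsilon> X Y = (lift_Inf (rescaled \<epsilon>) X Y)\<^sup>2"
proof -
  let ?I = "lift_Inf (rescaled \<epsilon>) X Y"
  have r: "(rescaled \<epsilon> x y)\<^sup>2 = \<epsilon>\<^sup>2 * action (x /\<^sub>R \<epsilon>) (y /\<^sub>R \<epsilon>)" for x y
    by (simp add: rescaled_def power_mult_distrib geodesic_dist_square)
  have S: "(LINT t:{0..1}|lborel. (matrix_inv (A (z t /\<^sub>R \<epsilon>)) *v g t) \<bullet> g t) =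
      \<epsilon>\<^sup>2 * energy 1 (\<lambda>t. z t /\<^sub>R \<epsilon>) (\<lambda>t. g t /\<^sub>R \<epsilon>)" for z g
  proof -
    have "energy 1 (\<lambda>t. z t /\<^sub>R \<epsilon>) (\<lambda>t. g t /\<^sub>R \<epsilon>) =
        (inverse \<epsilon>)\<^sup>2 * (LINT t:{0..1}|lborel. lagrangian (z t /\<^sub>R \<epsilon>) (g t))"
      unfolding energy_def L_homogeneous by simp
    then show ?thesis using \<epsilon> unfolding lagrangian_def by (simp add: field_simps)
  qed
  show ?thesis
    unfolding cost_eps_def S
  proof (rule Inf_eq_square)
    show I: "0 \<le> ?I" by (rule lift_Inf_nonneg[OF lift_bounded_rescaled[OF \<epsilon>]])
    fix e assume "e \<in> {\<epsilon>\<^sup>2 * energy 1 (\<lambda>t. z t /\<^sub>R \<epsilon>) (\<lambda>t. g t /\<^sub>R \<epsilon>) | z g.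
        H1_path 1 z g \<and> proj_torus (z 0) = X \<and> proj_torus (z 1) = Y}"
    then obtain z g where e: "e = \<epsilon>\<^sup>2 * energy 1 (\<lambda>t. z t /\<^sub>R \<epsilon>) (\<lambda>t. g t /\<^sub>R \<epsilon>)"
      and z: "H1_path 1 z g" "proj_torus (z 0) = X" "proj_torus (z 1) = Y" by auto
    have "?I \<le> rescaled \<epsilon> (z 0) (z 1)"
      using lift_Inf_lower[OF lift_bounded_rescaled[OF \<epsilon>], of "z 0" "z 1"] z by simp
    then have "?I\<^sup>2 \<le> (rescaled \<epsilon> (z 0) (z 1))\<^sup>2" using I by (rule power_mono)
    also have "\<dots> \<le> e"
      unfolding r e
      using action_le_energy[OF H1_path_scaleR[OF z(1), of "inverse \<epsilon>"]]
      by (intro mult_left_mono) auto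
    finally show "?I\<^sup>2 \<le> e" .
  next
    fix s assume s: "lift_Inf (rescaled \<epsilon>) X Y < s"
    obtain x y where xy: "proj_torus x = X" "proj_torus y = Y" "rescaled \<epsilon> x y < s"
      using lift_Inf_less_obtain[OF lift_bounded_rescaled[OF \<epsilon>] s] .
    have "(rescaled \<epsilon> x y)\<^sup>2 < s\<^sup>2"
      using xy(3) rescaled_nonneg[OF \<epsilon>, of x y] by (simp add: power_strict_mono)
    then have "action (x /\<^sub>R \<epsilon>) (y /\<^sub>R \<epsilon>) < s\<^sup>2 / \<epsilon>\<^sup>2"
      unfolding r using \<epsilon> by (simp add: pos_less_divide_eq mult.commute)
    from action_less_obtain[OF this zero_less_one]
    obtain z g where z: "H1_path 1 z g" "z 0 = x /\<^sub>R \<epsilon>" "z 1 = y /\<^sub>R \<epsilon>" "1 * energy 1 z g < s\<^sup>2 / \<epsilon>\<^sup>2" .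
    have "\<epsilon>\<^sup>2 * energy 1 (\<lambda>t. (\<epsilon> *\<^sub>R z t) /\<^sub>R \<epsilon>) (\<lambda>t. (\<epsilon> *\<^sub>R g t) /\<^sub>R \<epsilon>) < s\<^sup>2"
      using z(4) \<epsilon> by (simp add: pos_less_divide_eq mult.commute)
    moreover have "H1_path 1 (\<lambda>t. \<epsilon> *\<^sub>R z t) (\<lambda>t. \<epsilon> *\<^sub>R g t)" by (rule H1_path_scaleR[OF z(1)])
    moreover have "proj_torus (\<epsilon> *\<^sub>R z 0) = X" "proj_torus (\<epsilon> *\<^sub>R z 1) = Y"
      using xy z \<epsilon> by simp_all
    ultimately show "\<exists>e\<in>{\<epsilon>\<^sup>2 * energy 1 (\<lambda>t. z t /\<^sub>R \<epsilon>) (\<lambda>t. g t /\<^sub>R \<epsilon>) | z g.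
        H1_path 1 z g \<and> proj_torus (z 0) = X \<and> proj_torus (z 1) = Y}. e < s\<^sup>2"
      by (intro bexI[of _ "\<epsilon>\<^sup>2 * energy 1 (\<lambda>t. (\<epsilon> *\<^sub>R z t) /\<^sub>R \<epsilon>) (\<lambda>t. (\<epsilon> *\<^sub>R g t) /\<^sub>R \<epsilon>)"]
          CollectI exI[of _ "\<lambda>t. \<epsilon> *\<^sub>R z t"] exI[of _ "\<lambda>t. \<epsilon> *\<^sub>R g t"] conjI refl)
  qed
qed

lemma cost_eps_uniform_limit:
  assumes "0 < \<delta>"
  shows "\<forall>\<^sub>F \<epsilon> in at_right 0. \<forall>X Y. \<bar>cost_eps A \<epsilon> X Y - cost_hom A X Y\<bar> \<le> \<delta>"
proof -
  \<comment> \<open>C dominates the sum of the two distances, which is the second factor in the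
    difference of their squares.\<close>
  define C where "C = 2 * (sqrt (1 / l) * real CARD('n))"
  have C: "0 < C" using \<beta>_pos by (simp add: C_def)
  have "0 < \<delta> / C" using assms C by simp
  from lift_Inf_rescaled_close[OF this] eventually_at_right_less[of 0]
  show ?thesis
  proof eventually_elim
    case (elim \<epsilon>)
    show ?case
    proof (intro allI)
      fix X Y :: "'n torus"
      let ?I = "lift_Inf (rescaled \<epsilon>) X Y" and ?J = "lift_Inf (\<lambda>x y. stable_norm (y - x)) X Y"
      have I: "0 \<le> ?I" "?I \<le> C / 2"
        using lift_Inf_nonneg[OF lift_bounded_rescaled[OF elim(2)]]
          lift_Inf_upper[OF lift_bounded_rescaled[OF elim(2)] \<beta>_pos, of X Y] by (auto simp: C_def)
      have J: "0 \<le> ?J" "?J \<le> C / 2"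
        using lift_Inf_nonneg[OF lift_bounded_stable_norm]
          lift_Inf_upper[OF lift_bounded_stable_norm \<beta>_pos, of X Y] by (auto simp: C_def)
      have "\<bar>?I\<^sup>2 - ?J\<^sup>2\<bar> = \<bar>?I - ?J\<bar> * \<bar>?I + ?J\<bar>"
        by (simp add: power2_eq_square algebra_simps flip: abs_mult)
      also have "\<dots> \<le> \<delta> / C * C" using elim(1) I J \<open>0 < \<delta> / C\<close> by (intro mult_mono) auto
      finally show "\<bar>cost_eps A \<epsilon> X Y - cost_hom A X Y\<bar> \<le> \<delta>"
        using C by (simp add: cost_eps_eq[OF elim(2)] cost_hom_eq)
    qed
  qed
qed

end

section \<open>Borel structure and volume of the torus\<close>

lemma proj_torus_measurable [measurable]: "proj_torus \<in> borel \<rightarrow>\<^sub>M borel"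
proof (rule borel_measurable_continuous_onI)
  show "continuous_on UNIV (proj_torus :: real ^ 'a \<Rightarrow> _)"
    unfolding continuous_on_open_vimage[OF open_UNIV] by (simp add: open_torus_def)
qed

text \<open>\<open>rep_torus\<close> is an arbitrary choice of representative, for which
  measurability cannot be expected. Fractional parts make the choice canonical: the representative
  in the half-open unit cube.\<close>

definition torus_section :: "'n::finite torus \<Rightarrow> real ^ 'n"
  where "torus_section X = (\<chi> i. frac (rep_torus X $ i))"

lemma proj_torus_section: "proj_torus (torus_section X) = X"
proof -
  have "proj_torus (torus_section X) = proj_torus (rep_torus X)"
    unfolding proj_torus_eq_iff by (simp add: int_lattice_def torus_section_def frac_def)
  then show ?thesis using Quotient3_abs_rep[OF Quotient3_torus] by metis
qed

lemma torus_section_proj: "torus_section (proj_torus x) $ i = frac (x $ i)"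
proof -
  have "proj_torus (rep_torus (proj_torus x)) = proj_torus x"
    by (rule Quotient3_abs_rep[OF Quotient3_torus])
  then have "rep_torus (proj_torus x) $ i - x $ i \<in> \<int>"
    by (simp add: proj_torus_eq_iff int_lattice_def)
  then obtain m where "rep_torus (proj_torus x) $ i = x $ i + of_int m"
    by (metis Ints_cases add_diff_cancel_left' diff_add_cancel add.commute)
  then show ?thesis by (simp add: torus_section_def frac_def)
qed

text \<open>The section jumps where a coordinate is an integer. Away from there, the set where a
  coordinate lies strictly between 0 and a \<le> 1 is open, its preimage being a union of open
  strips; the level 0 is the complement of the case a = 1.\<close>

lemma torus_section_measurable [measurable]: "(torus_section :: 'n::finite torus \<Rightarrow> _) \<in> borel \<rightarrow>\<^sub>M borel"
proof -
  have sec: "{X :: 'n torus. 0 < torus_section X $ i \<and> torus_section X $ i < a} \<in> sets borel"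
    if "a \<le> 1" for i :: 'n and a
  proof -
    have "proj_torus -` {X. 0 < torus_section X $ i \<and> torus_section X $ i < a} =
        (\<lambda>x. x $ i) -` (\<Union>m::int. {of_int m <..< of_int m + a})"
    proof (rule set_eqI)
      fix x :: "real ^ 'n"
      have "(0 < frac (x $ i) \<and> frac (x $ i) < a) \<longleftrightarrow> (\<exists>m::int. of_int m < x $ i \<and> x $ i < of_int m + a)"
      proof
        assume "0 < frac (x $ i) \<and> frac (x $ i) < a"
        then show "\<exists>m::int. of_int m < x $ i \<and> x $ i < of_int m + a"
          unfolding frac_def by (intro exI[of _ "\<lfloor>x $ i\<rfloor>"]) linarith
      next
        assume "\<exists>m::int. of_int m < x $ i \<and> x $ i < of_int m + a"
        then obtain m :: int where m: "of_int m < x $ i" "x $ i < of_int m + a" by auto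
        then have "\<lfloor>x $ i\<rfloor> = m" using that by (intro floor_unique) auto
        with m show "0 < frac (x $ i) \<and> frac (x $ i) < a" unfolding frac_def by auto
      qed
      then show "x \<in> proj_torus -` {X. 0 < torus_section X $ i \<and> torus_section X $ i < a} \<longleftrightarrow>
          x \<in> (\<lambda>x. x $ i) -` (\<Union>m::int. {of_int m <..< of_int m + a})"
        unfolding vimage_eq mem_Collect_eq torus_section_proj by simp
    qed
    moreover have "open ((\<lambda>x::real ^ 'n. x $ i) -` (\<Union>m::int. {of_int m <..< of_int m + a}))"
      by (intro open_vimage open_UN continuous_intros) auto
    ultimately show ?thesis by (intro borel_open) (simp add: open_torus_def)
  qed
  have "(\<lambda>X. torus_section X $ i) \<in> borel_measurable borel" for i :: 'n
  proof (rule borel_measurable_iff_less[THEN iffD2], rule allI)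
    fix a :: real
    have range: "0 \<le> torus_section X $ i" "torus_section X $ i < 1" for X
      by (simp_all add: torus_section_def frac_ge_0 frac_lt_1)
    have zero: "{X. torus_section X $ i = 0} = - {X. 0 < torus_section X $ i \<and> torus_section X $ i < 1}"
      using range by (auto simp: order_le_less)
    have "{X. torus_section X $ i < a} \<in> sets borel"
    proof -
      consider "a \<le> 0" | "1 \<le> a" | "0 < a" "a < 1" by linarith
      then show ?thesis
      proof cases
        case 1
        then have "{X. torus_section X $ i < a} = {}" using range by (auto simp: not_less intro: order_trans)
        then show ?thesis by simp
      next
        case 2
        then have "{X. torus_section X $ i < a} = UNIV" using range by (auto intro: less_le_trans)
        then show ?thesis by simp
      next
        case 3
        then have "{X. torus_section X $ i < a} = {X. torus_section X $ i = 0} \<union>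
            {X. 0 < torus_section X $ i \<and> torus_section X $ i < a}"
          using range by (auto simp: order_le_less)
        also have "\<dots> \<in> sets borel"
          unfolding zero using 3 by (intro sets.Un sec borel_comp) auto
        finally show ?thesis .
      qed
    qed
    then show "{X \<in> space borel. torus_section X $ i < a} \<in> sets borel" by simp
  qed
  then show ?thesis
    by (subst borel_measurable_euclidean_space) (auto simp: Basis_vec_def inner_axis)
qed

text \<open>A function on the torus is its lift composed with the measurable section.\<close>

lemma borel_measurable_torus:
  assumes "continuous_on UNIV (\<lambda>x. f (proj_torus x))"
  shows "f \<in> borel_measurable (borel :: 'n::finite torus measure)"
proof -
  have "(\<lambda>X. f (proj_torus (torus_section X))) \<in> borel_measurable borel"
    by (rule measurable_compose[OF torus_section_measurable borel_measurable_continuous_onI[OF assms]])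
  then show ?thesis by (simp add: proj_torus_section)
qed

lemma borel_measurable_torus_pair:
  fixes f :: "'n::finite torus \<Rightarrow> 'n torus \<Rightarrow> real"
  assumes "continuous_on UNIV (\<lambda>p. f (proj_torus (fst p)) (proj_torus (snd p)))"
  shows "(\<lambda>p. f (fst p) (snd p)) \<in> borel_measurable (borel \<Otimes>\<^sub>M borel)"
proof -
  have "(\<lambda>p. (torus_section (fst p), torus_section (snd p)) :: (real ^ 'n) \<times> (real ^ 'n))
      \<in> borel \<Otimes>\<^sub>M borel \<rightarrow>\<^sub>M borel \<Otimes>\<^sub>M borel" by measurable
  then have s: "(\<lambda>p. (torus_section (fst p), torus_section (snd p)) :: (real ^ 'n) \<times> (real ^ 'n))
      \<in> borel_measurable (borel \<Otimes>\<^sub>M borel)" by (simp add: borel_prod)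
  have "(\<lambda>p. f (proj_torus (torus_section (fst p))) (proj_torus (torus_section (snd p))))
      \<in> borel_measurable (borel \<Otimes>\<^sub>M borel)"
    using measurable_compose[OF s borel_measurable_continuous_onI[OF assms]] by simp
  then show ?thesis by (simp add: proj_torus_section)
qed

lemma sets_torus_lebesgue [simp, measurable_cong]: "sets torus_lebesgue = sets borel"
  by (simp add: torus_lebesgue_def)

lemma space_torus_lebesgue [simp]: "space torus_lebesgue = UNIV"
  by (simp add: torus_lebesgue_def)

text \<open>The half-open cube lies between the open and the closed unit box, both of volume
  1.\<close>

lemma prob_space_torus_lebesgue: "prob_space (torus_lebesgue :: 'n::finite torus measure)"
proof -
  let ?Q = "{x :: real ^ 'n. \<forall>i. 0 \<le> x $ i \<and> x $ i < 1}"
  have box: "box 0 (1 :: real ^ 'n) \<subseteq> ?Q" "?Q \<subseteq> cbox 0 1"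
    by (auto simp: mem_box_cart less_imp_le)
  have Q [measurable]: "?Q \<in> sets borel" by measurable
  have one: "(1 :: real ^ 'n) \<bullet> b = 1" if "b \<in> Basis" for b
    using that by (auto simp: Basis_vec_def inner_axis)
  have "emeasure lborel (box 0 (1 :: real ^ 'n)) = 1" "emeasure lborel (cbox 0 (1 :: real ^ 'n)) = 1"
    by (simp_all add: emeasure_lborel_box_eq emeasure_lborel_cbox_eq one)
  then have "emeasure lborel ?Q = 1"
    using emeasure_mono[OF box(1), of lborel] emeasure_mono[OF box(2), of lborel] Q by (simp add: antisym)
  then have "prob_space (restrict_space lborel ?Q)"
    by (intro prob_spaceI) (simp add: emeasure_restrict_space space_restrict_space)
  then show ?thesis
    unfolding torus_lebesgue_def
    by (rule prob_space.prob_space_distr) (intro measurable_restrict_space1, simp)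
qed

definition bounded_cost :: "real \<Rightarrow> ('a::topological_space \<Rightarrow> 'a \<Rightarrow> real) \<Rightarrow> bool"
  where "bounded_cost C c \<longleftrightarrow> (\<lambda>p. c (fst p) (snd p)) \<in> borel_measurable (borel \<Otimes>\<^sub>M borel) \<and>
    (\<forall>x y. 0 \<le> c x y \<and> c x y \<le> C)"

lemma bounded_cost_lift_Inf_square:
  fixes F :: "real ^ 'n::finite \<Rightarrow> real ^ 'n \<Rightarrow> real"
  assumes "lift_bounded \<beta> F" "0 < \<beta>"
  shows "bounded_cost ((\<beta> * real CARD('n))\<^sup>2) (\<lambda>X Y. (lift_Inf F X Y)\<^sup>2)"
  unfolding bounded_cost_def
proof (intro conjI allI)
  have "(\<lambda>p. lift_Inf F (fst p) (snd p)) \<in> borel_measurable (borel \<Otimes>\<^sub>M borel)"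
    by (rule borel_measurable_torus_pair[OF lift_Inf_continuous[OF assms]])
  then show "(\<lambda>p. (lift_Inf F (fst p) (snd p))\<^sup>2) \<in> borel_measurable (borel \<Otimes>\<^sub>M borel)" by measurable
  show "(lift_Inf F X Y)\<^sup>2 \<le> (\<beta> * real CARD('n))\<^sup>2" for X Y
    by (intro power_mono lift_Inf_upper[OF assms] lift_Inf_nonneg[OF assms(1)])
qed simp

lemma (in elliptic_field) bounded_cost_hom:
  "bounded_cost ((sqrt (1 / l) * real CARD('n))\<^sup>2) (cost_hom A)"
  using bounded_cost_lift_Inf_square[OF lift_bounded_stable_norm \<beta>_pos]
  by (simp add: cost_hom_eq[abs_def])

lemma (in elliptic_field) bounded_cost_eps:
  assumes "0 < \<epsilon>"
  shows "bounded_cost ((sqrt (1 / l) * real CARD('n))\<^sup>2) (cost_eps A \<epsilon>)"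
  using bounded_cost_lift_Inf_square[OF lift_bounded_rescaled[OF assms] \<beta>_pos]
  by (simp add: cost_eps_eq[OF assms, abs_def])

text \<open>Brings the Euclidean distance under \<open>lift_Inf\<close>, so that measurability and
  boundedness of the quadratic cost follow from the case \<beta> = 1.\<close>

lemma d_Eu_eq_lift_Inf: "d_Eu X Y = lift_Inf (\<lambda>x y. norm (y - x)) X Y"
proof -
  obtain x y where xy: "proj_torus x = X" "proj_torus y = Y"
    using proj_torus_obtain[of X] proj_torus_obtain[of Y] by metis
  have "(\<lambda>k. norm (x - y + k)) ` int_lattice = {norm (w - u) | u w. proj_torus u = X \<and> proj_torus w = Y}"
  proof (intro set_eqI iffI)
    fix r assume "r \<in> (\<lambda>k. norm (x - y + k)) ` int_lattice"
    then obtain k where k: "k \<in> int_lattice" "r = norm (x - y + k)" by auto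
    then have "r = norm (y - (x + k))" by (simp add: norm_minus_commute algebra_simps)
    moreover have "proj_torus (x + k) = X" using k xy by (simp add: proj_torus_add_lattice)
    ultimately show "r \<in> {norm (w - u) | u w. proj_torus u = X \<and> proj_torus w = Y}" using xy by blast
  next
    fix r assume "r \<in> {norm (w - u) | u w. proj_torus u = X \<and> proj_torus w = Y}"
    then obtain u w where uw: "r = norm (w - u)" "proj_torus u = X" "proj_torus w = Y" by auto
    then have "(u - x) + - (w - y) \<in> int_lattice"
      using xy by (intro int_lattice_add int_lattice_uminus) (simp_all flip: proj_torus_eq_iff)
    moreover have "r = norm (x - y + ((u - x) + - (w - y)))"
      by (simp add: uw norm_minus_commute)
    ultimately show "r \<in> (\<lambda>k. norm (x - y + k)) ` int_lattice" by (rule rev_image_eqI)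
  qed
  then show ?thesis
    unfolding lift_Inf_def using d_Eu.abs_eq[of x y] xy by simp
qed

lemma lift_bounded_norm: "lift_bounded 1 (\<lambda>x y :: real ^ 'n::finite. norm (y - x))"
proof -
  have "norm (y - x) \<le> norm (y' - x') + norm (x - x') + norm (y - y')" for x y x' y' :: "real ^ 'n"
    using norm_triangle_ineq[of "y' - x'" "(y - y') - (x - x')"] norm_triangle_ineq4[of "y - y'" "x - x'"]
    by simp
  then show ?thesis by (simp add: lift_bounded_def)
qed

lemma bounded_cost_d_Eu: "bounded_cost ((real CARD('n))\<^sup>2) (\<lambda>X Y :: 'n::finite torus. (d_Eu X Y)\<^sup>2)"
  using bounded_cost_lift_Inf_square[OF lift_bounded_norm] by (simp add: d_Eu_eq_lift_Inf)

lemma d_Eu_self [simp]: "d_Eu X X = 0"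
proof -
  obtain x where x: "proj_torus x = X" using proj_torus_obtain .
  have "d_Eu X X \<le> norm (x - x)"
    unfolding d_Eu_eq_lift_Inf using lift_Inf_lower[OF lift_bounded_norm, of x x] x by simp
  moreover have "0 \<le> d_Eu X X" unfolding d_Eu_eq_lift_Inf by (rule lift_Inf_nonneg[OF lift_bounded_norm])
  ultimately show ?thesis by simp
qed

section \<open>Couplings\<close>

text \<open>Couplings will be glued and averaged as measures. Space and measurable sets come from
  the first summand, which is why the lemmas ask for \<open>sets N = sets M\<close>.\<close>

definition add_measure :: "'a measure \<Rightarrow> 'a measure \<Rightarrow> 'a measure"
  where "add_measure M N = measure_of (space M) (sets M) (\<lambda>A. emeasure M A + emeasure N A)"

lemma space_add_measure [simp]: "space (add_measure M N) = space M"
  and sets_add_measure [simp, measurable_cong]: "sets (add_measure M N) = sets M"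
  by (simp_all add: add_measure_def space_measure_of_conv sets.sigma_sets_eq)

lemma emeasure_add_measure:
  assumes "sets N = sets M" "A \<in> sets M"
  shows "emeasure (add_measure M N) A = emeasure M A + emeasure N A"
  unfolding add_measure_def
proof (rule emeasure_measure_of_sigma[OF sets.sigma_algebra_axioms _ _ assms(2)])
  show "positive (sets M) (\<lambda>A. emeasure M A + emeasure N A)" by (simp add: positive_def)
  show "countably_additive (sets M) (\<lambda>A. emeasure M A + emeasure N A)"
  proof (rule countably_additiveI)
    fix A :: "nat \<Rightarrow> 'a set" assume A: "range A \<subseteq> sets M" "disjoint_family A"
    then have "(\<Sum>i. emeasure M (A i)) = emeasure M (\<Union>i. A i)" "(\<Sum>i. emeasure N (A i)) = emeasure N (\<Union>i. A i)"
      using assms(1) by (auto intro!: suminf_emeasure)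
    then show "(\<Sum>i. emeasure M (A i) + emeasure N (A i)) = emeasure M (\<Union>i. A i) + emeasure N (\<Union>i. A i)"
      by (subst suminf_add[symmetric]) auto
  qed
qed

lemma nn_integral_add_measure:
  assumes N: "sets N = sets M" and f: "f \<in> borel_measurable M"
  shows "(\<integral>\<^sup>+x. f x \<partial>add_measure M N) = (\<integral>\<^sup>+x. f x \<partial>M) + (\<integral>\<^sup>+x. f x \<partial>N)"
  using f
proof (induction rule: borel_measurable_induct)
  case (cong f g)
  have "space N = space M" using N by (rule sets_eq_imp_space_eq)
  then have "integral\<^sup>N K f = integral\<^sup>N K g" if "space K = space M" for K
    using cong(3) that by (intro nn_integral_cong) simp
  from this[of M] this[of N] this[of "add_measure M N"] \<open>space N = space M\<close> cong(4)
  show ?case by simp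
next
  case (set A)
  then show ?case using N by (simp add: emeasure_add_measure)
next
  case (mult u c)
  note [measurable_cong] = N
  note [measurable] = \<open>u \<in> borel_measurable M\<close>
  from mult show ?case by (simp add: nn_integral_cmult distrib_left)
next
  case (add u v)
  note [measurable_cong] = N
  note [measurable] = \<open>u \<in> borel_measurable M\<close> \<open>v \<in> borel_measurable M\<close>
  from add show ?case by (simp add: nn_integral_add ac_simps)
next
  case (seq U)
  have U: "integral\<^sup>N K (SUP i. U i) = (SUP i. integral\<^sup>N K (U i))" if "sets K = sets M" for K
  proof -
    have "U i \<in> borel_measurable K" for i using that seq(1) by (simp cong: measurable_cong_sets)
    from nn_integral_monotone_convergence_SUP[OF \<open>incseq U\<close> this]
    have "(\<integral>\<^sup>+ x. (SUP i. U i x) \<partial>K) = (SUP i. integral\<^sup>N K (U i))" .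
    moreover have "(SUP i. U i) = (\<lambda>x. SUP i. U i x)" by (simp add: fun_eq_iff image_comp)
    ultimately show ?thesis by simp
  qed
  have "(SUP i. integral\<^sup>N M (U i) + integral\<^sup>N N (U i)) =
      (SUP i. integral\<^sup>N M (U i)) + (SUP i. integral\<^sup>N N (U i))"
    using \<open>incseq U\<close> by (intro ennreal_SUP_add) (auto simp: incseq_def le_fun_def intro!: nn_integral_mono)
  then show ?case by (simp only: U[OF refl] U[OF N] U[OF sets_add_measure] seq.IH)
qed

text \<open>The midpoint of two measures, the competitor used when two minimizers are
  compared.\<close>

definition mix_measure :: "'a measure \<Rightarrow> 'a measure \<Rightarrow> 'a measure"
  where "mix_measure M N = scale_measure (inverse 2) (add_measure M N)"

lemma sets_mix_measure [simp, measurable_cong]: "sets (mix_measure M N) = sets M"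
  and space_mix_measure [simp]: "space (mix_measure M N) = space M"
  by (simp_all add: mix_measure_def space_scale_measure)

lemma emeasure_mix_measure:
  "sets N = sets M \<Longrightarrow> A \<in> sets M \<Longrightarrow>
    emeasure (mix_measure M N) A = inverse 2 * (emeasure M A + emeasure N A)"
  by (simp add: mix_measure_def emeasure_add_measure)

lemma nn_integral_mix_measure:
  "sets N = sets M \<Longrightarrow> f \<in> borel_measurable M \<Longrightarrow>
    (\<integral>\<^sup>+x. f x \<partial>mix_measure M N) = inverse 2 * ((\<integral>\<^sup>+x. f x \<partial>M) + (\<integral>\<^sup>+x. f x \<partial>N))"
  by (simp add: mix_measure_def nn_integral_scale_measure nn_integral_add_measure)

lemma half_ennreal: "0 \<le> r \<Longrightarrow> inverse 2 * ennreal r = ennreal (r / 2)"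
proof -
  assume "0 \<le> r"
  then have "ennreal (r / 2) = ennreal r / ennreal 2" by (intro divide_ennreal[symmetric]) auto
  then show ?thesis by (simp add: divide_ennreal_def mult.commute)
qed

lemma half_add_half: "inverse 2 * (x + x) = (x :: ennreal)"
proof -
  have "inverse 2 * (x + x) = (inverse 2 * ennreal 2) * x"
    by (simp add: mult_2[symmetric] mult.assoc)
  also have "inverse 2 * ennreal 2 = 1" by (subst half_ennreal) auto
  finally show ?thesis by simp
qed

lemma prob_space_mix_measure:
  assumes "prob_space M" "prob_space N" "sets N = sets M"
  shows "prob_space (mix_measure M N)"
proof (rule prob_spaceI)
  have "space N = space M" using assms(3) by (rule sets_eq_imp_space_eq)
  then show "emeasure (mix_measure M N) (space (mix_measure M N)) = 1"
    using prob_space.emeasure_space_1[OF assms(1)] prob_space.emeasure_space_1[OF assms(2)] assms(3)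
      half_add_half[of 1]
    by (simp add: emeasure_mix_measure)
qed

lemma distr_mix_measure:
  assumes "sets N = sets M" and f [measurable]: "f \<in> M \<rightarrow>\<^sub>M K"
  shows "distr (mix_measure M N) K f = mix_measure (distr M K f) (distr N K f)"
proof (rule measure_eqI)
  have [measurable]: "f \<in> N \<rightarrow>\<^sub>M K" using f assms(1) by (simp cong: measurable_cong_sets)
  have sp: "space N = space M" using assms(1) by (rule sets_eq_imp_space_eq)
  fix A assume "A \<in> sets (distr (mix_measure M N) K f)"
  then show "emeasure (distr (mix_measure M N) K f) A = emeasure (mix_measure (distr M K f) (distr N K f)) A"
    using assms(1) by (simp add: emeasure_distr emeasure_mix_measure sp)
qed simp

section \<open>Transport costs under changes of the data\<close>

definition transport_cost :: "('a \<Rightarrow> 'a \<Rightarrow> real) \<Rightarrow> ('a \<times> 'a) measure \<Rightarrow> real"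
  where "transport_cost c \<omega> = (LINT p|\<omega>. c (fst p) (snd p))"

lemma couplingsD:
  assumes "\<omega> \<in> couplings \<mu> \<nu>"
  shows "prob_space \<omega>" "sets \<omega> = sets (borel \<Otimes>\<^sub>M borel)" "distr \<omega> borel fst = \<mu>" "distr \<omega> borel snd = \<nu>"
  using assms by (auto simp: couplings_def)

lemma coupling_projections_measurable:
  assumes "\<omega> \<in> couplings \<mu> \<nu>"
  shows "fst \<in> \<omega> \<rightarrow>\<^sub>M borel" "snd \<in> \<omega> \<rightarrow>\<^sub>M borel"
  using couplingsD(2)[OF assms] by (simp_all cong: measurable_cong_sets)

lemma transport_cost_facts:
  assumes c: "bounded_cost C c" and \<omega>: "prob_space \<omega>" "sets \<omega> = sets (borel \<Otimes>\<^sub>M borel)"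
  shows "integrable \<omega> (\<lambda>p. c (fst p) (snd p))"
    and "ennreal (transport_cost c \<omega>) = (\<integral>\<^sup>+p. ennreal (c (fst p) (snd p)) \<partial>\<omega>)"
    and "0 \<le> transport_cost c \<omega>"
proof -
  interpret prob_space \<omega> by fact
  have "(\<lambda>p. c (fst p) (snd p)) \<in> borel_measurable \<omega>"
    using c \<omega>(2) by (simp add: bounded_cost_def cong: measurable_cong_sets)
  then show i: "integrable \<omega> (\<lambda>p. c (fst p) (snd p))"
    using c by (intro integrable_const_bound[of _ C]) (auto simp: bounded_cost_def)
  show "ennreal (transport_cost c \<omega>) = (\<integral>\<^sup>+p. ennreal (c (fst p) (snd p)) \<partial>\<omega>)"
    unfolding transport_cost_def using c
    by (intro nn_integral_eq_integral[symmetric] i) (auto simp: bounded_cost_def)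
  show "0 \<le> transport_cost c \<omega>"
    unfolding transport_cost_def using c
    by (intro Bochner_Integration.integral_nonneg) (auto simp: bounded_cost_def)
qed

lemma transport_cost_nonneg:
  "bounded_cost C c \<Longrightarrow> \<omega> \<in> couplings \<mu> \<nu> \<Longrightarrow> 0 \<le> transport_cost c \<omega>"
  by (rule transport_cost_facts(3)[OF _ couplingsD(1,2)])

text \<open>Ensures that infima over couplings are taken over nonempty sets.\<close>

lemma pair_measure_coupling:
  assumes "\<mu> \<in> prob_measures" "\<nu> \<in> prob_measures"
  shows "\<mu> \<Otimes>\<^sub>M \<nu> \<in> couplings \<mu> \<nu>"
proof -
  have s [measurable_cong, simp]: "sets \<mu> = sets borel" "sets \<nu> = sets borel"
    using assms by (auto simp: prob_measures_def)
  interpret \<mu>: prob_space \<mu> using assms by (simp add: prob_measures_def)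
  interpret \<nu>: prob_space \<nu> using assms by (simp add: prob_measures_def)
  interpret P: pair_prob_space \<mu> \<nu> ..
  have sp: "space \<mu> = UNIV" "space \<nu> = UNIV" using s[THEN sets_eq_imp_space_eq] by auto
  have "distr (\<mu> \<Otimes>\<^sub>M \<nu>) borel fst = \<mu>"
  proof (rule measure_eqI)
    fix A assume "A \<in> sets (distr (\<mu> \<Otimes>\<^sub>M \<nu>) borel fst)"
    then have [simp]: "A \<in> sets borel" by simp
    have "fst -` A \<inter> space (\<mu> \<Otimes>\<^sub>M \<nu>) = A \<times> space \<nu>" by (auto simp: space_pair_measure sp)
    moreover have "emeasure (\<mu> \<Otimes>\<^sub>M \<nu>) (A \<times> space \<nu>) = emeasure \<mu> A * emeasure \<nu> (space \<nu>)"
      by (rule \<nu>.emeasure_pair_measure_Times) (simp, rule sets.top)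
    ultimately show "emeasure (distr (\<mu> \<Otimes>\<^sub>M \<nu>) borel fst) A = emeasure \<mu> A"
      by (simp add: emeasure_distr \<nu>.emeasure_space_1)
  qed simp
  moreover have "distr (\<mu> \<Otimes>\<^sub>M \<nu>) borel snd = \<nu>"
  proof (rule measure_eqI)
    fix A assume "A \<in> sets (distr (\<mu> \<Otimes>\<^sub>M \<nu>) borel snd)"
    then have [simp]: "A \<in> sets borel" by simp
    have "snd -` A \<inter> space (\<mu> \<Otimes>\<^sub>M \<nu>) = space \<mu> \<times> A" by (auto simp: space_pair_measure sp)
    moreover have "emeasure (\<mu> \<Otimes>\<^sub>M \<nu>) (space \<mu> \<times> A) = emeasure \<mu> (space \<mu>) * emeasure \<nu> A"
      by (rule \<nu>.emeasure_pair_measure_Times) (rule sets.top, simp)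
    ultimately show "emeasure (distr (\<mu> \<Otimes>\<^sub>M \<nu>) borel snd) A = emeasure \<nu> A"
      by (simp add: emeasure_distr \<mu>.emeasure_space_1)
  qed simp
  ultimately show ?thesis
    using P.prob_space_axioms by (simp add: couplings_def cong: sets_pair_measure_cong)
qed

lemma transport_W_square:
  assumes c: "bounded_cost C c" and "\<mu> \<in> prob_measures" "\<nu> \<in> prob_measures"
  shows "(transport_W c \<mu> \<nu>)\<^sup>2 = (INF \<omega>\<in>couplings \<mu> \<nu>. transport_cost c \<omega>)"
proof -
  have "0 \<le> (INF \<omega>\<in>couplings \<mu> \<nu>. transport_cost c \<omega>)"
    using pair_measure_coupling[OF assms(2,3)] transport_cost_nonneg[OF c]
    by (intro cINF_greatest) blast+
  then show ?thesis by (simp add: transport_W_def transport_cost_def)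
qed

lemma transport_W_square_le:
  assumes c: "bounded_cost C c" and \<omega>: "\<omega> \<in> couplings \<mu> \<nu>"
    and "\<mu> \<in> prob_measures" "\<nu> \<in> prob_measures"
  shows "(transport_W c \<mu> \<nu>)\<^sup>2 \<le> transport_cost c \<omega>"
  unfolding transport_W_square[OF c assms(3,4)]
proof (rule cINF_lower[OF _ \<omega>])
  show "bdd_below (transport_cost c ` couplings \<mu> \<nu>)"
    using transport_cost_nonneg[OF c] by (intro bdd_belowI2[of _ 0])
qed

lemma transport_W_square_greatest:
  assumes c: "bounded_cost C c" and "\<mu> \<in> prob_measures" "\<nu> \<in> prob_measures"
    and "\<And>\<omega>. \<omega> \<in> couplings \<mu> \<nu> \<Longrightarrow> r \<le> transport_cost c \<omega>"
  shows "r \<le> (transport_W c \<mu> \<nu>)\<^sup>2"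
  unfolding transport_W_square[OF assms(1-3)]
  using pair_measure_coupling[OF assms(2,3)] assms(4) by (intro cINF_greatest) auto

text \<open>A coupling has total mass one, so its cost shifts by at most \<delta>. The estimate is
  one-sided, to be applied in both directions.\<close>

lemma transport_W_square_cost_mono:
  assumes c: "bounded_cost C c" and c': "bounded_cost C' c'"
    and "\<mu> \<in> prob_measures" "\<nu> \<in> prob_measures"
    and le: "\<And>x y. c x y \<le> c' x y + \<delta>"
  shows "(transport_W c \<mu> \<nu>)\<^sup>2 \<le> (transport_W c' \<mu> \<nu>)\<^sup>2 + \<delta>"
proof -
  have "(transport_W c \<mu> \<nu>)\<^sup>2 - \<delta> \<le> (transport_W c' \<mu> \<nu>)\<^sup>2"
  proof (rule transport_W_square_greatest[OF c' assms(3,4)])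
    fix \<omega> assume \<omega>: "\<omega> \<in> couplings \<mu> \<nu>"
    interpret prob_space \<omega> using couplingsD[OF \<omega>] by simp
    have "(transport_W c \<mu> \<nu>)\<^sup>2 \<le> transport_cost c \<omega>" by (rule transport_W_square_le[OF c \<omega> assms(3,4)])
    also have "\<dots> \<le> (LINT p|\<omega>. c' (fst p) (snd p) + \<delta>)"
      unfolding transport_cost_def
      by (intro integral_mono Bochner_Integration.integrable_add integrable_const le
          transport_cost_facts(1)[OF c couplingsD(1,2)[OF \<omega>]] transport_cost_facts(1)[OF c' couplingsD(1,2)[OF \<omega>]])
    also have "\<dots> = transport_cost c' \<omega> + \<delta>"
      unfolding transport_cost_def
      using transport_cost_facts(1)[OF c' couplingsD(1,2)[OF \<omega>]] by (simp add: prob_space)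
    finally show "(transport_W c \<mu> \<nu>)\<^sup>2 - \<delta> \<le> transport_cost c' \<omega>" by simp
  qed
  then show ?thesis by simp
qed

lemma mix_measure_prob_measures:
  "\<mu> \<in> prob_measures \<Longrightarrow> \<nu> \<in> prob_measures \<Longrightarrow> mix_measure \<mu> \<nu> \<in> prob_measures"
  by (simp add: prob_measures_def prob_space_mix_measure)

text \<open>The average of a coupling of \<nu>1 and a coupling of \<nu>2 with the same \<mu> couples
  the average of \<nu>1 and \<nu>2 with \<mu>, and costs are linear in the coupling.\<close>

lemma transport_W_square_convex:
  assumes c: "bounded_cost C c"
    and p: "\<nu>1 \<in> prob_measures" "\<nu>2 \<in> prob_measures" "\<mu> \<in> prob_measures"
  shows "(transport_W c (mix_measure \<nu>1 \<nu>2) \<mu>)\<^sup>2 \<le>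
    ((transport_W c \<nu>1 \<mu>)\<^sup>2 + (transport_W c \<nu>2 \<mu>)\<^sup>2) / 2" (is "?W \<le> (?W1 + ?W2) / 2")
proof -
  have key: "2 * ?W \<le> transport_cost c \<omega>1 + transport_cost c \<omega>2"
    if 1: "\<omega>1 \<in> couplings \<nu>1 \<mu>" and 2: "\<omega>2 \<in> couplings \<nu>2 \<mu>" for \<omega>1 \<omega>2
  proof -
    let ?\<omega> = "mix_measure \<omega>1 \<omega>2"
    note s1 = couplingsD[OF 1] and s2 = couplingsD[OF 2]
    have s: "sets \<omega>2 = sets \<omega>1" using s1 s2 by simp
    have mm: "mix_measure \<mu> \<mu> = \<mu>"
      by (rule measure_eqI) (simp_all add: emeasure_mix_measure half_add_half)
    have "?\<omega> \<in> couplings (mix_measure \<nu>1 \<nu>2) \<mu>"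
      using s1 s2 distr_mix_measure[OF s coupling_projections_measurable(1)[OF 1]]
        distr_mix_measure[OF s coupling_projections_measurable(2)[OF 1]]
        prob_space_mix_measure[OF s1(1) s2(1) s]
      by (simp add: couplings_def mm)
    then have le: "?W \<le> transport_cost c ?\<omega>"
      by (intro transport_W_square_le[OF c] mix_measure_prob_measures p)
    have \<omega>: "prob_space ?\<omega>" "sets ?\<omega> = sets (borel \<Otimes>\<^sub>M borel)"
      using s1 s2 by (auto intro!: prob_space_mix_measure)
    have "(\<lambda>p. ennreal (c (fst p) (snd p))) \<in> borel_measurable \<omega>1"
      using c s1(2) by (simp add: bounded_cost_def cong: measurable_cong_sets)
    from nn_integral_mix_measure[OF s this]
    have "ennreal (transport_cost c ?\<omega>) =
        inverse 2 * (ennreal (transport_cost c \<omega>1) + ennreal (transport_cost c \<omega>2))"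
      by (simp add: transport_cost_facts(2)[OF c] \<omega> s1(1,2) s2(1,2))
    also have "\<dots> = ennreal (1 / 2 * (transport_cost c \<omega>1 + transport_cost c \<omega>2))"
      using transport_cost_facts(3)[OF c s1(1,2)] transport_cost_facts(3)[OF c s2(1,2)]
      by (simp add: half_ennreal flip: ennreal_plus)
    finally have "transport_cost c ?\<omega> = 1 / 2 * (transport_cost c \<omega>1 + transport_cost c \<omega>2)"
      using transport_cost_facts(3)[OF c s1(1,2)] transport_cost_facts(3)[OF c s2(1,2)]
        transport_cost_facts(3)[OF c \<omega>] by (simp add: ennreal_inj)
    then show ?thesis using le by simp
  qed
  \<comment> \<open>The two couplings vary independently, so the infima are taken one after the
    other.\<close>
  have "2 * ?W - transport_cost c \<omega>1 \<le> ?W2" if 1: "\<omega>1 \<in> couplings \<nu>1 \<mu>" for \<omega>1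
    using key[OF 1] by (intro transport_W_square_greatest[OF c p(2,3)]) fastforce
  then have "2 * ?W - ?W2 \<le> ?W1"
    by (intro transport_W_square_greatest[OF c p(1,3)]) fastforce
  then show ?thesis by simp
qed

text \<open>A coupling of \<open>\<nu>\<close> with \<open>f\<close> is kept on the part \<open>min f g\<close> that \<open>f\<close> shares with \<open>g\<close>; the
  remaining mass is coupled with the excess of \<open>g\<close> over \<open>f\<close> by a product measure.\<close>

lemma transport_W_square_L1:
  fixes M :: "'a::topological_space measure" and f g :: "'a \<Rightarrow> real"
  assumes c: "bounded_cost C c"
    and M [measurable_cong]: "sets M = sets borel"
    and f: "integrable M f" "\<And>x. 0 \<le> f x" "(LINT x|M. f x) = 1"
    and g: "integrable M g" "\<And>x. 0 \<le> g x" "(LINT x|M. g x) = 1"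
    and \<nu>: "\<nu> \<in> prob_measures"
    and \<mu>: "density M f \<in> prob_measures" "density M g \<in> prob_measures"
  shows "(transport_W c \<nu> (density M g))\<^sup>2 \<le>
    (transport_W c \<nu> (density M f))\<^sup>2 + C * (LINT x|M. \<bar>f x - g x\<bar>)"
proof -
  define k where "k = (\<lambda>x. min (f x) (g x))"
  \<comment> \<open>The fraction of the mass of f that is kept. The value 1 where f vanishes keeps h
    in [0, 1] and is compatible with \<open>f x * h x = k x\<close>, since k vanishes there
    too.\<close>
  define h where "h = (\<lambda>x. if f x = 0 then 1 else min 1 (g x / f x))"
  define m where "m = (LINT x|M. g x - k x)"
  have fm: "f \<in> borel_measurable M" "g \<in> borel_measurable M" using f g by auto
  then have [measurable]: "f \<in> borel_measurable borel" "g \<in> borel_measurable borel"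
    using M by (simp_all cong: measurable_cong_sets)
  have [measurable]: "k \<in> borel_measurable borel" "h \<in> borel_measurable borel"
    by (simp_all add: k_def h_def)
  have h: "0 \<le> h x" "h x \<le> 1" "f x * h x = k x" for x
    using f(2)[of x] g(2)[of x] by (auto simp: h_def k_def min_def field_simps)
  have C: "0 \<le> C" using c unfolding bounded_cost_def by (meson order_trans)
  have k: "integrable M k" unfolding k_def using f g by (intro integrable_min)
  have k0: "0 \<le> k x" "k x \<le> f x" "k x \<le> g x" for x using f g by (auto simp: k_def)
  have m0: "0 \<le> m" unfolding m_def using k0 by (intro Bochner_Integration.integral_nonneg) simp
  have mf: "m = (LINT x|M. f x - k x)" unfolding m_def using f g k by simp
  have mL1: "m \<le> (LINT x|M. \<bar>f x - g x\<bar>)"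
    unfolding m_def using f g k
    by (intro integral_mono Bochner_Integration.integrable_diff integrable_abs) (auto simp: k_def)
  have L1: "(transport_W c \<nu> (density M g))\<^sup>2 \<le> (transport_W c \<nu> (density M f))\<^sup>2 + C * m"
  \<comment> \<open>The excess of g is normalized by m, so the case where no mass has to move is
    separate; there f and g agree almost everywhere.\<close>
  proof (cases "m = 0")
    case True
    have "AE x in M. f x - k x = 0"
      using mf True f k k0 by (subst integral_nonneg_eq_0_iff_AE[symmetric]) auto
    moreover have "AE x in M. g x - k x = 0"
      using m_def True g k k0 by (subst integral_nonneg_eq_0_iff_AE[symmetric]) auto
    ultimately have "AE x in M. ennreal (f x) = ennreal (g x)" by eventually_elim simp
    then have "density M f = density M g"
      using fm by (intro density_cong) auto
    then show ?thesis using True by simp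
  next
    case False
    with m0 have m: "0 < m" by simp
    define \<beta> where "\<beta> = density M (\<lambda>x. ennreal ((g x - k x) / m))"
    have sets_\<beta> [simp, measurable_cong]: "sets \<beta> = sets borel" by (simp add: \<beta>_def M)
    have space_M: "space M = UNIV" using sets_eq_imp_space_eq[OF M] by simp
    have space_\<beta> [simp]: "space \<beta> = UNIV" by (simp add: \<beta>_def space_M)
    have nn: "(\<integral>\<^sup>+x. ennreal (g x - k x) \<partial>M) = ennreal m" "(\<integral>\<^sup>+x. ennreal (f x - k x) \<partial>M) = ennreal m"
      unfolding m_def using f g k k0 by (subst nn_integral_eq_integral; simp)+
    have em_\<beta>: "ennreal m * emeasure \<beta> B = (\<integral>\<^sup>+x. ennreal (g x - k x) * indicator B x \<partial>M)"
      if [measurable]: "B \<in> sets borel" for B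
    proof -
      have [measurable]: "B \<in> sets M" using that M by simp
      have "ennreal m * emeasure \<beta> B = (\<integral>\<^sup>+x. ennreal m * (ennreal ((g x - k x) / m) * indicator B x) \<partial>M)"
        by (simp add: \<beta>_def emeasure_density nn_integral_cmult)
      also have "\<dots> = (\<integral>\<^sup>+x. ennreal (g x - k x) * indicator B x \<partial>M)"
      proof (intro nn_integral_cong)
        fix x
        have "ennreal m * ennreal ((g x - k x) / m) = ennreal (g x - k x)"
          using m k0[of x] by (simp flip: ennreal_mult)
        then show "ennreal m * (ennreal ((g x - k x) / m) * indicator B x) = ennreal (g x - k x) * indicator B x"
          by (simp flip: mult.assoc)
      qed
      finally show ?thesis .
    qed
    have "ennreal m * emeasure \<beta> UNIV = ennreal m * 1"
      using em_\<beta>[of UNIV] nn by simp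
    then have one_\<beta>: "emeasure \<beta> UNIV = 1"
      using m by (subst (asm) ennreal_mult_cancel_left) auto
    then interpret \<beta>: prob_space \<beta> by (intro prob_spaceI) simp
    have "(transport_W c \<nu> (density M g))\<^sup>2 - C * m \<le> transport_cost c \<omega>"
      if \<omega>: "\<omega> \<in> couplings \<nu> (density M f)" for \<omega>
    proof -
      note \<omega>' = couplingsD[OF \<omega>]
      note [measurable_cong] = \<omega>'(2)
      have space_\<omega>: "space \<omega> = UNIV" using sets_eq_imp_space_eq[OF \<omega>'(2)] by (simp add: space_pair_measure)
      \<comment> \<open>\<open>\<omega>1\<close> keeps the fraction h of the mass and \<alpha>
        records where the withdrawn mass sits in the first factor. The total of \<alpha> is m, so
        its product with \<beta> restores the first marginal and supplies the second with g -
        k.\<close>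
      define \<omega>1 where "\<omega>1 = density \<omega> (\<lambda>p. ennreal (h (snd p)))"
      define \<alpha> where "\<alpha> = distr (density \<omega> (\<lambda>p. ennreal (1 - h (snd p)))) borel fst"
      have [simp, measurable_cong]: "sets \<alpha> = sets borel" "space \<alpha> = UNIV" by (simp_all add: \<alpha>_def)
      have [simp]: "sets \<omega>1 = sets (borel \<Otimes>\<^sub>M borel)" "space \<omega>1 = UNIV"
        by (simp_all add: \<omega>1_def \<omega>'(2) space_\<omega>)
      have em_\<alpha>: "emeasure \<alpha> A = (\<integral>\<^sup>+p. ennreal (1 - h (snd p)) * indicator A (fst p) \<partial>\<omega>)"
        if [measurable]: "A \<in> sets borel" for A
      proof -
        have "fst -` A \<in> sets \<omega>"
          using measurable_sets[OF coupling_projections_measurable(1)[OF \<omega>] that] by (simp add: space_\<omega>)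
        then show ?thesis
          by (simp add: \<alpha>_def emeasure_distr emeasure_density space_\<omega>)
             (intro nn_integral_cong, auto simp: indicator_def)
      qed
      have marg: "(\<integral>\<^sup>+p. ennreal (u (snd p)) \<partial>\<omega>) = (\<integral>\<^sup>+x. ennreal (f x * u x) \<partial>M)"
        if [measurable]: "u \<in> borel_measurable borel" for u :: "'a \<Rightarrow> real"
      proof -
        have "(\<integral>\<^sup>+p. ennreal (u (snd p)) \<partial>\<omega>) = (\<integral>\<^sup>+x. ennreal (u x) \<partial>distr \<omega> borel snd)"
          by (subst nn_integral_distr) auto
        also have "\<dots> = (\<integral>\<^sup>+x. ennreal (f x) * ennreal (u x) \<partial>M)"
          unfolding \<omega>'(4) by (subst nn_integral_density) auto
        finally show ?thesis using f(2) by (simp add: ennreal_mult')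
      qed
      have tot_\<alpha>: "emeasure \<alpha> UNIV = ennreal m"
        using em_\<alpha>[of UNIV] marg[of "\<lambda>x. 1 - h x"] nn(2) by (simp add: h(3) right_diff_distrib)
      interpret \<alpha>: finite_measure \<alpha> by (rule finite_measureI) (simp add: tot_\<alpha>)
      let ?\<omega> = "add_measure \<omega>1 (\<alpha> \<Otimes>\<^sub>M \<beta>)"
      have s: "sets (\<alpha> \<Otimes>\<^sub>M \<beta>) = sets \<omega>1" by (simp cong: sets_pair_measure_cong)
      have [simp]: "space (\<alpha> \<Otimes>\<^sub>M \<beta>) = UNIV" by (simp add: space_pair_measure)
      have Times: "emeasure (\<alpha> \<Otimes>\<^sub>M \<beta>) (A \<times> B) = emeasure \<alpha> A * emeasure \<beta> B"
        if "A \<in> sets borel" "B \<in> sets borel" for A B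
        using that by (intro \<beta>.emeasure_pair_measure_Times) auto
      have fst: "emeasure ?\<omega> (A \<times> UNIV) = emeasure \<nu> A" if A [measurable]: "A \<in> sets borel" for A
      proof -
        have "emeasure ?\<omega> (A \<times> UNIV) = emeasure \<omega>1 (A \<times> UNIV) + emeasure \<alpha> A"
          by (subst emeasure_add_measure[OF s]) (simp_all add: Times one_\<beta>)
        also have "emeasure \<omega>1 (A \<times> UNIV) = (\<integral>\<^sup>+p. ennreal (h (snd p)) * indicator A (fst p) \<partial>\<omega>)"
          by (simp add: \<omega>1_def emeasure_density \<omega>'(2)) (intro nn_integral_cong, auto simp: indicator_def)
        also have "\<dots> + emeasure \<alpha> A =
            (\<integral>\<^sup>+p. ennreal (h (snd p)) * indicator A (fst p) + ennreal (1 - h (snd p)) * indicator A (fst p) \<partial>\<omega>)"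
          unfolding em_\<alpha>[OF A] by (subst nn_integral_add) auto
        also have "\<dots> = (\<integral>\<^sup>+p. indicator A (fst p) \<partial>\<omega>)"
          using h by (intro nn_integral_cong) (simp add: indicator_def flip: ennreal_plus)
        also have "\<dots> = (\<integral>\<^sup>+x. indicator A x \<partial>distr \<omega> borel fst)"
          by (subst nn_integral_distr) auto
        also have "\<dots> = emeasure \<nu> A" unfolding \<omega>'(3)[symmetric] by simp
        finally show ?thesis .
      qed
      have snd: "emeasure ?\<omega> (UNIV \<times> B) = emeasure (density M g) B" if B [measurable]: "B \<in> sets borel" for B
      proof -
        have [measurable]: "B \<in> sets M" using B M by simp
        have "emeasure ?\<omega> (UNIV \<times> B) = emeasure \<omega>1 (UNIV \<times> B) + ennreal m * emeasure \<beta> B"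
          by (subst emeasure_add_measure[OF s]) (simp_all add: Times tot_\<alpha>)
        also have "emeasure \<omega>1 (UNIV \<times> B) = (\<integral>\<^sup>+p. ennreal (h (snd p) * indicator B (snd p)) \<partial>\<omega>)"
          by (simp add: \<omega>1_def emeasure_density \<omega>'(2)) (intro nn_integral_cong, auto simp: indicator_def)
        also have "\<dots> = (\<integral>\<^sup>+x. ennreal (f x * (h x * indicator B x)) \<partial>M)" by (rule marg) auto
        also have "\<dots> = (\<integral>\<^sup>+x. ennreal (k x) * indicator B x \<partial>M)"
          by (intro nn_integral_cong) (auto simp: h(3) indicator_def)
        also have "\<dots> + ennreal m * emeasure \<beta> B =
            (\<integral>\<^sup>+x. ennreal (k x) * indicator B x + ennreal (g x - k x) * indicator B x \<partial>M)"
          unfolding em_\<beta>[OF B] by (subst nn_integral_add) auto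
        also have "\<dots> = (\<integral>\<^sup>+x. ennreal (g x) * indicator B x \<partial>M)"
          using k0 by (intro nn_integral_cong) (simp add: indicator_def flip: ennreal_plus)
        also have "\<dots> = emeasure (density M g) B" by (simp add: emeasure_density)
        finally show ?thesis .
      qed
      have "emeasure ?\<omega> UNIV = 1"
        using fst[of UNIV] \<nu> prob_space.emeasure_space_1[of \<nu>] sets_eq_imp_space_eq[of \<nu> borel]
        by (simp add: prob_measures_def)
      then have p: "prob_space ?\<omega>" by (intro prob_spaceI) simp
      have "distr ?\<omega> borel fst = \<nu>"
      proof (rule measure_eqI)
        show "sets (distr ?\<omega> borel fst) = sets \<nu>" using \<nu> by (simp add: prob_measures_def)
        fix A assume "A \<in> sets (distr ?\<omega> borel fst)"
        then have [measurable]: "A \<in> sets borel" by simp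
        have "fst \<in> ?\<omega> \<rightarrow>\<^sub>M (borel :: 'a measure)" by (simp cong: measurable_cong_sets)
        then have "emeasure (distr ?\<omega> borel fst) A = emeasure ?\<omega> (fst -` A \<inter> space ?\<omega>)"
          by (rule emeasure_distr) simp
        also have "fst -` A \<inter> space ?\<omega> = A \<times> UNIV" by auto
        finally show "emeasure (distr ?\<omega> borel fst) A = emeasure \<nu> A" by (simp add: fst)
      qed
      moreover have "distr ?\<omega> borel snd = density M g"
      proof (rule measure_eqI)
        show "sets (distr ?\<omega> borel snd) = sets (density M g)" by (simp add: M)
        fix B assume "B \<in> sets (distr ?\<omega> borel snd)"
        then have [measurable]: "B \<in> sets borel" by simp
        have "snd \<in> ?\<omega> \<rightarrow>\<^sub>M (borel :: 'a measure)" by (simp cong: measurable_cong_sets)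
        then have "emeasure (distr ?\<omega> borel snd) B = emeasure ?\<omega> (snd -` B \<inter> space ?\<omega>)"
          by (rule emeasure_distr) simp
        also have "snd -` B \<inter> space ?\<omega> = UNIV \<times> B" by auto
        finally show "emeasure (distr ?\<omega> borel snd) B = emeasure (density M g) B" by (simp add: snd)
      qed
      ultimately have cpl: "?\<omega> \<in> couplings \<nu> (density M g)"
        using p by (simp add: couplings_def)
      have cm [measurable]: "(\<lambda>p. c (fst p) (snd p)) \<in> borel_measurable (borel \<Otimes>\<^sub>M borel)"
        and cb: "0 \<le> c x y" "c x y \<le> C" for x y
        using c by (auto simp: bounded_cost_def)
      have "ennreal (transport_cost c ?\<omega>) = (\<integral>\<^sup>+p. ennreal (c (fst p) (snd p)) \<partial>?\<omega>)"
        using couplingsD[OF cpl] by (intro transport_cost_facts(2)[OF c])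
      also have "\<dots> = (\<integral>\<^sup>+p. ennreal (c (fst p) (snd p)) \<partial>\<omega>1) +
          (\<integral>\<^sup>+p. ennreal (c (fst p) (snd p)) \<partial>(\<alpha> \<Otimes>\<^sub>M \<beta>))"
        by (rule nn_integral_add_measure[OF s]) (simp cong: measurable_cong_sets)
      \<comment> \<open>The kept mass costs no more than before because h \<le> 1; the product has
        mass m and costs at most C per unit.\<close>
      also have "\<dots> \<le> (\<integral>\<^sup>+p. ennreal (c (fst p) (snd p)) \<partial>\<omega>) + ennreal (C * m)"
      proof (rule add_mono)
        have "(\<integral>\<^sup>+p. ennreal (c (fst p) (snd p)) \<partial>\<omega>1) =
            (\<integral>\<^sup>+p. ennreal (h (snd p)) * ennreal (c (fst p) (snd p)) \<partial>\<omega>)"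
          unfolding \<omega>1_def by (subst nn_integral_density) auto
        also have "\<dots> \<le> (\<integral>\<^sup>+p. ennreal (c (fst p) (snd p)) \<partial>\<omega>)"
          using h cb by (intro nn_integral_mono) (auto simp: mult_left_le_one_le simp flip: ennreal_mult)
        finally show "(\<integral>\<^sup>+p. ennreal (c (fst p) (snd p)) \<partial>\<omega>1) \<le>
            (\<integral>\<^sup>+p. ennreal (c (fst p) (snd p)) \<partial>\<omega>)" .
        have "(\<integral>\<^sup>+p. ennreal (c (fst p) (snd p)) \<partial>(\<alpha> \<Otimes>\<^sub>M \<beta>)) \<le> (\<integral>\<^sup>+p. ennreal C \<partial>(\<alpha> \<Otimes>\<^sub>M \<beta>))"
          using cb by (intro nn_integral_mono) (simp add: ennreal_leI)
        also have "\<dots> = ennreal (C * m)"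
          using Times[of UNIV UNIV] C m by (simp add: tot_\<alpha> one_\<beta> ennreal_mult)
        finally show "(\<integral>\<^sup>+p. ennreal (c (fst p) (snd p)) \<partial>(\<alpha> \<Otimes>\<^sub>M \<beta>)) \<le> ennreal (C * m)" .
      qed
      also have "\<dots> = ennreal (transport_cost c \<omega> + C * m)"
        using transport_cost_facts(2,3)[OF c \<omega>'(1,2)] C m by (simp add: ennreal_plus)
      finally have "transport_cost c ?\<omega> \<le> transport_cost c \<omega> + C * m"
        using transport_cost_facts(3)[OF c \<omega>'(1,2)] C m by (subst (asm) ennreal_le_iff) auto
      then show ?thesis using transport_W_square_le[OF c cpl \<nu> \<mu>(2)] by linarith
    qed
    then have "(transport_W c \<nu> (density M g))\<^sup>2 - C * m \<le> (transport_W c \<nu> (density M f))\<^sup>2"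
      by (rule transport_W_square_greatest[OF c \<nu> \<mu>(1)])
    then show ?thesis by simp
  qed
  also have "C * m \<le> C * (LINT x|M. \<bar>f x - g x\<bar>)" using mL1 C by (rule mult_left_mono)
  finally show ?thesis by simp
qed

text \<open>The diagonal coupling moves nothing.\<close>

lemma transport_W_self:
  assumes c: "bounded_cost C c" and \<mu>: "\<mu> \<in> prob_measures" and "\<And>x. c x x = 0"
  shows "(transport_W c \<mu> \<mu>)\<^sup>2 = 0"
proof -
  have s [measurable_cong]: "sets \<mu> = sets borel" and p: "prob_space \<mu>" using \<mu> by (auto simp: prob_measures_def)
  let ?\<omega> = "distr \<mu> (borel \<Otimes>\<^sub>M borel) (\<lambda>x. (x, x))"
  have "prob_space ?\<omega>" by (rule prob_space.prob_space_distr[OF p]) measurable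
  moreover have "distr ?\<omega> borel fst = distr \<mu> borel id" "distr ?\<omega> borel snd = distr \<mu> borel id"
    by (simp_all add: distr_distr comp_def id_def)
  moreover have "distr \<mu> borel id = \<mu>" using s by (simp add: id_def distr_id2)
  ultimately have "?\<omega> \<in> couplings \<mu> \<mu>" by (simp add: couplings_def)
  then have "(transport_W c \<mu> \<mu>)\<^sup>2 \<le> transport_cost c ?\<omega>"
    by (intro transport_W_square_le[OF c _ \<mu> \<mu>])
  also have "\<dots> = (LINT x|\<mu>. c x x)"
    unfolding transport_cost_def using c by (subst integral_distr) (auto simp: bounded_cost_def)
  finally show ?thesis using assms(3) by simp
qed

section \<open>Entropy\<close>

text \<open>Comparing \<open>a ln a\<close> with the tangent of \<open>r ln r\<close> at \<open>m\<close> leaves a square, because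
  \<open>ln (m / a) = 2 ln (sqrt (m / a)) \<le> 2 (sqrt (m / a) - 1)\<close>.\<close>

lemma xlnx_tangent:
  fixes a m :: real
  assumes "0 \<le> a" "0 < m"
  shows "a * ln a \<ge> m * ln m + (ln m + 1) * (a - m) + (sqrt a - sqrt m)\<^sup>2"
proof (cases "a = 0")
  case True
  then show ?thesis using assms by (simp add: algebra_simps)
next
  case False
  then have a: "0 < a" using assms by simp
  have "ln (sqrt (m / a)) \<le> sqrt (m / a) - 1" using a assms by (intro ln_le_minus_one) simp
  moreover have "ln (sqrt (m / a)) = (ln m - ln a) / 2" using a assms by (simp add: ln_sqrt ln_div)
  ultimately have "ln m - ln a \<le> 2 * (sqrt (m / a) - 1)" by simp
  then have "a * (ln m - ln a) \<le> a * (2 * (sqrt (m / a) - 1))" using a by (intro mult_left_mono) auto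
  also have "\<dots> = 2 * (a * sqrt (m / a)) - 2 * a" by (simp add: algebra_simps)
  also have "a * sqrt (m / a) = sqrt a * sqrt m"
    using a by (simp add: real_sqrt_divide field_simps)
  finally have 1: "a * (ln m - ln a) \<le> 2 * (sqrt a * sqrt m) - 2 * a" .
  have 2: "(sqrt a - sqrt m)\<^sup>2 = a + m - 2 * (sqrt a * sqrt m)"
    using a assms by (simp add: power2_diff)
  show ?thesis using 1 unfolding 2 by (simp add: algebra_simps)
qed

text \<open>Convexity defect of r ln r at the midpoint. For two probability densities its integral
  is twice the Jensen-Shannon divergence.\<close>

definition xlnx_gap :: "real \<Rightarrow> real \<Rightarrow> real"
  where "xlnx_gap a b = a * ln a + b * ln b - 2 * ((a + b) / 2 * ln ((a + b) / 2))"

text \<open>A Pinsker-type inequality in pointwise form. The tangent bound at the midpoint leaves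
  squares of differences of roots; \<open>\<bar>x - m\<bar>\<close> contains such a difference as a
  factor, and Young's inequality with the free parameter s separates it from the other.\<close>

lemma xlnx_gap_bound:
  assumes "0 \<le> a" "0 \<le> b" "0 < s"
  shows "\<bar>a - b\<bar> \<le> xlnx_gap a b / (2 * s) + 2 * s * (a + b)"
    and "0 \<le> xlnx_gap a b"
proof -
  define m where "m = (a + b) / 2"
  consider "m = 0" | "0 < m" using assms by (fastforce simp: m_def)
  then have "\<bar>a - b\<bar> \<le> xlnx_gap a b / (2 * s) + 2 * s * (a + b) \<and> 0 \<le> xlnx_gap a b"
  proof cases
    case 1
    then have "a = 0" "b = 0" using assms by (auto simp: m_def)
    then show ?thesis by (simp add: xlnx_gap_def)
  next
    case 2
    have gap: "(sqrt a - sqrt m)\<^sup>2 + (sqrt b - sqrt m)\<^sup>2 \<le> xlnx_gap a b"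
    proof -
      \<comment> \<open>The linear terms of the two tangents cancel because m is the
        midpoint.\<close>
      have "(ln m + 1) * (a - m) + (ln m + 1) * (b - m) = 0"
        unfolding distrib_left[symmetric] by (simp add: m_def field_simps)
      then show ?thesis
        using xlnx_tangent[OF assms(1) 2] xlnx_tangent[OF assms(2) 2]
        unfolding xlnx_gap_def m_def[symmetric] by linarith
    qed
    have dev: "\<bar>x - m\<bar> \<le> (sqrt x - sqrt m)\<^sup>2 / (2 * s) + s * (x + m)" if "0 \<le> x" for x
    proof -
      let ?p = "\<bar>sqrt x - sqrt m\<bar>" and ?q = "sqrt x + sqrt m"
      have "x - m = (sqrt x - sqrt m) * (sqrt x + sqrt m)"
        using that 2 by (simp add: algebra_simps)
      then have e: "\<bar>x - m\<bar> = ?p * ?q" using that 2 by (simp add: abs_mult)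
      have "0 \<le> (?p - s * ?q)\<^sup>2" by simp
      then have "2 * s * (?p * ?q) \<le> ?p\<^sup>2 + s\<^sup>2 * ?q\<^sup>2"
        by (simp add: power2_eq_square algebra_simps)
      moreover have "?q\<^sup>2 \<le> 2 * (x + m)"
        using zero_le_power2[of "sqrt x - sqrt m"] that 2 by (simp add: power2_diff power2_sum)
      then have "s\<^sup>2 * ?q\<^sup>2 \<le> s\<^sup>2 * (2 * (x + m))" by (intro mult_left_mono) auto
      ultimately have "2 * s * \<bar>x - m\<bar> \<le> (sqrt x - sqrt m)\<^sup>2 + s\<^sup>2 * (2 * (x + m))"
        unfolding e power2_abs by linarith
      then have "\<bar>x - m\<bar> \<le> ((sqrt x - sqrt m)\<^sup>2 + s\<^sup>2 * (2 * (x + m))) / (2 * s)"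
        using assms(3) by (simp add: pos_le_divide_eq mult_ac)
      also have "\<dots> = (sqrt x - sqrt m)\<^sup>2 / (2 * s) + s * (x + m)"
        using assms(3) by (simp add: add_divide_distrib power2_eq_square)
      finally show ?thesis .
    qed
    have "\<bar>a - b\<bar> = \<bar>a - m\<bar> + \<bar>b - m\<bar>" by (auto simp: m_def abs_if field_simps)
    also have "\<dots> \<le> ((sqrt a - sqrt m)\<^sup>2 + (sqrt b - sqrt m)\<^sup>2) / (2 * s) + s * (a + b + 2 * m)"
      using dev[OF assms(1)] dev[OF assms(2)] by (simp add: add_divide_distrib algebra_simps)
    also have "\<dots> \<le> xlnx_gap a b / (2 * s) + s * (a + b + 2 * m)"
      using gap assms(3) by (intro add_right_mono divide_right_mono) auto
    also have "s * (a + b + 2 * m) = 2 * s * (a + b)" by (simp add: m_def algebra_simps)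
    finally have "\<bar>a - b\<bar> \<le> xlnx_gap a b / (2 * s) + 2 * s * (a + b)" .
    moreover have "0 \<le> (sqrt a - sqrt m)\<^sup>2 + (sqrt b - sqrt m)\<^sup>2" by simp
    ultimately show ?thesis using gap by linarith
  qed
  then show "\<bar>a - b\<bar> \<le> xlnx_gap a b / (2 * s) + 2 * s * (a + b)" "0 \<le> xlnx_gap a b" by auto
qed

text \<open>The tangent at 1 gives -1 in place of the sharp -1/e; this is enough on a space of mass
  one.\<close>

lemma xlnx_lower:
  fixes a :: real
  assumes "0 \<le> a"
  shows "- 1 \<le> a * ln a"
proof -
  have "a - 1 \<le> a - 1 + (sqrt a - 1)\<^sup>2" by simp
  also have "\<dots> \<le> a * ln a" using xlnx_tangent[OF assms zero_less_one] by simp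
  finally show ?thesis using assms by linarith
qed

section \<open>Measures of finite entropy\<close>

definition torus_density :: "'n::finite torus measure \<Rightarrow> 'n torus \<Rightarrow> real"
  where "torus_density \<mu> x = enn2real (RN_deriv torus_lebesgue \<mu> x)"

definition entropy_real :: "'n::finite torus measure \<Rightarrow> real"
  where "entropy_real \<mu> = (LINT x|torus_lebesgue. torus_density \<mu> x * ln (torus_density \<mu> x))"

text \<open>On this class the energies are real numbers, and extended real arithmetic can be left
  behind.\<close>

definition finite_entropy :: "'n::finite torus measure \<Rightarrow> bool"
  where "finite_entropy \<mu> \<longleftrightarrow> \<mu> \<in> prob_measures \<and> torus_entropy \<mu> < \<infinity>"

lemma torus_density_nonneg [simp]: "0 \<le> torus_density \<mu> x"
  by (simp add: torus_density_def)

lemma torus_density_measurable [measurable]: "torus_density \<mu> \<in> borel_measurable borel"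
proof -
  have "torus_density \<mu> \<in> borel_measurable torus_lebesgue"
    unfolding torus_density_def[abs_def] by measurable
  then show ?thesis by (simp cong: measurable_cong_sets)
qed

lemma ennreal_finite_obtain:
  assumes "x < (\<infinity> :: ennreal)"
  obtains r where "x = ennreal r" "0 \<le> r"
  using assms by (cases x) auto

lemma nn_integral_xlnx_neg:
  fixes f :: "'n::finite torus \<Rightarrow> real"
  assumes "\<And>x. 0 \<le> f x"
  shows "(\<integral>\<^sup>+ x. ennreal (- (f x * ln (f x))) \<partial>torus_lebesgue) < \<infinity>"
proof -
  interpret prob_space "torus_lebesgue :: 'n torus measure" by (rule prob_space_torus_lebesgue)
  have "(\<integral>\<^sup>+ x. ennreal (- (f x * ln (f x))) \<partial>torus_lebesgue) \<le> (\<integral>\<^sup>+ x. 1 \<partial>(torus_lebesgue :: 'n torus measure))"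
  proof (rule nn_integral_mono)
    show "ennreal (- (f x * ln (f x))) \<le> 1" for x
      using xlnx_lower[OF assms, of x] by (subst ennreal_le_1) linarith
  qed
  also have "\<dots> = 1" using emeasure_space_1 by simp
  finally show ?thesis by (rule le_less_trans) simp
qed

lemma entropy_eq_integral:
  fixes f :: "'n::finite torus \<Rightarrow> real"
  assumes [measurable]: "f \<in> borel_measurable borel" and "\<And>x. 0 \<le> f x"
    and fin: "(\<integral>\<^sup>+ x. ennreal (f x * ln (f x)) \<partial>torus_lebesgue) < \<infinity>"
  shows "integrable torus_lebesgue (\<lambda>x. f x * ln (f x))"
    and "enn2ereal (\<integral>\<^sup>+ x. ennreal (f x * ln (f x)) \<partial>torus_lebesgue) -
       enn2ereal (\<integral>\<^sup>+ x. ennreal (- (f x * ln (f x))) \<partial>torus_lebesgue) =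
       ereal (LINT x|torus_lebesgue. f x * ln (f x))"
proof -
  note neg = nn_integral_xlnx_neg[of f, OF assms(2)]
  show i: "integrable torus_lebesgue (\<lambda>x. f x * ln (f x))"
    using fin neg by (simp add: real_integrable_def less_top)
  from ennreal_finite_obtain[OF fin] obtain p where
    p: "(\<integral>\<^sup>+ x. ennreal (f x * ln (f x)) \<partial>torus_lebesgue) = ennreal p" "0 \<le> p" .
  from ennreal_finite_obtain[OF neg] obtain q where
    q: "(\<integral>\<^sup>+ x. ennreal (- (f x * ln (f x))) \<partial>torus_lebesgue) = ennreal q" "0 \<le> q" .
  show "enn2ereal (\<integral>\<^sup>+ x. ennreal (f x * ln (f x)) \<partial>torus_lebesgue) -
       enn2ereal (\<integral>\<^sup>+ x. ennreal (- (f x * ln (f x))) \<partial>torus_lebesgue) =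
       ereal (LINT x|torus_lebesgue. f x * ln (f x))"
    unfolding real_lebesgue_integral_def[OF i] p(1) q(1) using p(2) q(2) by (simp add: enn2ereal_ennreal)
qed

lemma finite_entropyD:
  fixes \<mu> :: "'n::finite torus measure"
  assumes "finite_entropy \<mu>"
  shows "\<mu> \<in> prob_measures"
    and "density torus_lebesgue (torus_density \<mu>) = \<mu>"
    and "integrable torus_lebesgue (torus_density \<mu>)"
    and "(LINT x|torus_lebesgue. torus_density \<mu> x) = 1"
    and "integrable torus_lebesgue (\<lambda>x. torus_density \<mu> x * ln (torus_density \<mu> x))"
    and "torus_entropy \<mu> = ereal (entropy_real \<mu>)"
proof -
  interpret L: prob_space "torus_lebesgue :: 'n torus measure" by (rule prob_space_torus_lebesgue)
  show \<mu>: "\<mu> \<in> prob_measures" using assms by (simp add: finite_entropy_def)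
  then interpret \<mu>: prob_space \<mu> by (simp add: prob_measures_def)
  have s: "sets \<mu> = sets torus_lebesgue" using \<mu> by (simp add: prob_measures_def)
  have ac: "absolutely_continuous torus_lebesgue \<mu>"
    using assms by (auto simp: finite_entropy_def torus_entropy_def split: if_splits)
  \<comment> \<open>\<open>RN_deriv\<close> takes extended values. Finiteness almost everywhere
    ensures that passing to the real function \<open>torus_density\<close> does not change the
    measure.\<close>
  have "AE x in torus_lebesgue. RN_deriv torus_lebesgue \<mu> x \<noteq> \<infinity>"
    by (rule L.RN_deriv_finite[OF \<mu>.sigma_finite_measure_axioms ac s])
  then have "AE x in torus_lebesgue. RN_deriv torus_lebesgue \<mu> x = ennreal (torus_density \<mu> x)"
    by eventually_elim (simp add: torus_density_def less_top)
  then have "density torus_lebesgue (RN_deriv torus_lebesgue \<mu>) = density torus_lebesgue (torus_density \<mu>)"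
    by (intro density_cong) auto
  then show d: "density torus_lebesgue (torus_density \<mu>) = \<mu>"
    using L.density_RN_deriv[OF ac s] by simp
  have "space \<mu> = UNIV" using sets_eq_imp_space_eq[OF s] by simp
  then have "emeasure (density torus_lebesgue (torus_density \<mu>)) UNIV = 1"
    unfolding d using \<mu>.emeasure_space_1 by simp
  then have nn: "(\<integral>\<^sup>+ x. ennreal (torus_density \<mu> x) \<partial>torus_lebesgue) = 1"
    by (simp add: emeasure_density)
  then show i: "integrable torus_lebesgue (torus_density \<mu>)"
    by (intro integrableI_nonneg) auto
  show "(LINT x|torus_lebesgue. torus_density \<mu> x) = 1"
    using nn nn_integral_eq_integral[OF i] by simp
  have e: "torus_entropy \<mu> = enn2ereal (\<integral>\<^sup>+ x. ennreal (torus_density \<mu> x * ln (torus_density \<mu> x)) \<partial>torus_lebesgue) -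
       enn2ereal (\<integral>\<^sup>+ x. ennreal (- (torus_density \<mu> x * ln (torus_density \<mu> x))) \<partial>torus_lebesgue)"
    using ac by (simp add: torus_entropy_def torus_density_def Let_def)
  \<comment> \<open>The negative part is finite, so an infinite positive part would make the entropy
    infinite.\<close>
  have "(\<integral>\<^sup>+ x. ennreal (torus_density \<mu> x * ln (torus_density \<mu> x)) \<partial>torus_lebesgue) < \<infinity>"
  proof (rule ccontr)
    assume "\<not> ?thesis"
    then have "(\<integral>\<^sup>+ x. ennreal (torus_density \<mu> x * ln (torus_density \<mu> x)) \<partial>torus_lebesgue) = \<infinity>"
      by (simp add: not_less top_unique)
    moreover obtain q where "(\<integral>\<^sup>+ x. ennreal (- (torus_density \<mu> x * ln (torus_density \<mu> x))) \<partial>torus_lebesgue) = ennreal q" "0 \<le> q"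
      by (rule ennreal_finite_obtain[OF nn_integral_xlnx_neg[OF torus_density_nonneg]])
    ultimately have "torus_entropy \<mu> = \<infinity>" unfolding e by simp
    then show False using assms by (simp add: finite_entropy_def)
  qed
  from entropy_eq_integral[OF torus_density_measurable torus_density_nonneg this]
  show "integrable torus_lebesgue (\<lambda>x. torus_density \<mu> x * ln (torus_density \<mu> x))"
    "torus_entropy \<mu> = ereal (entropy_real \<mu>)"
    unfolding e entropy_real_def by auto
qed

text \<open>Densities are determined up to null sets, so an explicit f may replace
  \<open>torus_density\<close> in the entropy.\<close>

lemma finite_entropy_density:
  fixes f :: "'n::finite torus \<Rightarrow> real"
  assumes [measurable]: "f \<in> borel_measurable borel" and f: "\<And>x. 0 \<le> f x"
    and \<mu>: "density torus_lebesgue f \<in> prob_measures"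
    and i: "integrable torus_lebesgue (\<lambda>x. f x * ln (f x))"
  shows "finite_entropy (density torus_lebesgue f)"
    and "entropy_real (density torus_lebesgue f) = (LINT x|torus_lebesgue. f x * ln (f x))"
proof -
  interpret L: prob_space "torus_lebesgue :: 'n torus measure" by (rule prob_space_torus_lebesgue)
  let ?\<mu> = "density torus_lebesgue f"
  have "AE x in torus_lebesgue. ennreal (f x) = RN_deriv torus_lebesgue ?\<mu> x"
    by (rule L.RN_deriv_unique) auto
  then have ae: "AE x in torus_lebesgue. torus_density ?\<mu> x = f x"
    by eventually_elim (metis enn2real_ennreal f torus_density_def)
  have [simp]: "absolutely_continuous torus_lebesgue ?\<mu>"
    by (rule absolutely_continuousI_density) auto
  have "(\<integral>\<^sup>+ x. ennreal (torus_density ?\<mu> x * ln (torus_density ?\<mu> x)) \<partial>torus_lebesgue) =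
      (\<integral>\<^sup>+ x. ennreal (f x * ln (f x)) \<partial>torus_lebesgue)"
    using ae by (intro nn_integral_cong_AE) auto
  also have "\<dots> < \<infinity>" using i by (simp add: real_integrable_def less_top)
  finally have "torus_entropy ?\<mu> =
      ereal (LINT x|torus_lebesgue. torus_density ?\<mu> x * ln (torus_density ?\<mu> x))"
    using entropy_eq_integral(2)[OF torus_density_measurable torus_density_nonneg]
    by (simp add: torus_entropy_def torus_density_def Let_def)
  then show "finite_entropy ?\<mu>" using \<mu> by (simp add: finite_entropy_def)
  show "entropy_real ?\<mu> = (LINT x|torus_lebesgue. f x * ln (f x))"
    unfolding entropy_real_def using ae by (intro integral_cong_AE) auto
qed

text \<open>For probability measures with densities this is twice the total variation
  distance.\<close>

definition L1_dist :: "'n::finite torus measure \<Rightarrow> 'n torus measure \<Rightarrow> real"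
  where "L1_dist \<mu> \<nu> = (LINT x|torus_lebesgue. \<bar>torus_density \<mu> x - torus_density \<nu> x\<bar>)"

lemma L1_dist_nonneg: "0 \<le> L1_dist \<mu> \<nu>"
  by (simp add: L1_dist_def)

lemma L1_dist_commute: "L1_dist \<mu> \<nu> = L1_dist \<nu> \<mu>"
  by (simp add: L1_dist_def abs_minus_commute)

lemma mix_measure_eq_density:
  assumes "finite_entropy \<mu>" "finite_entropy \<nu>"
  shows "mix_measure \<mu> \<nu> = density torus_lebesgue (\<lambda>x. (torus_density \<mu> x + torus_density \<nu> x) / 2)"
proof (rule measure_eqI)
  have s: "sets \<mu> = sets borel" "sets \<nu> = sets borel"
    using finite_entropyD(1)[OF assms(1)] finite_entropyD(1)[OF assms(2)] by (auto simp: prob_measures_def)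
  then show "sets (mix_measure \<mu> \<nu>) = sets (density torus_lebesgue (\<lambda>x. (torus_density \<mu> x + torus_density \<nu> x) / 2))"
    by simp
  fix A assume "A \<in> sets (mix_measure \<mu> \<nu>)"
  then have A [measurable]: "A \<in> sets borel" using s by simp
  have d: "emeasure \<kappa> A = (\<integral>\<^sup>+x. ennreal (torus_density \<kappa> x) * indicator A x \<partial>torus_lebesgue)"
    if "finite_entropy \<kappa>" for \<kappa>
    by (subst finite_entropyD(2)[OF that, symmetric]) (simp add: emeasure_density)
  have "emeasure (mix_measure \<mu> \<nu>) A = inverse 2 * (emeasure \<mu> A + emeasure \<nu> A)"
    using s by (simp add: emeasure_mix_measure)
  also have "\<dots> = (\<integral>\<^sup>+x. inverse 2 * (ennreal (torus_density \<mu> x) * indicator A x +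
      ennreal (torus_density \<nu> x) * indicator A x) \<partial>torus_lebesgue)"
    unfolding d[OF assms(1)] d[OF assms(2)]
    by (subst nn_integral_cmult, measurable) (subst nn_integral_add; simp)
  also have "\<dots> = (\<integral>\<^sup>+x. ennreal ((torus_density \<mu> x + torus_density \<nu> x) / 2) * indicator A x \<partial>torus_lebesgue)"
    by (intro nn_integral_cong) (simp add: indicator_def half_ennreal flip: ennreal_plus)
  also have "\<dots> = emeasure (density torus_lebesgue (\<lambda>x. (torus_density \<mu> x + torus_density \<nu> x) / 2)) A"
    by (simp add: emeasure_density)
  finally show "emeasure (mix_measure \<mu> \<nu>) A =
      emeasure (density torus_lebesgue (\<lambda>x. (torus_density \<mu> x + torus_density \<nu> x) / 2)) A" .
qed

text \<open>Uniform convexity of the entropy: \<open>xlnx_gap_bound\<close> is integrated over the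
  torus. The term 4 s is 2 s times the total mass 2 of the two densities.\<close>

lemma entropy_mix_measure:
  assumes \<mu>: "finite_entropy \<mu>" and \<nu>: "finite_entropy \<nu>"
  shows "finite_entropy (mix_measure \<mu> \<nu>)"
    and "0 < s \<Longrightarrow> L1_dist \<mu> \<nu> \<le>
      (entropy_real \<mu> + entropy_real \<nu> - 2 * entropy_real (mix_measure \<mu> \<nu>)) / (2 * s) + 4 * s"
proof -
  interpret L: prob_space "torus_lebesgue :: 'a torus measure" by (rule prob_space_torus_lebesgue)
  note D1 = finite_entropyD[OF \<mu>] and D2 = finite_entropyD[OF \<nu>]
  let ?f = "torus_density \<mu>" and ?g = "torus_density \<nu>"
  let ?h = "\<lambda>x. (?f x + ?g x) / 2"
  \<comment> \<open>Midpoint convexity bounds the integrand from above and \<open>xlnx_lower\<close>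
    from below, so the entropy of the midpoint is a genuine integral.\<close>
  have bound: "\<bar>?h x * ln (?h x)\<bar> \<le> 1 + \<bar>?f x * ln (?f x)\<bar> + \<bar>?g x * ln (?g x)\<bar>" for x
    using xlnx_gap_bound(2)[of "?f x" "?g x" 1] xlnx_lower[of "?h x"]
    by (simp add: xlnx_gap_def abs_if)
  have i: "integrable torus_lebesgue (\<lambda>x. ?h x * ln (?h x))"
  proof (rule Bochner_Integration.integrable_bound)
    show "integrable torus_lebesgue (\<lambda>x. 1 + \<bar>?f x * ln (?f x)\<bar> + \<bar>?g x * ln (?g x)\<bar>)"
      using D1(5) D2(5) by (intro Bochner_Integration.integrable_add integrable_abs) auto
  qed (use bound in auto)
  have p: "density torus_lebesgue ?h \<in> prob_measures"
    using mix_measure_prob_measures[OF D1(1) D2(1)] by (simp add: mix_measure_eq_density[OF \<mu> \<nu>])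
  note E = finite_entropy_density[of ?h, OF _ _ p i]
  show "finite_entropy (mix_measure \<mu> \<nu>)"
    unfolding mix_measure_eq_density[OF \<mu> \<nu>] by (rule E(1)) auto
  have S: "entropy_real (mix_measure \<mu> \<nu>) = (LINT x|torus_lebesgue. ?h x * ln (?h x))"
    unfolding mix_measure_eq_density[OF \<mu> \<nu>] by (rule E(2)) auto
  assume s: "0 < s"
  have ig: "integrable torus_lebesgue (\<lambda>x. xlnx_gap (?f x) (?g x))"
    unfolding xlnx_gap_def
    by (intro Bochner_Integration.integrable_diff Bochner_Integration.integrable_add integrable_mult_right D1(5) D2(5) i)
  have "L1_dist \<mu> \<nu> \<le> (LINT x|torus_lebesgue. xlnx_gap (?f x) (?g x) / (2 * s) + 2 * s * (?f x + ?g x))"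
    unfolding L1_dist_def using D1(3) D2(3) ig s
    by (intro integral_mono xlnx_gap_bound(1) Bochner_Integration.integrable_add integrable_abs
        Bochner_Integration.integrable_diff integrable_mult_right integrable_divide) auto
  also have "\<dots> = (LINT x|torus_lebesgue. xlnx_gap (?f x) (?g x)) / (2 * s) + 2 * s * 2"
    using D1(3,4) D2(3,4) ig by simp
  also have "(LINT x|torus_lebesgue. xlnx_gap (?f x) (?g x)) =
      entropy_real \<mu> + entropy_real \<nu> - 2 * entropy_real (mix_measure \<mu> \<nu>)"
    unfolding xlnx_gap_def S entropy_real_def[of \<mu>] entropy_real_def[of \<nu>]
    by (simp only: Bochner_Integration.integral_diff Bochner_Integration.integral_add
        Bochner_Integration.integrable_add integrable_mult_right integral_mult_right_zero D1(5) D2(5) i)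
  finally show "L1_dist \<mu> \<nu> \<le>
      (entropy_real \<mu> + entropy_real \<nu> - 2 * entropy_real (mix_measure \<mu> \<nu>)) / (2 * s) + 4 * s" by simp
qed

section \<open>Stability of minimizers\<close>

definition bounded_potential :: "('n::finite torus \<Rightarrow> real) \<Rightarrow> bool"
  where "bounded_potential V \<longleftrightarrow> V \<in> borel_measurable borel \<and> (\<exists>B. \<forall>x. \<bar>V x\<bar> \<le> B)"

definition jko_value ::
  "real \<Rightarrow> ('n::finite torus \<Rightarrow> 'n torus \<Rightarrow> real) \<Rightarrow> ('n torus \<Rightarrow> real) \<Rightarrow> 'n torus measure \<Rightarrow> 'n torus measure \<Rightarrow> real"
  where "jko_value \<tau> c V \<mu>0 \<nu> = entropy_real \<nu> + (LINT x|\<nu>. V x) + 1 / (2 * \<tau>) * (transport_W c \<nu> \<mu>0)\<^sup>2"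

definition jko_minimizer ::
  "real \<Rightarrow> ('n::finite torus \<Rightarrow> 'n torus \<Rightarrow> real) \<Rightarrow> ('n torus \<Rightarrow> real) \<Rightarrow> 'n torus measure \<Rightarrow> 'n torus measure \<Rightarrow> bool"
  where "jko_minimizer \<tau> c V \<mu>0 u \<longleftrightarrow> finite_entropy u \<and>
    (\<forall>\<nu>. finite_entropy \<nu> \<longrightarrow> jko_value \<tau> c V \<mu>0 u \<le> jko_value \<tau> c V \<mu>0 \<nu>)"

text \<open>The competitor w of finite value rules out infinite entropy of the minimizer; from then
  on only real numbers are compared.\<close>

lemma jko_minimizerI:
  fixes w :: "'n::finite torus measure" and V :: "'n torus \<Rightarrow> real"
  assumes min: "is_arg_min (\<lambda>\<nu>. free_energy V \<nu> + ereal (1 / (2 * \<tau>) * (transport_W c \<nu> \<mu>0)\<^sup>2))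
      (\<lambda>\<nu>. \<nu> \<in> prob_measures) u"
    and w: "finite_entropy w"
  shows "jko_minimizer \<tau> c V \<mu>0 u"
proof -
  let ?F = "\<lambda>\<nu>. free_energy V \<nu> + ereal (1 / (2 * \<tau>) * (transport_W c \<nu> \<mu>0)\<^sup>2)"
  have F: "?F \<nu> = ereal (jko_value \<tau> c V \<mu>0 \<nu>)" if "finite_entropy \<nu>" for \<nu>
    using finite_entropyD(6)[OF that] by (simp add: free_energy_def jko_value_def)
  have u: "u \<in> prob_measures" and le: "?F u \<le> ?F \<nu>" if "finite_entropy \<nu>" for \<nu>
    using min finite_entropyD(1)[OF that] by (auto simp: is_arg_min_def not_less)
  have "torus_entropy u < \<infinity>"
  proof (rule ccontr)
    assume "\<not> ?thesis"
    then have "?F u = \<infinity>" by (simp add: free_energy_def)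
    then show False using le[OF w] F[OF w] by simp
  qed
  then have fe: "finite_entropy u" using u[OF w] by (simp add: finite_entropy_def)
  then show ?thesis
    unfolding jko_minimizer_def using le F by (metis ereal_less_eq(3))
qed

lemma integral_potential_density:
  fixes f :: "'n::finite torus \<Rightarrow> real"
  assumes V: "bounded_potential V" and f: "integrable torus_lebesgue f" "\<And>x. 0 \<le> f x"
  shows "integrable torus_lebesgue (\<lambda>x. f x * V x)"
    and "(LINT x|density torus_lebesgue f. V x) = (LINT x|torus_lebesgue. f x * V x)"
proof -
  have [measurable]: "V \<in> borel_measurable torus_lebesgue" "f \<in> borel_measurable torus_lebesgue"
    using V f by (simp_all add: bounded_potential_def cong: measurable_cong_sets)
  obtain B where B: "\<bar>V x\<bar> \<le> B" for x using V by (auto simp: bounded_potential_def)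
  show "integrable torus_lebesgue (\<lambda>x. f x * V x)"
  proof (rule Bochner_Integration.integrable_bound)
    show "integrable torus_lebesgue (\<lambda>x. B * f x)" using f by simp
    have "\<bar>f x * V x\<bar> \<le> \<bar>B * f x\<bar>" for x
    proof -
      have "\<bar>f x * V x\<bar> = \<bar>V x\<bar> * f x" using f by (simp add: abs_mult)
      also have "\<dots> \<le> B * f x" using B f by (intro mult_right_mono) auto
      finally show ?thesis by simp
    qed
    then show "AE x in torus_lebesgue. norm (f x * V x) \<le> norm (B * f x)" by simp
  qed simp
  show "(LINT x|density torus_lebesgue f. V x) = (LINT x|torus_lebesgue. f x * V x)"
    using f by (subst integral_density) auto
qed

lemma integral_potential_mix:
  assumes V: "bounded_potential V" and \<mu>: "finite_entropy \<mu>" and \<nu>: "finite_entropy \<nu>"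
  shows "(LINT x|mix_measure \<mu> \<nu>. V x) = ((LINT x|\<mu>. V x) + (LINT x|\<nu>. V x)) / 2"
proof -
  note D1 = finite_entropyD[OF \<mu>] and D2 = finite_entropyD[OF \<nu>]
  have 1: "(LINT x|\<mu>. V x) = (LINT x|torus_lebesgue. torus_density \<mu> x * V x)"
    using integral_potential_density(2)[OF V D1(3)] D1(2) by simp
  have 2: "(LINT x|\<nu>. V x) = (LINT x|torus_lebesgue. torus_density \<nu> x * V x)"
    using integral_potential_density(2)[OF V D2(3)] D2(2) by simp
  have "(LINT x|mix_measure \<mu> \<nu>. V x) =
      (LINT x|torus_lebesgue. (torus_density \<mu> x + torus_density \<nu> x) / 2 * V x)"
    unfolding mix_measure_eq_density[OF \<mu> \<nu>] using D1(3) D2(3)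
    by (intro integral_potential_density(2)[OF V]) auto
  also have "\<dots> = (LINT x|torus_lebesgue. (torus_density \<mu> x * V x + torus_density \<nu> x * V x) / 2)"
    by (simp add: algebra_simps add_divide_distrib)
  also have "\<dots> = ((LINT x|\<mu>. V x) + (LINT x|\<nu>. V x)) / 2"
    unfolding 1 2
    using integral_potential_density(1)[OF V D1(3)] integral_potential_density(1)[OF V D2(3)] by simp
  finally show ?thesis .
qed

lemma integral_potential_le:
  assumes U: "bounded_potential U" and V: "bounded_potential V" and \<nu>: "\<nu> \<in> prob_measures"
    and le: "\<And>x. U x \<le> V x + \<delta>"
  shows "(LINT x|\<nu>. U x) \<le> (LINT x|\<nu>. V x) + \<delta>"
proof -
  interpret prob_space \<nu> using \<nu> by (simp add: prob_measures_def)
  have i: "integrable \<nu> W" if W: "bounded_potential W" for W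
  proof -
    obtain B where "\<bar>W x\<bar> \<le> B" for x using W by (auto simp: bounded_potential_def)
    moreover have "W \<in> borel_measurable \<nu>"
      using W \<nu> by (simp add: bounded_potential_def prob_measures_def cong: measurable_cong_sets)
    ultimately show ?thesis by (intro integrable_const_bound[of _ B]) auto
  qed
  have "(LINT x|\<nu>. U x) \<le> (LINT x|\<nu>. V x + \<delta>)"
    by (intro integral_mono Bochner_Integration.integrable_add integrable_const i U V le)
  also have "\<dots> = (LINT x|\<nu>. V x) + \<delta>" using i[OF V] by (simp add: prob_space)
  finally show ?thesis .
qed

text \<open>One-sided, so that the two functionals can be exchanged afterwards. The previous iterate
  is the second marginal, the one that varies in \<open>transport_W_square_L1\<close>.\<close>

lemma jko_value_perturb:
  assumes c: "bounded_cost C c1" "bounded_cost C c2" and V: "bounded_potential V1" "bounded_potential V2"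
    and fe: "finite_entropy \<nu>" "finite_entropy u0" "finite_entropy v0" and \<tau>: "0 < \<tau>"
    and V_le: "\<And>x. V1 x \<le> V2 x + \<delta>" and c_le: "\<And>x y. c1 x y \<le> c2 x y + \<delta>'"
  shows "jko_value \<tau> c1 V1 u0 \<nu> \<le> jko_value \<tau> c2 V2 v0 \<nu> + (\<delta> + 1 / (2 * \<tau>) * (\<delta>' + C * L1_dist u0 v0))"
proof -
  note p = finite_entropyD(1)[OF fe(1)] finite_entropyD(1)[OF fe(2)] finite_entropyD(1)[OF fe(3)]
  have "(transport_W c1 \<nu> u0)\<^sup>2 \<le> (transport_W c2 \<nu> u0)\<^sup>2 + \<delta>'"
    by (rule transport_W_square_cost_mono[OF c p(1,2) c_le])
  moreover have "(transport_W c2 \<nu> u0)\<^sup>2 \<le> (transport_W c2 \<nu> v0)\<^sup>2 + C * L1_dist v0 u0"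
    using transport_W_square_L1[OF c(2) sets_torus_lebesgue finite_entropyD(3)[OF fe(3)] _ finite_entropyD(4)[OF fe(3)]
        finite_entropyD(3)[OF fe(2)] _ finite_entropyD(4)[OF fe(2)] p(1)] p(2,3)
    unfolding finite_entropyD(2)[OF fe(2)] finite_entropyD(2)[OF fe(3)] L1_dist_def by simp
  ultimately have "(transport_W c1 \<nu> u0)\<^sup>2 \<le> (transport_W c2 \<nu> v0)\<^sup>2 + (\<delta>' + C * L1_dist u0 v0)"
    unfolding L1_dist_commute[of v0 u0] by linarith
  then have "1 / (2 * \<tau>) * (transport_W c1 \<nu> u0)\<^sup>2 \<le>
      1 / (2 * \<tau>) * ((transport_W c2 \<nu> v0)\<^sup>2 + (\<delta>' + C * L1_dist u0 v0))"
    using \<tau> by (intro mult_left_mono) auto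
  moreover have "(LINT x|\<nu>. V1 x) \<le> (LINT x|\<nu>. V2 x) + \<delta>"
    by (rule integral_potential_le[OF V p(1) V_le])
  ultimately show ?thesis unfolding jko_value_def distrib_left by linarith
qed

text \<open>Perturbing the functional by \<open>\<eta>\<close> moves its minimizer by \<open>O(sqrt \<eta>)\<close> in \<open>L\<^sup>1\<close>: the midpoint of the two
  minimizers is a competitor, and the entropy is uniformly convex.\<close>

lemma jko_minimizer_stable:
  assumes c: "bounded_cost C c1" "bounded_cost C c2" and V: "bounded_potential V1" "bounded_potential V2"
    and fe: "finite_entropy u0" "finite_entropy v0" and \<tau>: "0 < \<tau>"
    and V_close: "\<And>x. \<bar>V1 x - V2 x\<bar> \<le> \<delta>" and c_close: "\<And>x y. \<bar>c1 x y - c2 x y\<bar> \<le> \<delta>'"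
    and u: "jko_minimizer \<tau> c1 V1 u0 u" and v: "jko_minimizer \<tau> c2 V2 v0 v"
    and s: "0 < s"
  shows "L1_dist u v \<le> 4 * s + (\<delta> + 1 / (2 * \<tau>) * (\<delta>' + C * L1_dist u0 v0)) / s"
proof -
  define \<eta> where "\<eta> = \<delta> + 1 / (2 * \<tau>) * (\<delta>' + C * L1_dist u0 v0)"
  have fu: "finite_entropy u" and fv: "finite_entropy v"
    using u v by (auto simp: jko_minimizer_def)
  let ?w = "mix_measure u v"
  have fw: "finite_entropy ?w" by (rule entropy_mix_measure(1)[OF fu fv])
  let ?F = "jko_value \<tau> c2 V2 v0"
  \<comment> \<open>Passing from the second functional to the first and back costs \<eta> each time,
    so u is within 2 \<eta> of the minimum of the second one.\<close>
  have "?F u \<le> jko_value \<tau> c1 V1 u0 u + \<eta>"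
    unfolding \<eta>_def L1_dist_commute[of u0] using V_close c_close
    by (intro jko_value_perturb[OF c(2,1) V(2,1) fu fe(2,1) \<tau>]) (smt (verit))+
  also have "jko_value \<tau> c1 V1 u0 u \<le> jko_value \<tau> c1 V1 u0 v"
    using u fv by (simp add: jko_minimizer_def)
  also have "jko_value \<tau> c1 V1 u0 v \<le> ?F v + \<eta>"
    unfolding \<eta>_def using V_close c_close
    by (intro jko_value_perturb[OF c V fv fe \<tau>]) (smt (verit))+
  finally have 1: "?F u \<le> ?F v + 2 * \<eta>" by simp
  have 2: "?F v \<le> ?F ?w" using v fw by (simp add: jko_minimizer_def)
  have "(transport_W c2 ?w v0)\<^sup>2 \<le> ((transport_W c2 u v0)\<^sup>2 + (transport_W c2 v v0)\<^sup>2) / 2"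
    using finite_entropyD(1)[OF fu] finite_entropyD(1)[OF fv] finite_entropyD(1)[OF fe(2)]
    by (intro transport_W_square_convex[OF c(2)])
  then have "1 / (2 * \<tau>) * (transport_W c2 ?w v0)\<^sup>2 \<le>
      1 / (2 * \<tau>) * (((transport_W c2 u v0)\<^sup>2 + (transport_W c2 v v0)\<^sup>2) / 2)"
    using \<tau> by (intro mult_left_mono) auto
  also have "\<dots> = (1 / (2 * \<tau>) * (transport_W c2 u v0)\<^sup>2 + 1 / (2 * \<tau>) * (transport_W c2 v v0)\<^sup>2) / 2"
    by (simp add: add_divide_distrib distrib_left)
  \<comment> \<open>Potential and transport terms are at most their averages at the midpoint, so the
    entropy defect is at most \<open>?F u + ?F v - 2 * ?F ?w\<close>; minimality of v then bounds
    this by \<open>?F u - ?F v\<close>.\<close>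
  finally have "entropy_real u + entropy_real v - 2 * entropy_real ?w \<le> 2 * \<eta>"
    using 1 2 integral_potential_mix[OF V(2) fu fv] unfolding jko_value_def by argo
  then have "(entropy_real u + entropy_real v - 2 * entropy_real ?w) / (2 * s) \<le> 2 * \<eta> / (2 * s)"
    using s by (intro divide_right_mono) auto
  then show ?thesis
    using entropy_mix_measure(2)[OF fu fv s] unfolding \<eta>_def[symmetric] by simp
qed

text \<open>Start from \<mu> paired with itself at cost zero and replace the second marginal; the
  constant bounds the squared distance on the torus.\<close>

lemma W2_square_le_L1_dist:
  fixes \<mu> \<nu> :: "'n::finite torus measure"
  assumes "finite_entropy \<mu>" "finite_entropy \<nu>"
  shows "(W2 \<mu> \<nu>)\<^sup>2 \<le> (real CARD('n))\<^sup>2 * L1_dist \<mu> \<nu>"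
proof -
  note p = finite_entropyD(1)[OF assms(1)] finite_entropyD(1)[OF assms(2)]
  have "(W2 \<mu> \<nu>)\<^sup>2 \<le> (W2 \<mu> \<mu>)\<^sup>2 + (real CARD('n))\<^sup>2 * L1_dist \<mu> \<nu>"
    using transport_W_square_L1[OF bounded_cost_d_Eu sets_torus_lebesgue finite_entropyD(3)[OF assms(1)] _
        finite_entropyD(4)[OF assms(1)] finite_entropyD(3)[OF assms(2)] _ finite_entropyD(4)[OF assms(2)] p(1)] p
    unfolding finite_entropyD(2)[OF assms(1)] finite_entropyD(2)[OF assms(2)] L1_dist_def W2_def by simp
  also have "(W2 \<mu> \<mu>)\<^sup>2 = 0"
    unfolding W2_def by (rule transport_W_self[OF bounded_cost_d_Eu p(1)]) simp
  finally show ?thesis by simp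
qed

section \<open>Time steps and convergence of the scheme\<close>

definition JKO_iterates ::
  "real \<Rightarrow> ('a::topological_space measure \<Rightarrow> ereal) \<Rightarrow> ('a measure \<Rightarrow> 'a measure \<Rightarrow> real) \<Rightarrow>
    'a measure \<Rightarrow> (real \<Rightarrow> 'a measure) \<Rightarrow> (nat \<Rightarrow> 'a measure) \<Rightarrow> bool"
  where "JKO_iterates \<tau> H W \<mu>0 \<mu> m \<longleftrightarrow> m 0 = \<mu>0 \<and>
    (\<forall>n. is_arg_min (\<lambda>\<nu>. H \<nu> + ereal (1 / (2 * \<tau>) * (W \<nu> (m n))\<^sup>2))
      (\<lambda>\<nu>. \<nu> \<in> prob_measures) (m (Suc n))) \<and>
    (\<forall>n t. real n * \<tau> < t \<and> t \<le> real (Suc n) * \<tau> \<longrightarrow> \<mu> t = m (Suc n))"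

text \<open>Shifts the index from n - 1 and n to n and its successor, the form used by the
  induction.\<close>

lemma JKO_solution_imp_iterates:
  assumes "JKO_solution \<tau> H W \<mu>0 \<mu>"
  shows "\<exists>m. JKO_iterates \<tau> H W \<mu>0 \<mu> m"
proof -
  from assms obtain m where m: "m 0 = \<mu>0"
      "\<forall>n\<ge>1. is_arg_min (\<lambda>\<nu>. H \<nu> + ereal (1 / (2 * \<tau>) * (W \<nu> (m (n - 1)))\<^sup>2)) (\<lambda>\<nu>. \<nu> \<in> prob_measures) (m n)"
      "\<forall>n\<ge>1. \<forall>t. (real n - 1) * \<tau> < t \<and> t \<le> real n * \<tau> \<longrightarrow> \<mu> t = m n"
    unfolding JKO_solution_def by (elim exE conjE)
  have "is_arg_min (\<lambda>\<nu>. H \<nu> + ereal (1 / (2 * \<tau>) * (W \<nu> (m n))\<^sup>2)) (\<lambda>\<nu>. \<nu> \<in> prob_measures) (m (Suc n))" for n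
    using m(2)[rule_format, of "Suc n"] by simp
  moreover have "\<mu> t = m (Suc n)" if "real n * \<tau> < t" "t \<le> real (Suc n) * \<tau>" for n t
    using m(3)[rule_format, of "Suc n" t] that by simp
  ultimately show ?thesis using m(1) unfolding JKO_iterates_def by (intro exI[of _ m]) simp
qed

text \<open>The time intervals are open on the left, so the index is the ceiling of t / \<tau> minus
  one; the floor would fail at multiples of \<tau>.\<close>

lemma time_step_index:
  assumes "0 < \<tau>" "0 < (t::real)"
  obtains n where "real n * \<tau> < t" "t \<le> real (Suc n) * \<tau>"
proof -
  define n where "n = nat (\<lceil>t / \<tau>\<rceil> - 1)"
  have "0 < \<lceil>t / \<tau>\<rceil>" using assms by simp
  then have "real n = of_int \<lceil>t / \<tau>\<rceil> - 1" by (simp add: n_def)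
  then have "real n < t / \<tau>" "t / \<tau> \<le> real (Suc n)" by linarith+
  then show ?thesis using assms by (intro that[of n]) (auto simp: field_simps)
qed

lemma bounded_potentialI:
  assumes "continuous_on UNIV (\<lambda>x. V (proj_torus x))" "\<And>x. \<bar>V x\<bar> \<le> B"
  shows "bounded_potential V"
  using borel_measurable_torus[OF assms(1)] assms(2) by (auto simp: bounded_potential_def)

lemma C1_map_imp_continuous_on: "C1_map f \<Longrightarrow> continuous_on S f"
  unfolding C1_map_def by (meson continuous_at_imp_continuous_on has_derivative_continuous)

theorem theorem1p5:
  fixes A :: "real ^ 'n::finite \<Rightarrow> real ^ 'n ^ 'n"
    and \<Lambda>\<^sub>0 \<Lambda>\<^sub>1 lam \<tau> :: real
    and E :: "real set"
    and V\<epsilon> :: "real \<Rightarrow> 'n torus \<Rightarrow> real"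
    and V :: "'n torus \<Rightarrow> real"
    and \<mu>\<^sub>0 :: "'n torus measure"
    and \<mu>\<epsilon> :: "real \<Rightarrow> real \<Rightarrow> 'n torus measure"
    and \<mu>bar :: "real \<Rightarrow> 'n torus measure"
  assumes A_periodic: "lattice_periodic A"
    and A_C2: "C2_map A"
    and Lambda_pos: "\<Lambda>\<^sub>0 > 0" "\<Lambda>\<^sub>1 > 0"
    and A_elliptic: "\<And>x. loewner_le (mat \<Lambda>\<^sub>0) (A x)" "\<And>x. loewner_le (A x) (mat \<Lambda>\<^sub>1)"
    and E_admissible: "\<And>\<epsilon>. \<epsilon> \<in> E \<Longrightarrow> \<epsilon> > 0 \<and> lattice_periodic (\<lambda>x. A (x /\<^sub>R \<epsilon>))"
    and lam_pos: "lam > 0"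
    and V_C1: "\<And>\<epsilon>. \<epsilon> \<in> E \<Longrightarrow> C1_map (\<lambda>x. V\<epsilon> \<epsilon> (proj_torus x))"
    and V_bounds: "\<And>\<epsilon> x. \<epsilon> \<in> E \<Longrightarrow> 0 \<le> V\<epsilon> \<epsilon> x \<and> V\<epsilon> \<epsilon> x \<le> lam"
    and V_gradient: "\<And>\<epsilon> x v. \<epsilon> \<in> E \<Longrightarrow> GDERIV (\<lambda>y. V\<epsilon> \<epsilon> (proj_torus y)) x :> v \<Longrightarrow> norm v \<le> lam"
    and V_limit: "uniform_limit UNIV V\<epsilon> V (at 0 within E)"
    and tau_pos: "\<tau> > 0"
    and mu0: "\<mu>\<^sub>0 \<in> prob_measures" "torus_entropy \<mu>\<^sub>0 < \<infinity>"
    and JKO_eps: "\<And>\<epsilon>. \<epsilon> \<in> E \<Longrightarrow>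
      JKO_solution \<tau> (free_energy (V\<epsilon> \<epsilon>)) (W_eps A \<epsilon>) \<mu>\<^sub>0 (\<mu>\<epsilon> \<epsilon>)"
    and JKO_hom: "JKO_solution \<tau> (free_energy V) (W_GH A) \<mu>\<^sub>0 \<mu>bar"
  shows "\<forall>t>0. ((\<lambda>\<epsilon>. W2 (\<mu>\<epsilon> \<epsilon> t) (\<mu>bar t)) \<longlongrightarrow> 0) (at 0 within E)"
proof (cases "at 0 within E = bot")
  \<comment> \<open>If 0 is not a limit point of E, the limit holds trivially. Otherwise the filter
    is proper, and V can inherit continuity and a bound from the approximating potentials.\<close>
  case True
  then show ?thesis by simp
next
  case False
  interpret elliptic_field A \<Lambda>\<^sub>0 \<Lambda>\<^sub>1
    using A_periodic C2_map_imp_continuous_on[OF A_C2] Lambda_pos A_elliptic by unfold_locales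
  define C where "C = (sqrt (1 / \<Lambda>\<^sub>0) * real CARD('n))\<^sup>2"
  have in_E: "\<forall>\<^sub>F \<epsilon> in at 0 within E. \<epsilon> \<in> E" by (simp add: eventually_at_filter)
  have V\<epsilon>_potential: "bounded_potential (V\<epsilon> \<epsilon>)" if "\<epsilon> \<in> E" for \<epsilon>
    using C1_map_imp_continuous_on[OF V_C1[OF that]] V_bounds[OF that]
    by (intro bounded_potentialI[of _ lam]) auto
  have V_close: "\<forall>\<^sub>F \<epsilon> in at 0 within E. \<forall>x. \<bar>V\<epsilon> \<epsilon> x - V x\<bar> \<le> \<delta>" if "0 < \<delta>" for \<delta>
    using uniform_limitD[OF V_limit that]
    by eventually_elim (auto simp: dist_real_def intro: less_imp_le)
  have V_potential: "bounded_potential V"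
  proof (rule bounded_potentialI)
    have "\<forall>\<^sub>F \<epsilon> in at 0 within E. continuous_on UNIV (\<lambda>x. V\<epsilon> \<epsilon> (proj_torus x))"
      using in_E by eventually_elim (rule C1_map_imp_continuous_on[OF V_C1])
    moreover have "uniform_limit UNIV (\<lambda>\<epsilon> x. V\<epsilon> \<epsilon> (proj_torus x)) (\<lambda>x. V (proj_torus x)) (at 0 within E)"
      using V_limit by (rule uniform_limit_compose') auto
    ultimately show "continuous_on UNIV (\<lambda>x. V (proj_torus x))"
      using False by (rule uniform_limit_theorem)
    from eventually_happens'[OF False eventually_conj[OF in_E V_close[OF zero_less_one]]]
    obtain \<epsilon> where "\<epsilon> \<in> E" "\<And>x. \<bar>V\<epsilon> \<epsilon> x - V x\<bar> \<le> 1" by auto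
    then show "\<bar>V x\<bar> \<le> lam + 1" for x
      using V_bounds[OF \<open>\<epsilon> \<in> E\<close>, of x] by (smt (verit))
  qed
  have cost_close: "\<forall>\<^sub>F \<epsilon> in at 0 within E. \<forall>X Y. \<bar>cost_eps A \<epsilon> X Y - cost_hom A X Y\<bar> \<le> \<delta>" if "0 < \<delta>" for \<delta>
  \<comment> \<open>E lies to the right of 0, so the limit from the right applies along E.\<close>
  proof (rule filter_leD[OF at_le cost_eps_uniform_limit[OF that]])
    show "E \<subseteq> {0<..}" using E_admissible by auto
  qed
  have "\<forall>\<epsilon>\<in>E. \<exists>m. JKO_iterates \<tau> (free_energy (V\<epsilon> \<epsilon>)) (W_eps A \<epsilon>) \<mu>\<^sub>0 (\<mu>\<epsilon> \<epsilon>) m"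
    using JKO_solution_imp_iterates[OF JKO_eps] by blast
  \<comment> \<open>Iterates exist for each \<epsilon> separately; choosing them for all \<epsilon>
    at once makes the n-th iterate a function of \<epsilon>, whose limit can be studied.\<close>
  from bchoice[OF this] obtain m
    where m: "\<And>\<epsilon>. \<epsilon> \<in> E \<Longrightarrow> JKO_iterates \<tau> (free_energy (V\<epsilon> \<epsilon>)) (W_eps A \<epsilon>) \<mu>\<^sub>0 (\<mu>\<epsilon> \<epsilon>) (m \<epsilon>)"
    by blast
  obtain b where b: "JKO_iterates \<tau> (free_energy V) (W_GH A) \<mu>\<^sub>0 \<mu>bar b"
    using JKO_solution_imp_iterates[OF JKO_hom] by blast
  have fe0: "finite_entropy \<mu>\<^sub>0" using mu0 by (simp add: finite_entropy_def)
  have m_jko: "jko_minimizer \<tau> (cost_eps A \<epsilon>) (V\<epsilon> \<epsilon>) (m \<epsilon> n) (m \<epsilon> (Suc n))" if "\<epsilon> \<in> E" for \<epsilon> n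
    using m[OF that] by (intro jko_minimizerI[OF _ fe0]) (simp add: JKO_iterates_def W_eps_def)
  have b_jko: "jko_minimizer \<tau> (cost_hom A) V (b n) (b (Suc n))" for n
    using b by (intro jko_minimizerI[OF _ fe0]) (simp add: JKO_iterates_def W_GH_def)
  have m0: "m \<epsilon> 0 = \<mu>\<^sub>0" if "\<epsilon> \<in> E" for \<epsilon> using m[OF that] by (simp add: JKO_iterates_def)
  have b0: "b 0 = \<mu>\<^sub>0" using b by (simp add: JKO_iterates_def)
  have m_fe: "finite_entropy (m \<epsilon> n)" if "\<epsilon> \<in> E" for \<epsilon> n
    using m_jko[OF that] m0[OF that] fe0 by (cases n) (auto simp: jko_minimizer_def)
  have b_fe: "finite_entropy (b n)" for n
    using b_jko b0 fe0 by (cases n) (auto simp: jko_minimizer_def)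
  have conv: "((\<lambda>\<epsilon>. L1_dist (m \<epsilon> n) (b n)) \<longlongrightarrow> 0) (at 0 within E)" for n
  proof (induction n)
    case 0
    have "\<forall>\<^sub>F \<epsilon> in at 0 within E. L1_dist (m \<epsilon> 0) (b 0) = 0"
      using in_E by eventually_elim (simp add: m0 b0 L1_dist_def)
    then show ?case by (rule tendsto_eventually)
  next
    case (Suc n)
    show ?case
    proof (rule order_tendstoI)
      fix r :: real assume "r < 0"
      then show "\<forall>\<^sub>F \<epsilon> in at 0 within E. r < L1_dist (m \<epsilon> (Suc n)) (b (Suc n))"
        by (intro always_eventually allI) (rule less_le_trans[OF _ L1_dist_nonneg])
    next
      fix r :: real assume r: "0 < r"
      \<comment> \<open>If the errors of potential, cost and previous iterate are all at most
        \<theta>, the functional changes by at most \<theta> D. With s = r / 8 the stability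
        estimate gives 4 s = r / 2, and the choice of \<theta> makes \<theta> D / s = r / 4,
        together less than r.\<close>
      define D where "D = 1 + 1 / (2 * \<tau>) * (1 + C)"
      define \<theta> where "\<theta> = (r / 8) * (r / 4) / D"
      have D: "0 < D" using tau_pos by (simp add: D_def C_def add_pos_nonneg)
      have \<theta>: "0 < \<theta>" using r D by (simp add: \<theta>_def)
      have "\<forall>\<^sub>F \<epsilon> in at 0 within E. L1_dist (m \<epsilon> n) (b n) < \<theta>"
        using Suc \<theta> by (rule order_tendstoD(2))
      with in_E V_close[OF \<theta>] cost_close[OF \<theta>]
      show "\<forall>\<^sub>F \<epsilon> in at 0 within E. L1_dist (m \<epsilon> (Suc n)) (b (Suc n)) < r"
      proof eventually_elim
        case (elim \<epsilon>)
        have \<epsilon>: "0 < \<epsilon>" using E_admissible elim(1) by blast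
        have "L1_dist (m \<epsilon> (Suc n)) (b (Suc n)) \<le>
            4 * (r / 8) + (\<theta> + 1 / (2 * \<tau>) * (\<theta> + C * L1_dist (m \<epsilon> n) (b n))) / (r / 8)"
          using elim(2,3) r bounded_cost_eps[OF \<epsilon>] bounded_cost_hom unfolding C_def[symmetric]
          by (intro jko_minimizer_stable[OF _ _ V\<epsilon>_potential[OF elim(1)] V_potential m_fe[OF elim(1)] b_fe tau_pos
                _ _ m_jko[OF elim(1)] b_jko]) auto
        also have "\<dots> \<le> 4 * (r / 8) + (\<theta> + 1 / (2 * \<tau>) * (\<theta> + C * \<theta>)) / (r / 8)"
          using elim(4) r tau_pos
          by (intro add_left_mono divide_right_mono mult_left_mono) (auto simp: C_def)
        also have "\<theta> + 1 / (2 * \<tau>) * (\<theta> + C * \<theta>) = \<theta> * D"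
          by (simp add: D_def algebra_simps)
        also have "\<theta> * D = (r / 8) * (r / 4)" using D by (simp add: \<theta>_def)
        also have "4 * (r / 8) + (r / 8) * (r / 4) / (r / 8) < r" using r by simp
        finally show ?case .
      qed
    qed
  qed
  show ?thesis
  proof (intro allI impI)
    fix t :: real assume "0 < t"
    from time_step_index[OF tau_pos this]
    obtain n where n: "real n * \<tau> < t" "t \<le> real (Suc n) * \<tau>" .
    have le: "\<forall>\<^sub>F \<epsilon> in at 0 within E. (W2 (\<mu>\<epsilon> \<epsilon> t) (\<mu>bar t))\<^sup>2 \<le>
        (real CARD('n))\<^sup>2 * L1_dist (m \<epsilon> (Suc n)) (b (Suc n))"
      using in_E
    proof eventually_elim
      case (elim \<epsilon>)
      have "\<mu>\<epsilon> \<epsilon> t = m \<epsilon> (Suc n)" "\<mu>bar t = b (Suc n)"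
        using m[OF elim] b n unfolding JKO_iterates_def by blast+
      then show ?case
        by (simp only:) (rule W2_square_le_L1_dist[OF m_fe[OF elim] b_fe])
    qed
    have "((\<lambda>\<epsilon>. (real CARD('n))\<^sup>2 * L1_dist (m \<epsilon> (Suc n)) (b (Suc n))) \<longlongrightarrow> (real CARD('n))\<^sup>2 * 0) (at 0 within E)"
      by (intro tendsto_intros conv)
    then have "((\<lambda>\<epsilon>. (real CARD('n))\<^sup>2 * L1_dist (m \<epsilon> (Suc n)) (b (Suc n))) \<longlongrightarrow> 0) (at 0 within E)" by simp
    with le have "((\<lambda>\<epsilon>. (W2 (\<mu>\<epsilon> \<epsilon> t) (\<mu>bar t))\<^sup>2) \<longlongrightarrow> 0) (at 0 within E)"
      by (intro tendsto_sandwich[OF _ le tendsto_const]) auto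
    then have "((\<lambda>\<epsilon>. sqrt ((W2 (\<mu>\<epsilon> \<epsilon> t) (\<mu>bar t))\<^sup>2)) \<longlongrightarrow> sqrt 0) (at 0 within E)"
      by (rule tendsto_real_sqrt)
    then show "((\<lambda>\<epsilon>. W2 (\<mu>\<epsilon> \<epsilon> t) (\<mu>bar t)) \<longlongrightarrow> 0) (at 0 within E)"
      by (simp add: tendsto_rabs_zero_iff)
  qed
qed

end
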